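(* Let $a,p,c,\gamma>0$ with $c<\min(a,p)$, and let the random arrival rates be $\Lambda^\lambda=\lambda+X\sqrt{\lambda}\ge 0$ with $E[X]=0$ and $E|X|<\infty$. Let $\beta^\star\in\mathbb{R}$ be a minimizer over $\beta\in(-\infty,\infty)$ of $c\beta+E[\hat z(\beta-X,\hat T^\star(\beta-X))]$, and put $$\hat{\mathcal C}^\star:=c\beta^\star+E\left[\hat z(\beta^\star-X,\hat T^\star(\beta^\star-X))\right].$$ Let $\mathbf{u}^\star=(\mathbf{N}^\star,\boldsymbol{\tau}^\star)=\{(N^{\lambda,\star},\tau(T^{\lambda,\star}))\}$ be the policy with staffing level $N^{\lambda,\star}=\lambda+\beta^\star\sqrt{\lambda}$ (rounded to the nearest integer) which, when the arrival rate realizes as $l^\lambda(x)=\lambda+x\sqrt\lambda$, uses threshold routing with threshold $$T^{\lambda,\star}=N^{\lambda,\star}+\hat T^\star(\beta^\star-x)\sqrt{l^\lambda(x)}.$$ Then $\mathbf{u}^\star$ is asymptotically optimal; that is, under any other admissible policy $\mathbf{u}$, $$\liminf_{\lambda\to\infty}\hat{\mathcal C}^\lambda(\mathbf{u})\ \ge\ \hat{\mathcal C}^\star .$$ Furthermore, $$\frac{cN^{\lambda,\star}+E\left[z^\lambda_{\boldsymbol{\tau}^\star}(\mathbf{N}^\star,\Lambda^\lambda)\right]-\mathcal C^{\lambda,\mathrm{opt}}}{\sqrt\lambda}\to 0\quad\text{as }\lambda\to\infty .$$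
   Context: Single-system model. Fix costs: $c$ per server per unit time (staffing), $p$ per outsourced call, $a$ per abandonment; mean service time $1$; patience is exponential with mean $1/\gamma$. For a staffing level $N\in\{0,1,2,\dots\}$, a realized arrival rate $l\ge 0$ and a routing policy $\pi=(\pi_n)_{n\ge 0}\in\Pi:=[0,1]^{\{0,1,2,\dots\}}$ ($\pi_n$ is the probability that a call arriving when $n$ customers are present is accepted; otherwise it is outsourced), the number in system is a birth-death process with birth rate $l\pi_n$ and death rate $\mu_n=\min(N,n)+\gamma[n-N]^+$ in state $n$. Its stationary distribution is $\theta_k\propto\prod_{i=1}^k (l\pi_{i-1}/\mu_i)$, $k\ge0$. Write $P_\pi(\mathrm{out};l)=\sum_n\theta_n(1-\pi_n)$ for the steady-state probability that an arriving call is outsourced, and $lP_\pi(\mathrm{ab};l)=\gamma\sum_n[n-N]^+\theta_n$ for the steady-state abandonment rate. The long-run average operating cost is $$z_\pi(N,l)=p\,l\,P_\pi(\mathrm{out};l)+a\,l\,P_\pi(\mathrm{ab};l).$$ For $T\in[0,\infty]$, the threshold policy $\tau(T)=(\tau_n(T))_{n\ge0}$ has $\tau_n(T)=1$ if $n<T$ and $\tau_n(T)=0$ if $n\ge T$. Sequence of systems. The systems are indexed by the mean arrival rate $\lambda\to\infty$, with random arrival rate $\Lambda^\lambda=\lambda+X\sqrt\lambda$, where the law of $X$ does not depend on $\lambda$. Arrival rates are non-negative, so only values of $\lambda$ with $X\ge-\sqrt\lambda$ a.s. are considered, and it is assumed this holds for all sufficiently large $\lambda$. An admissible policy $\mathbf{u}=(\mathbf{N},\boldsymbol{\pi})=\{(N^\lambda,\pi^\lambda)\}$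 specifies for each $\lambda$ a non-negative integer $N^\lambda$ (chosen before the arrival rate is known) and, for each realization $x$ of $X$, a routing policy $\pi^\lambda=\pi^\lambda(N^\lambda,l^\lambda(x))\in\Pi$, where $l^\lambda(x)=\lambda+x\sqrt\lambda$ (depending measurably on $x$). $z^\lambda_{\boldsymbol{\pi}}(\mathbf{N},l^\lambda(x))$ denotes $z_{\pi^\lambda}(N^\lambda,l^\lambda(x))$, and $z^\lambda_{\boldsymbol{\pi}}(\mathbf{N},\Lambda^\lambda)$ is the associated random variable, with $x$ replaced by $X$. The diffusion-scaled cost is $$\hat{\mathcal C}^\lambda(\mathbf{u}):=\sqrt\lambda\left(\frac{cN^\lambda+E[z^\lambda_{\boldsymbol\pi}(\mathbf{N},\Lambda^\lambda)]}{\lambda}-c\right).$$ An admissible policy $\mathbf{u}^\star$ is asymptotically optimal if $\limsup_{\lambda\to\infty}\hat{\mathcal C}^\lambda(\mathbf{u}^\star)<\infty$ and $\limsup_{\lambda\to\infty}\hat{\mathcal C}^\lambda(\mathbf{u}^\star)\le\liminf_{\lambda\to\infty}\hat{\mathcal C}^\lambda(\mathbf{u})$ for every admissible policy $\mathbf{u}$. The minimum cost in the system with mean arrival rate $\lambda$ is $$\mathcal C^{\lambda,\mathrm{opt}}:=\min_{N\in\{0,1,2,\dots\}}\left(cN+E\left[\inf_{\pi\in\Pi}z_\pi(N,\Lambda^\lambda)\right]\right),$$ where the infimum is taken separately for each realization of $\Lambda^\lambda$. Limiting cost. With $\phi,\Phi$ the standard normal pdf and cdf, for $m\in\mathbb{R}$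 and $\hat T\in[0,\infty)$ let $\hat z(m,\hat T)=A(m,\hat T)/B(m,\hat T)$, where, with $v=\sqrt\gamma(\hat T+m/\gamma)$, $$A=p\,\phi(v)+a\left[\phi\left(\tfrac{m}{\sqrt\gamma}\right)-\phi(v)+\tfrac{m}{\sqrt\gamma}\left(\Phi\left(\tfrac{m}{\sqrt\gamma}\right)-\Phi(v)\right)\right],$$ $$B=\frac{\phi(m/\sqrt\gamma)}{\phi(m)}\Phi(m)+\frac1{\sqrt\gamma}\left(\Phi(v)-\Phi\left(\tfrac m{\sqrt\gamma}\right)\right),$$ and $\hat z(m,\infty):=\lim_{\hat T\to\infty}\hat z(m,\hat T)$. If $p<a$, $\hat T^\star(m)$ is the unique $\hat T\in[0,\infty)$ solving $(a-p)\gamma\hat T-\hat z(m,\hat T)=pm$ (existence and uniqueness are known); if $a\le p$, $\hat T^\star(m)=\infty$. In both cases $\hat T^\star(m)$ minimizes $\hat z(m,\cdot)$. A minimizer $\beta^\star$ exists. *)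

theory Defs
  imports "HOL-Probability.Probability"
begin

section \<open>Single system\<close>

definition routing_policies :: "(nat \<Rightarrow> real) set" where
  "routing_policies = {\<pi>. \<forall>n. 0 \<le> \<pi> n \<and> \<pi> n \<le> 1}"

definition threshold_policy :: "ereal \<Rightarrow> nat \<Rightarrow> real" where
  "threshold_policy T n = (if ereal (real n) < T then 1 else 0)"

(* Subtraction on nat truncates, so real (n - N) is the positive part of n - N. *)
definition death_rate :: "real \<Rightarrow> nat \<Rightarrow> nat \<Rightarrow> real" where
  "death_rate \<gamma> N n = real (min N n) + \<gamma> * real (n - N)"

definition stationary_weight ::
    "real \<Rightarrow> (nat \<Rightarrow> real) \<Rightarrow> nat \<Rightarrow> real \<Rightarrow> nat \<Rightarrow> real" where
  "stationary_weight \<gamma> \<pi> N l k = (\<Prod>i = 1..k. l * \<pi> (i - 1) / death_rate \<gamma> N i)"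

(* For l >= 0 and gamma > 0 the normalizing series converges, with value at least 1. *)
definition stationary_prob ::
    "real \<Rightarrow> (nat \<Rightarrow> real) \<Rightarrow> nat \<Rightarrow> real \<Rightarrow> nat \<Rightarrow> real" where
  "stationary_prob \<gamma> \<pi> N l k =
     stationary_weight \<gamma> \<pi> N l k / (\<Sum>j. stationary_weight \<gamma> \<pi> N l j)"

definition outsourcing_prob :: "real \<Rightarrow> (nat \<Rightarrow> real) \<Rightarrow> nat \<Rightarrow> real \<Rightarrow> real" where
  "outsourcing_prob \<gamma> \<pi> N l = (\<Sum>n. stationary_prob \<gamma> \<pi> N l n * (1 - \<pi> n))"

definition abandonment_rate :: "real \<Rightarrow> (nat \<Rightarrow> real) \<Rightarrow> nat \<Rightarrow> real \<Rightarrow> real" where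
  "abandonment_rate \<gamma> \<pi> N l = \<gamma> * (\<Sum>n. real (n - N) * stationary_prob \<gamma> \<pi> N l n)"

definition operating_cost ::
    "real \<Rightarrow> real \<Rightarrow> real \<Rightarrow> (nat \<Rightarrow> real) \<Rightarrow> nat \<Rightarrow> real \<Rightarrow> real" where
  "operating_cost p a \<gamma> \<pi> N l =
     p * l * outsourcing_prob \<gamma> \<pi> N l + a * abandonment_rate \<gamma> \<pi> N l"

section \<open>Sequence of systems\<close>

(* Only systems with lam + x * sqrt lam >= 0 for almost every realization x are considered, so
   the truncation at 0 changes the arrival rate on a null set only.  It is there because the
   Bochner integral of a function that fails to be measurable on a null set is 0. *)
definition arrival_rate :: "real \<Rightarrow> real \<Rightarrow> real" where
  "arrival_rate lam x = max 0 (lam + x * sqrt lam)"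

(* Staffing level for each mean arrival rate; routing policy for each mean arrival rate and
   each realization x of X. *)
type_synonym policy = "(real \<Rightarrow> nat) \<times> (real \<Rightarrow> real \<Rightarrow> nat \<Rightarrow> real)"

definition admissible :: "policy \<Rightarrow> bool" where
  "admissible u \<longleftrightarrow>
     (\<forall>lam x. snd u lam x \<in> routing_policies) \<and>
     (\<forall>lam n. (\<lambda>x. snd u lam x n) \<in> borel_measurable borel)"

definition total_cost ::
    "real \<Rightarrow> real \<Rightarrow> real \<Rightarrow> real \<Rightarrow> 'a measure \<Rightarrow> ('a \<Rightarrow> real) \<Rightarrow> policy \<Rightarrow> real \<Rightarrow> real" where
  "total_cost c p a \<gamma> M X u lam =
     c * real (fst u lam) +
     (\<integral>\<omega>. operating_cost p a \<gamma> (snd u lam (X \<omega>)) (fst u lam) (arrival_rate lam (X \<omega>)) \<partial>M)"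

definition scaled_cost ::
    "real \<Rightarrow> real \<Rightarrow> real \<Rightarrow> real \<Rightarrow> 'a measure \<Rightarrow> ('a \<Rightarrow> real) \<Rightarrow> policy \<Rightarrow> real \<Rightarrow> real" where
  "scaled_cost c p a \<gamma> M X u lam = sqrt lam * (total_cost c p a \<gamma> M X u lam / lam - c)"

definition asymptotically_optimal ::
    "real \<Rightarrow> real \<Rightarrow> real \<Rightarrow> real \<Rightarrow> 'a measure \<Rightarrow> ('a \<Rightarrow> real) \<Rightarrow> policy \<Rightarrow> bool" where
  "asymptotically_optimal c p a \<gamma> M X u \<longleftrightarrow>
     admissible u \<and>
     Limsup at_top (\<lambda>lam. ereal (scaled_cost c p a \<gamma> M X u lam)) < \<infinity> \<and>
     (\<forall>u'. admissible u' \<longrightarrow>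
        Limsup at_top (\<lambda>lam. ereal (scaled_cost c p a \<gamma> M X u lam))
          \<le> Liminf at_top (\<lambda>lam. ereal (scaled_cost c p a \<gamma> M X u' lam)))"

(* Both infima are of nonempty sets of nonnegative reals; the outer one is attained for c > 0
   because the cost then tends to infinity with N. *)
definition min_cost ::
    "real \<Rightarrow> real \<Rightarrow> real \<Rightarrow> real \<Rightarrow> 'a measure \<Rightarrow> ('a \<Rightarrow> real) \<Rightarrow> real \<Rightarrow> real" where
  "min_cost c p a \<gamma> M X lam =
     (INF N. c * real N +
        (\<integral>\<omega>. (INF \<pi>\<in>routing_policies.
               operating_cost p a \<gamma> \<pi> N (arrival_rate lam (X \<omega>))) \<partial>M))"

section \<open>Limiting cost\<close>

abbreviation std_normal_cdf :: "real \<Rightarrow> real" where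
  "std_normal_cdf \<equiv> cdf std_normal_distribution"

definition zhat_num :: "real \<Rightarrow> real \<Rightarrow> real \<Rightarrow> real \<Rightarrow> real \<Rightarrow> real" where
  "zhat_num p a \<gamma> m T =
     (let v = sqrt \<gamma> * (T + m / \<gamma>); w = m / sqrt \<gamma> in
      p * std_normal_density v +
      a * (std_normal_density w - std_normal_density v
           + w * (std_normal_cdf w - std_normal_cdf v)))"

definition zhat_den :: "real \<Rightarrow> real \<Rightarrow> real \<Rightarrow> real" where
  "zhat_den \<gamma> m T =
     (let v = sqrt \<gamma> * (T + m / \<gamma>); w = m / sqrt \<gamma> in
      std_normal_density w / std_normal_density m * std_normal_cdf m
      + 1 / sqrt \<gamma> * (std_normal_cdf v - std_normal_cdf w))"

definition zhat_real :: "real \<Rightarrow> real \<Rightarrow> real \<Rightarrow> real \<Rightarrow> real \<Rightarrow> real" where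
  "zhat_real p a \<gamma> m T = zhat_num p a \<gamma> m T / zhat_den \<gamma> m T"

definition zhat :: "real \<Rightarrow> real \<Rightarrow> real \<Rightarrow> real \<Rightarrow> ereal \<Rightarrow> real" where
  "zhat p a \<gamma> m T =
     (if T = \<infinity> then Lim at_top (zhat_real p a \<gamma> m)
      else zhat_real p a \<gamma> m (real_of_ereal T))"

definition That_star :: "real \<Rightarrow> real \<Rightarrow> real \<Rightarrow> real \<Rightarrow> ereal" where
  "That_star p a \<gamma> m =
     (if p < a
      then ereal (THE T. 0 \<le> T \<and> (a - p) * \<gamma> * T - zhat_real p a \<gamma> m T = p * m)
      else \<infinity>)"

definition limit_cost ::
    "real \<Rightarrow> real \<Rightarrow> real \<Rightarrow> real \<Rightarrow> 'a measure \<Rightarrow> ('a \<Rightarrow> real) \<Rightarrow> real \<Rightarrow> real" where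
  "limit_cost c p a \<gamma> M X \<beta> =
     c * \<beta> + (\<integral>\<omega>. zhat p a \<gamma> (\<beta> - X \<omega>) (That_star p a \<gamma> (\<beta> - X \<omega>)) \<partial>M)"

section \<open>The proposed policy\<close>

(* For fixed beta the staffing level is positive once lam is large, so nat truncates only
   for small lam. *)
definition star_staffing :: "real \<Rightarrow> real \<Rightarrow> nat" where
  "star_staffing \<beta> lam = nat (round (lam + \<beta> * sqrt lam))"

(* If the scaled threshold is infinite and the arrival rate is 0, the product below is 0 in
   ereal; no calls arrive then, so every routing policy has operating cost 0. *)
definition star_threshold :: "real \<Rightarrow> real \<Rightarrow> real \<Rightarrow> real \<Rightarrow> real \<Rightarrow> real \<Rightarrow> ereal" where
  "star_threshold p a \<gamma> \<beta> lam x =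
     ereal (real (star_staffing \<beta> lam))
     + That_star p a \<gamma> (\<beta> - x) * ereal (sqrt (arrival_rate lam x))"

definition star_policy :: "real \<Rightarrow> real \<Rightarrow> real \<Rightarrow> real \<Rightarrow> policy" where
  "star_policy p a \<gamma> \<beta> =
     (star_staffing \<beta>, \<lambda>lam x. threshold_policy (star_threshold p a \<gamma> \<beta> lam x))"

end

theory Submission
  imports Defs "HOL-Real_Asymp.Real_Asymp"
begin

text \<open>By detailed balance the outsourcing cost is \<open>p l\<close> minus \<open>p\<close> times the mean death rate, so a
  routing policy earns the average of a reward that depends on the state only. Its stationary law is a
  mixture of the stationary laws of threshold policies, so for each \<open>N\<close> and \<open>l\<close> the optimal cost is
  an infimum over thresholds. With \<open>N = l + m sqrt l\<close> and threshold \<open>N + t sqrt l\<close> the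
  stationary weights, normalised at \<open>N\<close>, converge to Gaussian exponentials and their sums to
  Gaussian integrals, so the cost divided by \<open>sqrt l\<close> tends to \<open>zhat_real p a \<gamma> m t\<close>. For \<open>p < a\<close> a
  lower bound on the optimal cost can be tested at a single threshold; for \<open>a \<le> p\<close> never
  outsourcing is optimal.

  Bounds derived from the Erlang loss recursion dominate the scaled cost by an affine function of \<open>\<bar>X\<bar>\<close>,
  so expectations converge as well. Scaled staffing levels with bounded cost are bounded, so any
  policy sequence can be compared with the minimiser of the limiting cost along a subsequence.\<close>

section \<open>Costs of general and of threshold policies\<close>

text \<open>The obstacle is the exchange of the infimum over routing policies with the heavy-traffic
  limit. For \<open>p < a\<close> a test level \<open>z\<close> itself selects the threshold at
  which it must be checked: as a function of the state, the net cost falls below \<open>z\<close>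
  and returns to it at queue length \<open>(z + p * (N - l)) / ((a - p) * \<gamma>)\<close>, so the
  summed excess over \<open>z\<close> is smallest there or at the empty sum. Scaled by
  \<open>sqrt l\<close>, this formula becomes the equation that defines the optimal limiting
  threshold. For \<open>a \<le> p\<close> the infimum is approached at infinite thresholds. There
  the cost with outsourcing price 0 increases in the threshold while the full cost decreases, and
  both have the same limit, so one large finite threshold bounds the costs of all thresholds from
  below. Only \<open>E|X|\<close> is known to be finite, so the dominating function must be linear
  in \<open>X\<close>. The trivial cost bound of order \<open>l\<close> is too large by a factor
  \<open>sqrt l\<close>; the Erlang loss supplies \<open>max 0 (l - N) + sqrt l\<close>. The
  limiting cost is defined through \<open>THE\<close> and \<open>Lim\<close>, and its measurability
  comes from its being a pointwise limit of optimal costs.\<close>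

abbreviation free_weight :: "real \<Rightarrow> nat \<Rightarrow> real \<Rightarrow> nat \<Rightarrow> real" where
  "free_weight \<gamma> \<equiv> stationary_weight \<gamma> (\<lambda>_. 1)"

definition net_cost :: "real \<Rightarrow> real \<Rightarrow> real \<Rightarrow> nat \<Rightarrow> real \<Rightarrow> nat \<Rightarrow> real" where
  "net_cost p a \<gamma> N l k = p * l - p * death_rate \<gamma> N k + a * \<gamma> * real (k - N)"

text \<open>The call arriving in state \<open>K - 1\<close> is still accepted, so the chain lives on
  \<open>0..K\<close>, both ends included. Truncating a birth-death chain keeps the ratios of its
  weights, so the free weights can be used.\<close>

definition threshold_cost :: "real \<Rightarrow> real \<Rightarrow> real \<Rightarrow> nat \<Rightarrow> real \<Rightarrow> nat \<Rightarrow> real" where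
  "threshold_cost p a \<gamma> N l K =
     (\<Sum>k\<le>K. free_weight \<gamma> N l k * net_cost p a \<gamma> N l k) / (\<Sum>k\<le>K. free_weight \<gamma> N l k)"

definition opt_cost :: "real \<Rightarrow> real \<Rightarrow> real \<Rightarrow> nat \<Rightarrow> real \<Rightarrow> real" where
  "opt_cost p a \<gamma> N l = (INF \<pi>\<in>routing_policies. operating_cost p a \<gamma> \<pi> N l)"

section \<open>Stationary weights: positivity, summability and flow balance\<close>

lemma death_rate_0 [simp]: "death_rate \<gamma> N 0 = 0"
  by (simp add: death_rate_def)

text \<open>A death rate that grows at least linearly makes the weights at most those of an
  exponential series, uniformly in the routing policy. This is the source of all summability
  below.\<close>

lemma death_rate_ge:
  assumes "\<gamma> > 0"
  shows "min 1 \<gamma> * real k \<le> death_rate \<gamma> N k"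
proof -
  have "min 1 \<gamma> * real k = min 1 \<gamma> * real (min N k) + min 1 \<gamma> * real (k - N)"
    by (cases "k \<le> N") (auto simp: min_absorb1 min_absorb2 of_nat_diff algebra_simps)
  also have "\<dots> \<le> 1 * real (min N k) + \<gamma> * real (k - N)"
    by (intro add_mono mult_right_mono) auto
  finally show ?thesis by (simp add: death_rate_def)
qed

lemma death_rate_nonneg: "\<gamma> > 0 \<Longrightarrow> 0 \<le> death_rate \<gamma> N k"
  by (simp add: death_rate_def)

lemma death_rate_pos: "\<gamma> > 0 \<Longrightarrow> k > 0 \<Longrightarrow> 0 < death_rate \<gamma> N k"
  using death_rate_ge[of \<gamma> k N] by (smt (verit) mult_pos_pos of_nat_0_less_iff min_def)

lemma stationary_weight_0 [simp]: "stationary_weight \<gamma> \<pi> N l 0 = 1"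
  by (simp add: stationary_weight_def)

lemma stationary_weight_Suc:
  "stationary_weight \<gamma> \<pi> N l (Suc k) =
     stationary_weight \<gamma> \<pi> N l k * (l * \<pi> k / death_rate \<gamma> N (Suc k))"
  by (simp add: stationary_weight_def)

lemma detailed_balance:
  "\<gamma> > 0 \<Longrightarrow> death_rate \<gamma> N (Suc k) * stationary_weight \<gamma> \<pi> N l (Suc k) =
     l * \<pi> k * stationary_weight \<gamma> \<pi> N l k"
  using death_rate_pos[of \<gamma> "Suc k" N] by (simp add: stationary_weight_Suc)

lemma stationary_weight_eq:
  "stationary_weight \<gamma> \<pi> N l k = free_weight \<gamma> N l k * (\<Prod>i<k. \<pi> i)"
  by (induction k) (simp_all add: stationary_weight_Suc algebra_simps)

lemma routing_policiesD:
  assumes "\<pi> \<in> routing_policies"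
  shows "0 \<le> \<pi> n" "\<pi> n \<le> 1"
  using assms by (auto simp: routing_policies_def)

lemma free_policy [simp]: "(\<lambda>_. 1) \<in> routing_policies"
  by (simp add: routing_policies_def)

lemma threshold_policy_routing [simp]: "threshold_policy T \<in> routing_policies"
  by (simp add: routing_policies_def threshold_policy_def)

lemma stationary_weight_nonneg:
  assumes "\<gamma> > 0" "l \<ge> 0" "\<pi> \<in> routing_policies"
  shows "0 \<le> stationary_weight \<gamma> \<pi> N l k"
  unfolding stationary_weight_def
  using assms by (intro prod_nonneg ballI divide_nonneg_nonneg mult_nonneg_nonneg death_rate_nonneg)
    (auto dest: routing_policiesD)

lemma free_weight_pos:
  assumes "\<gamma> > 0" "l > 0"
  shows "0 < free_weight \<gamma> N l k"
  unfolding stationary_weight_def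
  using assms by (intro prod_pos) (auto intro!: divide_pos_pos death_rate_pos)

lemma stationary_weight_le:
  assumes "\<gamma> > 0" "l \<ge> 0" "\<pi> \<in> routing_policies"
  shows "stationary_weight \<gamma> \<pi> N l k \<le> (l / min 1 \<gamma>) ^ k / fact k"
proof (induction k)
  case (Suc k)
  let ?g = "min 1 \<gamma>"
  have g: "?g > 0" using assms by simp
  have 1: "l * \<pi> k / death_rate \<gamma> N (Suc k) \<le> l / (?g * real (Suc k))"
  proof (rule frac_le)
    show "l * \<pi> k \<le> l" using assms routing_policiesD[of \<pi> k] by (simp add: mult_left_le)
    show "?g * real (Suc k) \<le> death_rate \<gamma> N (Suc k)" by (rule death_rate_ge) fact
  qed (use g assms in auto)
  have "stationary_weight \<gamma> \<pi> N l (Suc k) \<le> (l / ?g) ^ k / fact k * (l / (?g * real (Suc k)))"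
    unfolding stationary_weight_Suc
    using 1 Suc assms g death_rate_nonneg[of \<gamma> N "Suc k"] routing_policiesD[of \<pi> k]
    by (intro mult_mono) auto
  also have "\<dots> = (l / ?g) ^ Suc k / fact (Suc k)"
    by (simp add: field_simps)
  finally show ?case .
qed simp

lemma summable_stationary_weight:
  assumes "\<gamma> > 0" "l \<ge> 0" "\<pi> \<in> routing_policies"
  shows "summable (stationary_weight \<gamma> \<pi> N l)"
proof (rule summable_comparison_test)
  show "\<exists>N'. \<forall>n\<ge>N'. norm (stationary_weight \<gamma> \<pi> N l n) \<le> (l / min 1 \<gamma>) ^ n / fact n"
    using stationary_weight_nonneg[OF assms] stationary_weight_le[OF assms] by auto
  show "summable (\<lambda>n. (l / min 1 \<gamma>) ^ n / fact n)"
    using summable_exp[of "l / min 1 \<gamma>"] by (simp add: field_simps)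
qed

lemma total_weight_ge_1:
  assumes "\<gamma> > 0" "l \<ge> 0" "\<pi> \<in> routing_policies"
  shows "1 \<le> (\<Sum>k. stationary_weight \<gamma> \<pi> N l k)"
proof -
  have "sum (stationary_weight \<gamma> \<pi> N l) {0} \<le> (\<Sum>k. stationary_weight \<gamma> \<pi> N l k)"
    by (intro sum_le_suminf summable_stationary_weight assms)
       (auto intro: stationary_weight_nonneg assms)
  thus ?thesis by simp
qed

lemma partial_weight_ge_1:
  assumes "\<gamma> > 0" "l \<ge> 0"
  shows "1 \<le> (\<Sum>k\<le>K. free_weight \<gamma> N l k)"
proof -
  have "sum (free_weight \<gamma> N l) {0} \<le> (\<Sum>k\<le>K. free_weight \<gamma> N l k)"
    by (intro sum_mono2) (auto intro: stationary_weight_nonneg assms)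
  thus ?thesis by simp
qed

lemma summable_policy_weight:
  assumes "\<gamma> > 0" "l \<ge> 0" "\<pi> \<in> routing_policies"
  shows "summable (\<lambda>k. \<pi> k * stationary_weight \<gamma> \<pi> N l k)"
  using routing_policiesD[OF assms(3)] stationary_weight_nonneg[OF assms, of N]
  by (intro summable_comparison_test[OF _ summable_stationary_weight[OF assms, of N]])
     (auto simp: abs_mult intro!: mult_left_le_one_le exI[of _ 0])

text \<open>Detailed balance summed over all states, shifted by one index; state 0 contributes
  nothing because its death rate is 0. After normalisation it says that departures balance accepted
  calls.\<close>

lemma flow_balance_sums:
  assumes "\<gamma> > 0" "l \<ge> 0" "\<pi> \<in> routing_policies"
  shows "(\<lambda>k. death_rate \<gamma> N k * stationary_weight \<gamma> \<pi> N l k) sums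
           (l * (\<Sum>k. \<pi> k * stationary_weight \<gamma> \<pi> N l k))"
proof -
  have "(\<lambda>k. l * (\<pi> k * stationary_weight \<gamma> \<pi> N l k)) sums
          (l * (\<Sum>k. \<pi> k * stationary_weight \<gamma> \<pi> N l k))"
    by (intro sums_mult summable_sums summable_policy_weight assms)
  hence "(\<lambda>k. death_rate \<gamma> N (Suc k) * stationary_weight \<gamma> \<pi> N l (Suc k)) sums
          (l * (\<Sum>k. \<pi> k * stationary_weight \<gamma> \<pi> N l k))"
    using detailed_balance[OF assms(1)] by (simp add: mult.assoc)
  thus ?thesis by (subst (asm) sums_Suc_iff) simp
qed

lemma summable_queue_weight:
  assumes "\<gamma> > 0" "l \<ge> 0" "\<pi> \<in> routing_policies"
  shows "summable (\<lambda>k. real (k - N) * stationary_weight \<gamma> \<pi> N l k)"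
proof (rule summable_comparison_test)
  show "summable (\<lambda>k. 1 / \<gamma> * (death_rate \<gamma> N k * stationary_weight \<gamma> \<pi> N l k))"
    by (intro summable_mult sums_summable[OF flow_balance_sums] assms)
  show "\<exists>N'. \<forall>k\<ge>N'. norm (real (k - N) * stationary_weight \<gamma> \<pi> N l k)
           \<le> 1 / \<gamma> * (death_rate \<gamma> N k * stationary_weight \<gamma> \<pi> N l k)"
  proof (intro exI allI impI)
    fix k
    have "real (k - N) * stationary_weight \<gamma> \<pi> N l k
        \<le> death_rate \<gamma> N k / \<gamma> * stationary_weight \<gamma> \<pi> N l k"
      using assms stationary_weight_nonneg[OF assms]
      by (intro mult_right_mono) (auto simp: death_rate_def field_simps)
    thus "norm (real (k - N) * stationary_weight \<gamma> \<pi> N l k)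
        \<le> 1 / \<gamma> * (death_rate \<gamma> N k * stationary_weight \<gamma> \<pi> N l k)"
      using stationary_weight_nonneg[OF assms] by (simp add: abs_mult)
  qed
qed

text \<open>The third claim replaces the rate of accepted calls by the mean death rate, which frees
  the summands of \<open>\<pi>\<close> except through the weights. It stays unnormalised so that it
  can be compared termwise with truncated sums.\<close>

lemma operating_cost_eq:
  fixes N :: nat
  assumes "\<gamma> > 0" "l \<ge> 0" "\<pi> \<in> routing_policies"
  defines "W \<equiv> stationary_weight \<gamma> \<pi> N l"
  shows "outsourcing_prob \<gamma> \<pi> N l = 1 - (\<Sum>k. \<pi> k * W k) / (\<Sum>k. W k)"
    and "abandonment_rate \<gamma> \<pi> N l = \<gamma> * (\<Sum>k. real (k - N) * W k) / (\<Sum>k. W k)"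
    and "(\<lambda>k. W k * net_cost p a \<gamma> N l k) sums (operating_cost p a \<gamma> \<pi> N l * (\<Sum>k. W k))"
proof -
  note sm = summable_stationary_weight[OF assms(1-3), of N, folded W_def]
    summable_policy_weight[OF assms(1-3), of N, folded W_def]
    summable_queue_weight[OF assms(1-3), of N, folded W_def]
  have S: "(\<Sum>k. W k) \<ge> 1" unfolding W_def by (rule total_weight_ge_1) fact+
  have "(\<lambda>k. (W k - \<pi> k * W k) / (\<Sum>j. W j)) sums (((\<Sum>k. W k) - (\<Sum>k. \<pi> k * W k)) / (\<Sum>j. W j))"
    by (intro sums_divide sums_diff summable_sums sm)
  hence "(\<lambda>k. stationary_prob \<gamma> \<pi> N l k * (1 - \<pi> k)) sums
      (((\<Sum>k. W k) - (\<Sum>k. \<pi> k * W k)) / (\<Sum>j. W j))"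
    by (simp add: stationary_prob_def W_def algebra_simps diff_divide_distrib)
  thus 1: "outsourcing_prob \<gamma> \<pi> N l = 1 - (\<Sum>k. \<pi> k * W k) / (\<Sum>k. W k)"
    using S by (simp add: outsourcing_prob_def sums_iff field_simps)
  have "(\<lambda>k. real (k - N) * W k / (\<Sum>j. W j)) sums ((\<Sum>k. real (k - N) * W k) / (\<Sum>j. W j))"
    by (intro sums_divide summable_sums sm)
  thus 2: "abandonment_rate \<gamma> \<pi> N l = \<gamma> * (\<Sum>k. real (k - N) * W k) / (\<Sum>k. W k)"
    by (simp add: abandonment_rate_def stationary_prob_def W_def sums_iff)
  have "(\<lambda>k. p * l * W k - p * (death_rate \<gamma> N k * W k) + a * \<gamma> * (real (k - N) * W k)) sums
     (p * l * (\<Sum>k. W k) - p * (l * (\<Sum>k. \<pi> k * W k)) + a * \<gamma> * (\<Sum>k. real (k - N) * W k))"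
    by (intro sums_add sums_diff sums_mult summable_sums sm
        flow_balance_sums[OF assms(1-3), of N, folded W_def])
  also have "(\<lambda>k. p * l * W k - p * (death_rate \<gamma> N k * W k) + a * \<gamma> * (real (k - N) * W k)) =
      (\<lambda>k. W k * net_cost p a \<gamma> N l k)"
    by (auto simp: net_cost_def algebra_simps)
  also have "p * l * (\<Sum>k. W k) - p * (l * (\<Sum>k. \<pi> k * W k)) + a * \<gamma> * (\<Sum>k. real (k - N) * W k)
      = operating_cost p a \<gamma> \<pi> N l * (\<Sum>k. W k)"
    unfolding operating_cost_def 1 2 using S by (simp add: field_simps)
  finally show "(\<lambda>k. W k * net_cost p a \<gamma> N l k) sums (operating_cost p a \<gamma> \<pi> N l * (\<Sum>k. W k))" .
qed

text \<open>Abandonments are part of the death flow, which equals the accepted flow, so at most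
  \<open>l\<close> calls abandon per unit time. The upper bound is coarse and serves integrability
  only for fixed mean arrival rate.\<close>

lemma operating_cost_bounds:
  assumes "\<gamma> > 0" "l \<ge> 0" "\<pi> \<in> routing_policies" "p \<ge> 0" "a \<ge> 0"
  shows "0 \<le> operating_cost p a \<gamma> \<pi> N l" "operating_cost p a \<gamma> \<pi> N l \<le> (p + a) * l"
proof -
  define W where "W = stationary_weight \<gamma> \<pi> N l"
  note eq = operating_cost_eq(1,2)[OF assms(1-3), of N, folded W_def]
  note sm = summable_stationary_weight[OF assms(1-3), of N, folded W_def]
    summable_policy_weight[OF assms(1-3), of N, folded W_def]
    summable_queue_weight[OF assms(1-3), of N, folded W_def]
  have W: "0 \<le> W k" for k
    unfolding W_def by (rule stationary_weight_nonneg) fact+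
  have S: "(\<Sum>k. W k) \<ge> 1" unfolding W_def by (rule total_weight_ge_1) fact+
  have P: "(\<Sum>k. \<pi> k * W k) \<le> (\<Sum>k. W k)" "0 \<le> (\<Sum>k. \<pi> k * W k)"
    using routing_policiesD[OF assms(3)] W sm
    by (auto intro!: suminf_le suminf_nonneg mult_left_le_one_le)
  hence P': "(\<Sum>k. \<pi> k * W k) / (\<Sum>k. W k) \<le> 1" "0 \<le> (\<Sum>k. \<pi> k * W k) / (\<Sum>k. W k)"
    using S by auto
  have "\<gamma> * (\<Sum>k. real (k - N) * W k) = (\<Sum>k. \<gamma> * (real (k - N) * W k))"
    by (intro suminf_mult[symmetric] sm)
  also have "\<dots> \<le> (\<Sum>k. death_rate \<gamma> N k * W k)"
    using sm W flow_balance_sums[OF assms(1-3), of N, folded W_def]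
    by (intro suminf_le summable_mult) (auto simp: sums_iff death_rate_def algebra_simps)
  also have "\<dots> = l * (\<Sum>k. \<pi> k * W k)"
    using flow_balance_sums[OF assms(1-3), of N, folded W_def] by (simp add: sums_iff)
  also have "\<dots> \<le> l * (\<Sum>k. W k)" using P assms by (intro mult_left_mono) auto
  finally have A: "abandonment_rate \<gamma> \<pi> N l \<le> l"
    unfolding eq using S by (simp add: field_simps)
  have A0: "0 \<le> abandonment_rate \<gamma> \<pi> N l"
    unfolding eq using S W sm assms by (auto intro!: divide_nonneg_nonneg mult_nonneg_nonneg suminf_nonneg)
  have "outsourcing_prob \<gamma> \<pi> N l \<le> 1" "0 \<le> outsourcing_prob \<gamma> \<pi> N l"
    using eq P' by auto
  with A A0 assms show "0 \<le> operating_cost p a \<gamma> \<pi> N l"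
    "operating_cost p a \<gamma> \<pi> N l \<le> (p + a) * l"
    unfolding operating_cost_def
    by (auto simp: algebra_simps intro!: add_nonneg_nonneg add_mono mult_left_mono mult_left_le)
qed

section \<open>Reduction to threshold policies\<close>

lemma abel_summation:
  fixes u s :: "nat \<Rightarrow> real"
  shows "(\<Sum>k\<le>n. u k * s k) =
    (\<Sum>k<n. (u k - u (Suc k)) * (\<Sum>j\<le>k. s j)) + u n * (\<Sum>j\<le>n. s j)"
  by (induction n) (simp_all add: algebra_simps)

text \<open>The stationary law is a free one with weights multiplied by the nonincreasing sequence
  \<open>\<pi>\<^sub>0 \<cdots> \<pi>\<^sub>k\<^sub>-\<^sub>1\<close>, hence a mixture of stationary laws of threshold policies.\<close>

lemma operating_cost_ge:
  assumes "\<gamma> > 0" "l \<ge> 0" "\<pi> \<in> routing_policies"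
    and z: "\<And>K. z \<le> threshold_cost p a \<gamma> N l K"
  shows "z \<le> operating_cost p a \<gamma> \<pi> N l"
proof -
  define w where "w = free_weight \<gamma> N l"
  define u where "u = (\<lambda>k. \<Prod>i<k. \<pi> i)"
  define s where "s = (\<lambda>k. w k * (net_cost p a \<gamma> N l k - z))"
  define W where "W = stationary_weight \<gamma> \<pi> N l"
  have W: "W k = u k * w k" for k
    by (simp add: W_def u_def w_def stationary_weight_eq[of _ \<pi>])
  have u: "0 \<le> u k" "u (Suc k) \<le> u k" for k
    unfolding u_def using routing_policiesD[OF assms(3)]
    by (auto intro!: prod_nonneg mult_left_le)
  \<comment> \<open>This is the hypothesis at threshold \<open>k\<close>, multiplied by the
    normalising sum. Abel summation then writes the excess under \<open>\<pi>\<close> as a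
    combination of these sums with coefficients \<open>u k - u (Suc k)\<close> and
    \<open>u n\<close>, all nonnegative.\<close>
  have S: "0 \<le> (\<Sum>j\<le>k. s j)" for k
  proof -
    have "z * (\<Sum>j\<le>k. w j) \<le> (\<Sum>j\<le>k. w j * net_cost p a \<gamma> N l j)"
      using z[of k] partial_weight_ge_1[OF assms(1,2), of N k]
      by (simp add: threshold_cost_def w_def field_simps)
    thus ?thesis by (simp add: s_def algebra_simps sum_subtractf sum_distrib_left)
  qed
  have "0 \<le> (\<Sum>k\<le>n. u k * s k)" for n
    unfolding abel_summation using u
    by (intro add_nonneg_nonneg sum_nonneg mult_nonneg_nonneg[OF _ S]) auto
  hence pos: "0 \<le> (\<Sum>k<n. u k * s k)" for n
    by (cases n) (simp_all add: lessThan_Suc_atMost del: sum.lessThan_Suc)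
  have "(\<lambda>k. W k * net_cost p a \<gamma> N l k - z * W k) sums
     (operating_cost p a \<gamma> \<pi> N l * (\<Sum>k. W k) - z * (\<Sum>k. W k))"
    unfolding W_def
    by (intro sums_diff operating_cost_eq sums_mult summable_sums summable_stationary_weight assms)
  also have "(\<lambda>k. W k * net_cost p a \<gamma> N l k - z * W k) = (\<lambda>k. u k * s k)"
    by (simp add: W s_def algebra_simps fun_eq_iff)
  finally have "0 \<le> operating_cost p a \<gamma> \<pi> N l * (\<Sum>k. W k) - z * (\<Sum>k. W k)"
    unfolding sums_def using pos by (intro LIMSEQ_le_const) auto
  thus ?thesis
    using total_weight_ge_1[OF assms(1-3), of N] by (simp add: W_def)
qed

text \<open>For an integer \<open>n\<close>, \<open>n < T\<close> means
  \<open>n < nat \<lceil>T\<rceil>\<close>, so the rounded threshold is the highest state that can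
  be reached. A negative \<open>T\<close> rounds to 0 and rejects every call.\<close>

lemma operating_cost_threshold_policy:
  assumes "\<gamma> > 0" "l \<ge> 0"
  shows "operating_cost p a \<gamma> (threshold_policy (ereal T)) N l = threshold_cost p a \<gamma> N l (nat \<lceil>T\<rceil>)"
proof -
  define \<pi> where "\<pi> = threshold_policy (ereal T)"
  define K where "K = nat \<lceil>T\<rceil>"
  have less: "real i < T \<longleftrightarrow> i < K" for i
    unfolding K_def by linarith
  have "(\<Prod>i<k. \<pi> i) = (if k \<le> K then 1 else 0)" for k
  proof (cases "k \<le> K")
    case False
    hence "K < k" "\<pi> K = 0" by (auto simp: \<pi>_def threshold_policy_def less)
    thus ?thesis by auto
  qed (auto intro!: prod.neutral simp: \<pi>_def threshold_policy_def less)
  hence W: "stationary_weight \<gamma> \<pi> N l k = (if k \<in> {..K} then free_weight \<gamma> N l k else 0)" for k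
    by (simp add: stationary_weight_eq[of _ \<pi>])
  have 1: "(\<Sum>k. stationary_weight \<gamma> \<pi> N l k) = (\<Sum>k\<le>K. free_weight \<gamma> N l k)"
    unfolding W by (intro sums_unique[symmetric] sums_If_finite_set) auto
  have "(\<lambda>k. stationary_weight \<gamma> \<pi> N l k * net_cost p a \<gamma> N l k) =
     (\<lambda>k. if k \<in> {..K} then free_weight \<gamma> N l k * net_cost p a \<gamma> N l k else 0)"
    by (auto simp: W)
  hence "(\<lambda>k. stationary_weight \<gamma> \<pi> N l k * net_cost p a \<gamma> N l k) sums
      (\<Sum>k\<le>K. free_weight \<gamma> N l k * net_cost p a \<gamma> N l k)"
    using sums_If_finite_set[of "{..K}"] by simp
  moreover have "(\<lambda>k. stationary_weight \<gamma> \<pi> N l k * net_cost p a \<gamma> N l k) sums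
      (operating_cost p a \<gamma> \<pi> N l * (\<Sum>k\<le>K. free_weight \<gamma> N l k))"
    unfolding 1[symmetric] by (rule operating_cost_eq(3)) (auto simp: assms \<pi>_def)
  ultimately have "operating_cost p a \<gamma> \<pi> N l * (\<Sum>k\<le>K. free_weight \<gamma> N l k) =
      (\<Sum>k\<le>K. free_weight \<gamma> N l k * net_cost p a \<gamma> N l k)"
    using sums_unique2 by blast
  thus ?thesis
    using partial_weight_ge_1[OF assms, of N K]
    by (simp add: threshold_cost_def \<pi>_def K_def field_simps)
qed

lemma threshold_cost_is_operating_cost:
  assumes "\<gamma> > 0" "l \<ge> 0"
  obtains \<pi> where "\<pi> \<in> routing_policies" "threshold_cost p a \<gamma> N l K = operating_cost p a \<gamma> \<pi> N l"
  using operating_cost_threshold_policy[OF assms, of p a "real K" N]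
  by (intro that[of "threshold_policy (ereal (real K))"]) auto

lemma bdd_below_operating_cost:
  assumes "\<gamma> > 0" "l \<ge> 0" "p \<ge> 0" "a \<ge> 0"
  shows "bdd_below ((\<lambda>\<pi>. operating_cost p a \<gamma> \<pi> N l) ` routing_policies)"
  using assms by (intro bdd_belowI[of _ 0]) (auto intro: operating_cost_bounds)

lemma opt_cost_le:
  assumes "\<gamma> > 0" "l \<ge> 0" "p \<ge> 0" "a \<ge> 0" "\<pi> \<in> routing_policies"
  shows "opt_cost p a \<gamma> N l \<le> operating_cost p a \<gamma> \<pi> N l"
  unfolding opt_cost_def by (intro cINF_lower bdd_below_operating_cost assms)

lemma opt_cost_le_threshold_cost:
  assumes "\<gamma> > 0" "l \<ge> 0" "p \<ge> 0" "a \<ge> 0"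
  shows "opt_cost p a \<gamma> N l \<le> threshold_cost p a \<gamma> N l K"
  using threshold_cost_is_operating_cost[OF assms(1,2), of p a N K] opt_cost_le[OF assms] by metis

lemma opt_cost_ge:
  assumes "\<gamma> > 0" "l \<ge> 0" "\<And>K. z \<le> threshold_cost p a \<gamma> N l K"
  shows "z \<le> opt_cost p a \<gamma> N l"
  unfolding opt_cost_def using free_policy
  by (intro cINF_greatest) (blast intro: operating_cost_ge[OF assms(1,2) _ assms(3)])+

lemma threshold_cost_nonneg:
  assumes "\<gamma> > 0" "l \<ge> 0" "p \<ge> 0" "a \<ge> 0"
  shows "0 \<le> threshold_cost p a \<gamma> N l K"
  using threshold_cost_is_operating_cost[OF assms(1,2), of p a N K]
    operating_cost_bounds(1)[OF assms(1,2) _ assms(3,4)] by metis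

lemma opt_cost_nonneg:
  assumes "\<gamma> > 0" "l \<ge> 0" "p \<ge> 0" "a \<ge> 0"
  shows "0 \<le> opt_cost p a \<gamma> N l"
  by (intro opt_cost_ge threshold_cost_nonneg assms)

text \<open>Turns an infimum over an uncountable set of policies into a countable one, from which
  measurability in the arrival rate follows.\<close>

lemma opt_cost_eq_INF_threshold_cost:
  assumes "\<gamma> > 0" "l \<ge> 0" "p \<ge> 0" "a \<ge> 0"
  shows "opt_cost p a \<gamma> N l = (INF K. threshold_cost p a \<gamma> N l K)"
proof (rule antisym)
  show "opt_cost p a \<gamma> N l \<le> (INF K. threshold_cost p a \<gamma> N l K)"
    by (intro cINF_greatest opt_cost_le_threshold_cost assms) auto
  have "bdd_below (range (threshold_cost p a \<gamma> N l))"
    by (intro bdd_belowI[of _ 0]) (auto intro: threshold_cost_nonneg assms)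
  thus "(INF K. threshold_cost p a \<gamma> N l K) \<le> opt_cost p a \<gamma> N l"
    by (intro opt_cost_ge assms cINF_lower) auto
qed

lemma measurable_threshold_cost [measurable]:
  "(\<lambda>l. threshold_cost p a \<gamma> N l K) \<in> borel_measurable borel"
  unfolding threshold_cost_def stationary_weight_def net_cost_def by measurable

lemma measurable_opt_cost:
  assumes "\<gamma> > 0" "p \<ge> 0" "a \<ge> 0" "f \<in> borel_measurable M" "\<And>x. f x \<ge> 0"
  shows "(\<lambda>x. opt_cost p a \<gamma> N (f x)) \<in> borel_measurable M"
proof -
  have "(\<lambda>x. threshold_cost p a \<gamma> N (f x) K) \<in> borel_measurable M" for K
    using measurable_compose[OF assms(4) measurable_threshold_cost] by simp
  hence "(\<lambda>x. INF K. threshold_cost p a \<gamma> N (f x) K) \<in> borel_measurable M"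
    by (intro borel_measurable_cINF_real) auto
  thus ?thesis by (simp add: opt_cost_eq_INF_threshold_cost assms)
qed

section \<open>Balance identities and bounds for threshold policies\<close>

text \<open>The sum telescopes by detailed balance; what remains is the flow out of the top state,
  which is exactly the unnormalised flow of rejected calls under threshold \<open>K\<close>.\<close>

lemma sum_free_weight_drift:
  assumes "\<gamma> > 0"
  shows "(\<Sum>k\<le>K. free_weight \<gamma> N l k * (l - death_rate \<gamma> N k)) = l * free_weight \<gamma> N l K"
proof (induction K)
  case (Suc K)
  thus ?case using detailed_balance[OF assms, of N K "\<lambda>_. 1" l] by (simp add: algebra_simps)
qed simp

lemma threshold_cost_eq:
  assumes "\<gamma> > 0"
  shows "threshold_cost p a \<gamma> N l K =
    (p * (l * free_weight \<gamma> N l K) + a * (\<Sum>k\<le>K. \<gamma> * real (k - N) * free_weight \<gamma> N l k))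
      / (\<Sum>k\<le>K. free_weight \<gamma> N l k)"
  unfolding threshold_cost_def sum_free_weight_drift[OF assms, symmetric]
  by (simp add: net_cost_def algebra_simps sum.distrib sum_distrib_left sum_subtractf)

text \<open>Above \<open>N\<close>, detailed balance expresses \<open>\<gamma> * j\<close> times the
  weight at \<open>N + j\<close> as \<open>l\<close> times the preceding weight minus
  \<open>N\<close> times the weight itself, and the sum telescopes. The first moment of the queue is
  thus reduced to two boundary weights and a plain sum of weights, so no limit of a weighted sum has
  to be computed.\<close>

lemma queue_sum_eq:
  assumes "\<gamma> > 0"
  shows "(\<Sum>k\<le>N+J. \<gamma> * real (k - N) * free_weight \<gamma> N l k) =
    l * (free_weight \<gamma> N l N - free_weight \<gamma> N l (N + J))
      - (real N - l) * (\<Sum>j\<in>{1..J}. free_weight \<gamma> N l (N + j))"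
proof (induction J)
  case 0
  show ?case by (simp add: sum.neutral)
next
  case (Suc J)
  have "death_rate \<gamma> N (Suc (N + J)) = real N + \<gamma> * real (Suc J)"
    by (simp add: death_rate_def)
  with detailed_balance[OF assms, of N "N + J" "\<lambda>_. 1" l]
  have "(real N + \<gamma> * real (Suc J)) * free_weight \<gamma> N l (Suc (N + J)) = l * free_weight \<gamma> N l (N + J)"
    by simp
  with Suc show ?case by (simp add: algebra_simps)
qed

lemma sum_atMost_add_split:
  fixes f :: "nat \<Rightarrow> real"
  shows "(\<Sum>k\<le>N+J. f k) = (\<Sum>k\<le>N. f k) + (\<Sum>j\<in>{1..J}. f (N + j))"
  by (induction J) simp_all

text \<open>At most \<open>N\<close> calls are served per unit time, so the excess
  \<open>l - N\<close> is outsourced or abandons, at a price of at least \<open>min p a\<close> per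
  call. Its expectation later penalises understaffing.\<close>

lemma threshold_cost_ge_fluid:
  assumes "\<gamma> > 0" "l \<ge> 0" "p \<ge> 0" "a \<ge> 0"
  shows "min p a * (l - real N) \<le> threshold_cost p a \<gamma> N l K"
proof -
  let ?w = "free_weight \<gamma> N l" and ?m = "min p a"
  have w: "?w k \<ge> 0" for k by (intro stationary_weight_nonneg assms) simp
  have Q: "0 \<le> (\<Sum>k\<le>K. \<gamma> * real (k - N) * ?w k)"
    using w assms by (intro sum_nonneg) simp
  have "?m * (l - real N) * (\<Sum>k\<le>K. ?w k) = ?m * (\<Sum>k\<le>K. ?w k * (l - real N))"
    by (simp add: sum_distrib_right[symmetric])
  also have "\<dots> \<le> ?m * (\<Sum>k\<le>K. ?w k * (l - real (min N k)))"
    using w assms by (intro mult_left_mono sum_mono) auto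
  also have "\<dots> = ?m * (l * ?w K) + ?m * (\<Sum>k\<le>K. \<gamma> * real (k - N) * ?w k)"
    unfolding sum_free_weight_drift[OF assms(1), symmetric]
    by (simp add: death_rate_def algebra_simps sum.distrib sum_subtractf)
  also have "\<dots> \<le> p * (l * ?w K) + a * (\<Sum>k\<le>K. \<gamma> * real (k - N) * ?w k)"
    using assms w Q by (intro add_mono mult_right_mono) auto
  finally show ?thesis
    using partial_weight_ge_1[OF assms(1,2), of N K]
    by (simp add: threshold_cost_eq[OF assms(1)] field_simps)
qed

text \<open>\<open>l\<close> times the Erlang loss probability of \<open>N\<close> servers.\<close>

definition erlang_loss :: "real \<Rightarrow> nat \<Rightarrow> real \<Rightarrow> real" where
  "erlang_loss \<gamma> N l = l * free_weight \<gamma> N l N / (\<Sum>k\<le>N. free_weight \<gamma> N l k)"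

section \<open>Erlang loss recursion and its consequences\<close>

lemma free_weight_below:
  assumes "k \<le> N"
  shows "free_weight \<gamma> N l k = l ^ k / fact k"
  using assms by (induction k) (simp_all add: stationary_weight_Suc death_rate_def mult_ac)

lemma erlang_loss_eq: "erlang_loss \<gamma> N l = l * (l ^ N / fact N) / (\<Sum>k\<le>N. l ^ k / fact k)"
  by (simp add: erlang_loss_def free_weight_below)

lemma erlang_loss_Suc:
  assumes "l > 0"
  shows "erlang_loss \<gamma> (Suc N) l = l * erlang_loss \<gamma> N l / (real (Suc N) + erlang_loss \<gamma> N l)"
proof -
  define S where "S = (\<Sum>k\<le>N. l ^ k / fact k)"
  define x where "x = l ^ N / fact N"
  have S: "S > 0" unfolding S_def using assms by (intro sum_pos) auto
  have x: "x > 0" using assms by (simp add: x_def)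
  define n where "n = real (Suc N)"
  have n: "n > 0" by (simp add: n_def)
  have *: "l ^ Suc N / fact (Suc N) = l * x / n" by (simp add: x_def n_def field_simps)
  have "erlang_loss \<gamma> (Suc N) l = l * (l * x / n) / (S + l * x / n)"
    unfolding erlang_loss_eq sum.atMost_Suc * S_def ..
  also have "\<dots> = l * (l * x / S) / (n + l * x / S)"
  proof -
    have "S + l * x / n > 0" "n + l * x / S > 0" "S * n + l * x > 0"
      using S x assms n by (auto intro!: add_pos_pos divide_pos_pos mult_pos_pos)
    thus ?thesis using S x assms n by (simp add: divide_simps)
  qed
  finally show ?thesis by (simp add: erlang_loss_eq S_def x_def n_def)
qed

text \<open>The quadratic inequality is chosen because the Erlang recursion preserves it; solving it
  for the loss yields the order \<open>sqrt l\<close> at balanced load. The linear lower bound is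
  carried along for the induction step and is reused in
  \<open>threshold_cost_le_erlang_loss\<close>.\<close>

lemma erlang_loss_bounds:
  assumes "l > 0"
  shows "0 \<le> erlang_loss \<gamma> N l \<and> l - real N \<le> erlang_loss \<gamma> N l \<and>
    erlang_loss \<gamma> N l * (erlang_loss \<gamma> N l + real N - l + 1) \<le> l"
proof (induction N)
  case 0
  show ?case using assms by (simp add: erlang_loss_eq)
next
  case (Suc N)
  define b where "b = erlang_loss \<gamma> N l"
  define n where "n = real (Suc N)"
  define b' where "b' = l * b / (n + b)"
  have b': "erlang_loss \<gamma> (Suc N) l = b'" by (simp add: erlang_loss_Suc assms b_def b'_def n_def)
  have n: "n \<ge> 1" "real N = n - 1" by (auto simp: n_def)
  have IH: "0 \<le> b" "l - n + 1 \<le> b" "b * (b + n - l) \<le> l"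
    using Suc n by (auto simp: b_def algebra_simps)
  have pos: "n + b > 0" using IH n by simp
  have 1: "0 \<le> b'" using IH pos assms by (simp add: b'_def)
  have "(l - n) * (n + b) \<le> l * b"
  proof -
    have "0 \<le> n * (b - (l - n))" using IH n by (intro mult_nonneg_nonneg) auto
    thus ?thesis by (simp add: algebra_simps)
  qed
  hence 2: "l - n \<le> b'" using pos by (simp add: b'_def field_simps)
  \<comment> \<open>By the induction hypotheses \<open>b * (b + n - l) \<le> l\<close> and
    \<open>l \<le> b + n - 1\<close>, so the bracket is at most -1.\<close>
  have "n * (b * (b + n - l) - b - n) \<le> 0"
    using IH n by (intro mult_nonneg_nonpos) auto
  hence "l * (n * (b * (b + n - l) - b - n)) \<le> 0"
    using mult_nonneg_nonpos[of l] assms by simp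
  \<comment> \<open>Clearing the denominator \<open>n + b\<close> from the quadratic for the new
    loss \<open>b'\<close> leaves a multiple of the bracket just bounded.\<close>
  moreover have "(b' * (b' + n - l + 1) - l) * (n + b)\<^sup>2 = l * (n * (b * (b + n - l) - b - n))"
  proof -
    have e: "b' * (n + b) = l * b" using pos by (simp add: b'_def)
    have "(b' * (b' + n - l + 1) - l) * (n + b)\<^sup>2 =
       (b' * (n + b)) * (b' * (n + b)) + (b' * (n + b)) * (n + b) * (n - l + 1) - l * (n + b)\<^sup>2"
      by (simp add: algebra_simps power2_eq_square)
    also have "\<dots> = l * (n * (b * (b + n - l) - b - n))"
      unfolding e by (simp add: algebra_simps power2_eq_square)
    finally show ?thesis .
  qed
  ultimately have "(b' * (b' + n - l + 1) - l) * (n + b)\<^sup>2 \<le> 0" by simp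
  hence "b' * (b' + n - l + 1) \<le> l"
    using pos by (simp add: mult_le_0_iff)
  with 1 2 show ?case unfolding b' n_def by simp
qed

text \<open>If the bound failed, both factors of the quadratic inequality would exceed
  \<open>sqrt l\<close> and their product would exceed \<open>l\<close>.\<close>

lemma erlang_loss_le:
  assumes "l > 0"
  shows "erlang_loss \<gamma> N l \<le> max 0 (l - real N) + sqrt l"
proof (rule ccontr)
  define b where "b = erlang_loss \<gamma> N l"
  assume "\<not> ?thesis"
  hence "b > sqrt l" "b + real N - l > sqrt l" by (auto simp: b_def)
  moreover have "0 \<le> sqrt l" using assms by simp
  ultimately have "sqrt l * sqrt l < b * (b + real N - l + 1)"
    by (intro mult_strict_mono) linarith+
  with erlang_loss_bounds[OF assms, of \<gamma> N] assms show False by (simp add: b_def)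
qed

text \<open>With waiting room, losses and abandonments together amount to
  \<open>l * w N + (l - N) * U\<close> by \<open>queue_sum_eq\<close>, where \<open>U\<close> is the
  weight above \<open>N\<close>. The first term is the Erlang loss times the weight up to
  \<open>N\<close>, and \<open>l - N\<close> is at most the Erlang loss. The bound is uniform in
  \<open>J\<close>.\<close>

lemma threshold_cost_le_erlang_loss:
  assumes "\<gamma> > 0" "l > 0" "p \<ge> 0" "a \<ge> 0"
  shows "threshold_cost p a \<gamma> N l (N + J) \<le> max p a * erlang_loss \<gamma> N l"
proof -
  let ?w = "free_weight \<gamma> N l" and ?m = "max p a"
  define U where "U = (\<Sum>j\<in>{1..J}. ?w (N + j))"
  define W where "W = (\<Sum>k\<le>N. ?w k)"
  have w: "?w k > 0" for k by (intro free_weight_pos assms)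
  have U: "U \<ge> 0" unfolding U_def using w by (intro sum_nonneg less_imp_le)
  have W: "W > 0" unfolding W_def using w by (intro sum_pos) auto
  have Q: "0 \<le> (\<Sum>k\<le>N+J. \<gamma> * real (k - N) * ?w k)"
    using w assms by (intro sum_nonneg) (simp add: less_imp_le)
  have "p * (l * ?w (N+J)) + a * (\<Sum>k\<le>N+J. \<gamma> * real (k - N) * ?w k)
      \<le> ?m * (l * ?w (N+J)) + ?m * (\<Sum>k\<le>N+J. \<gamma> * real (k - N) * ?w k)"
    using assms w[of "N+J"] Q by (intro add_mono mult_right_mono) auto
  also have "\<dots> = ?m * (l * ?w N + (l - real N) * U)"
    unfolding queue_sum_eq[OF assms(1)] U_def by (simp add: algebra_simps)
  also have "\<dots> \<le> ?m * (erlang_loss \<gamma> N l * (W + U))"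
  proof -
    have "l * ?w N = erlang_loss \<gamma> N l * W" using W by (simp add: erlang_loss_def W_def)
    moreover have "(l - real N) * U \<le> erlang_loss \<gamma> N l * U"
      using erlang_loss_bounds[OF assms(2)] U by (intro mult_right_mono) auto
    ultimately show ?thesis using assms by (intro mult_left_mono) (auto simp: algebra_simps)
  qed
  finally have "p * (l * ?w (N+J)) + a * (\<Sum>k\<le>N+J. \<gamma> * real (k - N) * ?w k)
      \<le> ?m * erlang_loss \<gamma> N l * (W + U)" by (simp add: mult.assoc)
  moreover have "W + U > 0" using W U by simp
  ultimately show ?thesis
    unfolding threshold_cost_eq[OF assms(1)] sum_atMost_add_split[of _ N J] U_def W_def
    by (simp add: pos_divide_le_eq del: One_nat_def)
qed

section \<open>Monotonicity of the cost in the threshold\<close>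

lemma weighted_average_mono:
  fixes w f :: "nat \<Rightarrow> real"
  assumes w: "\<And>k. w k > 0" and f: "mono f" and le: "K \<le> K'"
  shows "(\<Sum>k\<le>K. w k * f k) / (\<Sum>k\<le>K. w k) \<le> (\<Sum>k\<le>K'. w k * f k) / (\<Sum>k\<le>K'. w k)"
  using le
proof (induction K' rule: dec_induct)
  case (step n)
  define W where "W = (\<Sum>k\<le>n. w k)"
  have W: "W > 0" unfolding W_def using w by (intro sum_pos) auto
  have "(\<Sum>k\<le>n. w k * f k) \<le> (\<Sum>k\<le>n. w k * f (Suc n))"
    using w f by (intro sum_mono mult_left_mono) (auto simp: mono_def less_imp_le)
  hence *: "(\<Sum>k\<le>n. w k * f k) \<le> W * f (Suc n)" by (simp add: W_def sum_distrib_right)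
  have "w (Suc n) * (\<Sum>k\<le>n. w k * f k) \<le> w (Suc n) * (W * f (Suc n))"
    using * w[of "Suc n"] by (intro mult_left_mono) auto
  hence "(\<Sum>k\<le>n. w k * f k) / W \<le> ((\<Sum>k\<le>n. w k * f k) + w (Suc n) * f (Suc n)) / (W + w (Suc n))"
    using W w[of "Suc n"] by (simp add: field_simps)
  with step show ?case by (simp add: W_def)
qed simp

text \<open>If abandonment is no dearer than outsourcing, the net cost never increases with the
  state, so each additional state lowers the average.\<close>

lemma threshold_cost_antimono:
  assumes "\<gamma> > 0" "l > 0" "0 \<le> a" "a \<le> p" "K \<le> K'"
  shows "threshold_cost p a \<gamma> N l K' \<le> threshold_cost p a \<gamma> N l K"
proof -
  have "mono (\<lambda>k. - net_cost p a \<gamma> N l k)"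
  proof (rule monoI)
    fix i j :: nat assume "i \<le> j"
    hence "p * real (min N i) \<le> p * real (min N j)"
      "(p - a) * (\<gamma> * real (i - N)) \<le> (p - a) * (\<gamma> * real (j - N))"
      using assms by (auto intro!: mult_left_mono)
    thus "- net_cost p a \<gamma> N l i \<le> - net_cost p a \<gamma> N l j"
      by (simp add: net_cost_def death_rate_def algebra_simps)
  qed
  from weighted_average_mono[OF free_weight_pos[OF assms(1,2)] this assms(5)]
  show ?thesis by (simp add: threshold_cost_def sum_negf)
qed

text \<open>At outsourcing price 0 only abandonment is charged, and this grows with the state. A
  lower bound found at one threshold therefore persists at all larger ones, which is how the case
  \<open>a \<le> p\<close> of the limit is handled.\<close>

lemma threshold_cost_no_outsourcing_mono:
  assumes "\<gamma> > 0" "l > 0" "0 \<le> a" "K \<le> K'"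
  shows "threshold_cost 0 a \<gamma> N l K \<le> threshold_cost 0 a \<gamma> N l K'"
proof -
  have "mono (net_cost 0 a \<gamma> N l)"
    using assms by (intro monoI) (auto simp: net_cost_def intro!: mult_left_mono)
  from weighted_average_mono[OF free_weight_pos[OF assms(1,2)] this assms(4)]
  show ?thesis by (simp add: threshold_cost_def)
qed

lemma threshold_cost_mono_price:
  assumes "\<gamma> > 0" "l \<ge> 0" "0 \<le> p"
  shows "threshold_cost 0 a \<gamma> N l K \<le> threshold_cost p a \<gamma> N l K"
  using assms partial_weight_ge_1[OF assms(1,2), of N K] stationary_weight_nonneg[OF assms(1,2) free_policy]
  unfolding threshold_cost_eq[OF assms(1)] by (intro divide_right_mono) auto

lemma operating_cost_no_threshold:
  assumes "\<gamma> > 0" "l \<ge> 0" "0 \<le> a" "a \<le> p"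
  shows "operating_cost p a \<gamma> (threshold_policy \<infinity>) N l = opt_cost p a \<gamma> N l"
proof (cases "l = 0")
  case True
  hence "operating_cost p a \<gamma> (threshold_policy \<infinity>) N l = 0"
    using operating_cost_bounds[OF assms(1,2) threshold_policy_routing, of p a \<infinity> N] assms by simp
  moreover have "opt_cost p a \<gamma> N l \<le> operating_cost p a \<gamma> (threshold_policy \<infinity>) N l"
    "0 \<le> opt_cost p a \<gamma> N l"
    using assms by (auto intro!: opt_cost_le opt_cost_nonneg)
  ultimately show ?thesis by simp
next
  case False
  hence l: "l > 0" using assms by simp
  let ?z = "operating_cost p a \<gamma> (threshold_policy \<infinity>) N l"
  have free: "threshold_policy \<infinity> = (\<lambda>_. 1)" by (simp add: threshold_policy_def fun_eq_iff)
  have S: "(\<lambda>K. \<Sum>k\<le>K. free_weight \<gamma> N l k) \<longlonglongrightarrow> (\<Sum>k. free_weight \<gamma> N l k)"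
    by (intro summable_LIMSEQ' summable_stationary_weight assms free_policy)
  have "(\<lambda>K. \<Sum>k\<le>K. free_weight \<gamma> N l k * net_cost p a \<gamma> N l k) \<longlonglongrightarrow>
      ?z * (\<Sum>k. free_weight \<gamma> N l k)"
    using operating_cost_eq(3)[OF assms(1,2) free_policy, of N p a] unfolding free sums_def_le .
  from tendsto_divide[OF this S] have "threshold_cost p a \<gamma> N l \<longlonglongrightarrow> ?z"
    using total_weight_ge_1[OF assms(1,2) free_policy, of N] by (simp add: threshold_cost_def[abs_def])
  moreover have "decseq (threshold_cost p a \<gamma> N l)"
    using threshold_cost_antimono[OF assms(1) l assms(3,4)] by (simp add: decseq_def)
  ultimately have "?z \<le> threshold_cost p a \<gamma> N l K" for K
    by (intro decseq_ge)
  hence "?z \<le> opt_cost p a \<gamma> N l" by (intro opt_cost_ge assms)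
  thus ?thesis using opt_cost_le[OF assms(1,2) _ _ threshold_policy_routing] assms
    by (intro antisym) auto
qed

section \<open>Testing a lower bound at a single threshold\<close>

text \<open>The partial sums rise, then fall up to \<open>k0\<close>, then rise again, so they are
  smallest either before the first term or at \<open>k0\<close>. The assumption \<open>left\<close>
  expresses that a positive term up to \<open>k0\<close> is never preceded by a negative
  one.\<close>

lemma partial_sum_ge_min:
  fixes s :: "nat \<Rightarrow> real"
  assumes right: "\<And>k. k > k0 \<Longrightarrow> s k \<ge> 0"
    and left: "\<And>i j. i \<le> j \<Longrightarrow> j \<le> k0 \<Longrightarrow> s j > 0 \<Longrightarrow> s i \<ge> 0"
  shows "min 0 (\<Sum>k\<le>k0. s k) \<le> (\<Sum>k\<le>K. s k)"
proof (cases "k0 \<le> K")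
  case True
  have "(\<Sum>k\<le>k0. s k) \<le> (\<Sum>k\<le>K. s k)"
    using True right by (intro sum_mono2) auto
  thus ?thesis by simp
next
  case False
  show ?thesis
  proof (cases "\<exists>j. K < j \<and> j \<le> k0 \<and> s j > 0")
    case True
    then obtain j where "K < j" "j \<le> k0" "s j > 0" by blast
    hence "0 \<le> (\<Sum>k\<le>K. s k)" using left[of _ j] by (intro sum_nonneg) simp
    thus ?thesis by simp
  next
    case none: False
    have "(\<Sum>k\<le>k0. s k) = (\<Sum>k\<le>K. s k) + (\<Sum>k\<in>{..k0} - {..K}. s k)"
      using False by (subst sum.subset_diff[of "{..K}"]) auto
    also have "(\<Sum>k\<in>{..k0} - {..K}. s k) \<le> 0"
      using none by (intro sum_nonpos) (metis DiffE atMost_iff not_le not_less)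
    finally show ?thesis by simp
  qed
qed

text \<open>The increments of the excess of the cost over a level \<open>z\<close> are nonnegative, then nonpositive up
  to the index \<open>N + J\<close>, and nonnegative afterwards.\<close>

lemma opt_cost_ge_if_threshold_cost_ge:
  assumes "\<gamma> > 0" "l > 0" "0 < p" "p < a"
    and J: "J = nat \<lfloor>(z + p * (real N - l)) / ((a - p) * \<gamma>)\<rfloor>"
    and z: "z + p * (real N - l) \<ge> 0 \<Longrightarrow> z \<le> threshold_cost p a \<gamma> N l (N + J)"
  shows "z \<le> opt_cost p a \<gamma> N l"
proof -
  let ?w = "free_weight \<gamma> N l"
  define s where "s = (\<lambda>k. ?w k * (net_cost p a \<gamma> N l k - z))"
  have w: "?w k > 0" for k by (intro free_weight_pos assms)
  have W: "(\<Sum>k\<le>K. ?w k) > 0" for K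
    using partial_weight_ge_1[of \<gamma> l N K] assms by simp
  have thr: "z \<le> threshold_cost p a \<gamma> N l K \<longleftrightarrow> 0 \<le> (\<Sum>k\<le>K. s k)" for K
    using W[of K] by (simp add: threshold_cost_def s_def field_simps sum_subtractf sum_distrib_left)
  have net: "net_cost p a \<gamma> N l k = (if k \<le> N then p * (l - real k)
      else p * (l - real N) + (a - p) * \<gamma> * real (k - N))" for k
    by (simp add: net_cost_def death_rate_def algebra_simps)
  have c: "(a - p) * \<gamma> > 0" using assms by simp
  have "z \<le> threshold_cost p a \<gamma> N l K" for K
  proof (cases "z + p * (real N - l) \<ge> 0")
    case False
    \<comment> \<open>The net cost is smallest at state \<open>N\<close>, with value
      \<open>p * (l - N)\<close>. Here that value already exceeds \<open>z\<close>, so every average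
      does too.\<close>
    have "net_cost p a \<gamma> N l k - z \<ge> 0" for k
    proof (cases "k \<le> N")
      case True
      hence "p * (l - real N) \<le> p * (l - real k)" using assms by (intro mult_left_mono) auto
      thus ?thesis using False True by (simp add: net algebra_simps)
    next
      case k: False
      have "0 \<le> (a - p) * \<gamma> * real (k - N)" using c by simp
      thus ?thesis using False k by (simp add: net algebra_simps)
    qed
    thus ?thesis unfolding thr s_def using w by (intro sum_nonneg mult_nonneg_nonneg) (auto intro: less_imp_le)
  next
    case True
    \<comment> \<open>\<open>q\<close> is the real queue length at which the increasing branch of
      the net cost reaches \<open>z\<close>; its floor \<open>J\<close> marks the last state with
      net cost at most \<open>z\<close>.\<close>
    define q where "q = (z + p * (real N - l)) / ((a - p) * \<gamma>)"
    have q: "q \<ge> 0" "(a - p) * \<gamma> * q = z + p * (real N - l)" "J = nat \<lfloor>q\<rfloor>"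
      using True c J by (auto simp: q_def)
    have sgn: "(s k > 0 \<longleftrightarrow> net_cost p a \<gamma> N l k > z) \<and> (s k \<ge> 0 \<longleftrightarrow> net_cost p a \<gamma> N l k \<ge> z)" for k
      using w[of k] by (auto simp: s_def zero_less_mult_iff zero_le_mult_iff)
    have up: "net_cost p a \<gamma> N l k - z = (a - p) * \<gamma> * (real (k - N) - q)" if "k \<ge> N" for k
      using that q(2) by (cases "k = N") (simp_all add: net right_diff_distrib)
    have "min 0 (\<Sum>k\<le>N+J. s k) \<le> (\<Sum>k\<le>K. s k)"
    proof (rule partial_sum_ge_min)
      fix k assume "k > N + J"
      hence "k \<ge> N" "real (k - N) - q \<ge> 0" using q by linarith+
      hence "net_cost p a \<gamma> N l k - z \<ge> 0"
        unfolding up[OF \<open>k \<ge> N\<close>] using c by (meson less_imp_le mult_nonneg_nonneg)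
      thus "s k \<ge> 0" using sgn[of k] by simp
    next
      fix i j assume ij: "i \<le> j" "j \<le> N + J" "s j > 0"
      \<comment> \<open>From \<open>N\<close> up to \<open>N + J\<close> the net cost is at most
        \<open>z\<close>, so a positive increment occurs only below \<open>N\<close>, where the net
        cost decreases in the state and all earlier increments are positive too.\<close>
      have "j < N"
      proof (rule ccontr)
        assume "\<not> j < N"
        moreover have "real (j - N) \<le> q" using ij q by linarith
        ultimately have "(a - p) * \<gamma> * (real (j - N) - q) \<le> 0"
          using c by (intro mult_nonneg_nonpos) auto
        thus False using up[of j] \<open>\<not> j < N\<close> sgn[of j] ij by simp
      qed
      moreover have "p * (l - real j) \<le> p * (l - real i)" using ij assms by (intro mult_left_mono) auto
      ultimately show "s i \<ge> 0" using ij sgn[of i] sgn[of j] by (simp add: net)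
    qed
    moreover have "0 \<le> (\<Sum>k\<le>N+J. s k)" using z True thr by simp
    ultimately show ?thesis unfolding thr by simp
  qed
  thus ?thesis using assms by (intro opt_cost_ge) auto
qed

section \<open>The standard normal distribution\<close>

interpretation std_normal: real_distribution std_normal_distribution
  by (rule real_dist_normal_dist)

lemma integrable_std_normal_density: "integrable lborel std_normal_density"
  using integrable_std_normal_moment[of 0] by simp

lemma measure_std_normal:
  assumes "A \<in> sets borel"
  shows "measure std_normal_distribution A = (\<integral>x. indicator A x * std_normal_density x \<partial>lborel)"
proof -
  have "measure std_normal_distribution A = (\<integral>x. indicator A x \<partial>std_normal_distribution)"
    using assms by simp
  also have "\<dots> = (\<integral>x. std_normal_density x *\<^sub>R indicator A x \<partial>lborel)"
    using assms by (intro integral_density) auto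
  finally show ?thesis by (simp add: mult.commute)
qed

lemma DERIV_std_normal_density [derivative_intros]:
  assumes "(f has_real_derivative f') (at x within s)"
  shows "((\<lambda>x. std_normal_density (f x)) has_real_derivative (- f x * std_normal_density (f x)) * f') (at x within s)"
  unfolding std_normal_density_def using assms
  by (auto intro!: derivative_eq_intros simp: field_simps power2_eq_square)

lemma DERIV_std_normal_cdf_at:
  "(std_normal_cdf has_real_derivative std_normal_density x) (at x)"
proof -
  \<comment> \<open>The base point lies strictly left of \<open>x\<close>, so that \<open>x\<close>
    is interior to the interval and the one-sided derivative of the integral is a full
    derivative.\<close>
  let ?c = "x - 1"
  have eq: "std_normal_cdf y = std_normal_cdf ?c + integral {?c..y} std_normal_density" if "y > ?c" for y
  proof -
    have "std_normal_cdf y - std_normal_cdf ?c =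
        (\<integral>u. indicator {?c<..y} u * std_normal_density u \<partial>lborel)"
      using that by (simp add: std_normal.cdf_diff_eq measure_std_normal)
    also have "\<dots> = (\<integral>u. indicator {?c..y} u * std_normal_density u \<partial>lborel)"
      by (intro integral_cong_AE AE_I'[of "{?c}"]) (auto simp: indicator_def)
    also have "\<dots> = integral {?c..y} std_normal_density"
      using set_borel_integral_eq_integral(2)[of "{?c..y}" std_normal_density]
        integrable_mult_indicator[OF _ integrable_std_normal_density, of "{?c..y}"]
      by (simp add: set_integrable_def set_lebesgue_integral_def)
    finally show ?thesis by simp
  qed
  have "continuous_on {?c..x+1} std_normal_density"
    by (intro continuous_at_imp_continuous_on ballI DERIV_isCont[OF DERIV_std_normal_density[OF DERIV_ident]])
  hence "((\<lambda>y. integral {?c..y} std_normal_density) has_real_derivative std_normal_density x)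
      (at x within {?c..x+1})"
    by (intro integral_has_real_derivative) auto
  hence "((\<lambda>y. integral {?c..y} std_normal_density) has_real_derivative std_normal_density x) (at x)"
    by (subst (asm) at_within_interior) auto
  hence "((\<lambda>y. std_normal_cdf ?c + integral {?c..y} std_normal_density)
      has_real_derivative std_normal_density x) (at x)"
    by (auto intro!: derivative_eq_intros)
  thus ?thesis
  proof (rule has_field_derivative_transform_within_open[of _ _ _ "{?c<..}"])
  qed (auto simp: eq)
qed

lemmas DERIV_std_normal_cdf [derivative_intros] = DERIV_chain2[OF DERIV_std_normal_cdf_at]

lemma std_normal_density_pos [simp]: "std_normal_density x > 0"
  by (simp add: normal_density_pos)

lemma std_normal_density_neq_0 [simp]: "std_normal_density x \<noteq> 0"
  using std_normal_density_pos[of x] by linarith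

lemma std_normal_cdf_strict_mono: "x < y \<Longrightarrow> std_normal_cdf x < std_normal_cdf y"
  by (rule DERIV_pos_imp_increasing) (use DERIV_std_normal_cdf_at std_normal_density_pos in blast)+

lemma std_normal_cdf_pos: "std_normal_cdf x > 0"
  using std_normal_cdf_strict_mono[of "x - 1" x] std_normal.cdf_nonneg[of "x - 1"] by simp

section \<open>Gaussian integrals of the limiting weights\<close>

lemma std_normal_density_diff:
  "std_normal_density (m - s) = std_normal_density m * exp (m * s - s\<^sup>2 / 2)"
proof -
  have "exp (- ((m - s)\<^sup>2 / 2)) = exp (- (m\<^sup>2 / 2)) * exp (m * s - s\<^sup>2 / 2)"
    unfolding exp_add[symmetric] by (simp add: power2_eq_square field_simps)
  thus ?thesis by (simp add: std_normal_density_def)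
qed

text \<open>Substitution \<open>u = m - s\<close>. The integrand is the limiting weight when
  \<open>s\<close> times \<open>sqrt l\<close> servers are idle, relative to the weight at
  \<open>N\<close>.\<close>

lemma gaussian_integral_below:
  "(\<integral>s. (if 0 \<le> s then exp (m * s - s\<^sup>2 / 2) else 0) \<partial>lborel) = std_normal_cdf m / std_normal_density m"
proof -
  have "std_normal_cdf m = (\<integral>u. indicator {..m} u * std_normal_density u \<partial>lborel)"
    unfolding cdf_def by (rule measure_std_normal) simp
  also have "\<dots> = (\<integral>s. indicator {..m} (m + (-1) * s) * std_normal_density (m + (-1) * s) \<partial>lborel)"
    by (subst lborel_integral_real_affine[where c = "-1" and t = m]) auto
  also have "\<dots> = (\<integral>s. std_normal_density m * (if 0 \<le> s then exp (m * s - s\<^sup>2 / 2) else 0) \<partial>lborel)"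
    by (intro Bochner_Integration.integral_cong) (auto simp: std_normal_density_diff)
  also have "\<dots> = std_normal_density m * (\<integral>s. (if 0 \<le> s then exp (m * s - s\<^sup>2 / 2) else 0) \<partial>lborel)"
    by simp
  finally show ?thesis using std_normal_density_pos[of m] by (simp add: eq_divide_eq mult.commute)
qed

lemma gaussian_integral_above:
  assumes "\<gamma> > 0" "t \<ge> 0"
  shows "(\<integral>s. (if 0 \<le> s \<and> s < t then exp (- (m * s + \<gamma> * s\<^sup>2 / 2)) else 0) \<partial>lborel) =
    (std_normal_cdf (sqrt \<gamma> * (t + m / \<gamma>)) - std_normal_cdf (m / sqrt \<gamma>))
      / (sqrt \<gamma> * std_normal_density (m / sqrt \<gamma>))"
proof -
  define v where "v = sqrt \<gamma> * (t + m / \<gamma>)"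
  define w where "w = m / sqrt \<gamma>"
  have g: "sqrt \<gamma> > 0" "sqrt \<gamma> * w = m" using assms by (auto simp: w_def)
  have v: "v = w + sqrt \<gamma> * t"
    using assms by (simp add: v_def w_def ring_distribs) (simp add: field_simps)
  have "std_normal_cdf v - std_normal_cdf w = (\<integral>u. indicator {w<..v} u * std_normal_density u \<partial>lborel)"
  proof (cases "t = 0")
    case False
    hence "w < v" using assms g by (simp add: v)
    thus ?thesis by (simp add: std_normal.cdf_diff_eq measure_std_normal)
  qed (simp add: v)
  also have "\<dots> = sqrt \<gamma> * (\<integral>s. indicator {w<..v} (w + sqrt \<gamma> * s) * std_normal_density (w + sqrt \<gamma> * s) \<partial>lborel)"
    using g by (subst lborel_integral_real_affine[where c = "sqrt \<gamma>" and t = w]) auto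
  also have "(\<integral>s. indicator {w<..v} (w + sqrt \<gamma> * s) * std_normal_density (w + sqrt \<gamma> * s) \<partial>lborel) =
     (\<integral>s. std_normal_density w * (if 0 \<le> s \<and> s < t then exp (- (m * s + \<gamma> * s\<^sup>2 / 2)) else 0) \<partial>lborel)"
  \<comment> \<open>The half-open intervals \<open>{w<..v}\<close> and \<open>0 \<le> s < t\<close>
    correspond under the substitution except at the end points 0 and \<open>t\<close>.\<close>
  proof (intro integral_cong_AE AE_I'[of "{0, t}"] subsetI)
    fix s assume "s \<in> {s \<in> space lborel. indicat_real {w<..v} (w + sqrt \<gamma> * s) * std_normal_density (w + sqrt \<gamma> * s) \<noteq>
        std_normal_density w * (if 0 \<le> s \<and> s < t then exp (- (m * s + \<gamma> * s\<^sup>2 / 2)) else 0)}"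
    moreover have "std_normal_density (w + sqrt \<gamma> * s) = std_normal_density w * exp (- (m * s + \<gamma> * s\<^sup>2 / 2))"
    proof -
      have "w * (- (sqrt \<gamma> * s)) - (- (sqrt \<gamma> * s))\<^sup>2 / 2 = - ((sqrt \<gamma> * w) * s + \<gamma> * s\<^sup>2 / 2)"
        using assms by (simp add: power_mult_distrib)
      thus ?thesis using std_normal_density_diff[of w "- (sqrt \<gamma> * s)"] g by simp
    qed
    moreover have "w + sqrt \<gamma> * s \<in> {w<..v} \<longleftrightarrow> 0 < s \<and> s \<le> t"
      using g by (auto simp: v zero_less_mult_iff)
    ultimately show "s \<in> {0, t}" by (auto simp: indicator_def split: if_splits)
  qed (auto intro: finite_imp_null_set_lborel)
  also have "\<dots> = std_normal_density w * (\<integral>s. (if 0 \<le> s \<and> s < t then exp (- (m * s + \<gamma> * s\<^sup>2 / 2)) else 0) \<partial>lborel)"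
    by simp
  finally show ?thesis
    unfolding v_def[symmetric] w_def[symmetric] using g(1) by (simp add: eq_divide_eq mult_ac)
qed

lemma integrable_exp_decay:
  assumes "c > 0"
  shows "integrable lborel (\<lambda>s. if 0 \<le> s then exp (- (c * s)) else (0::real))"
    and "(\<integral>s. (if 0 \<le> s then exp (- (c * s)) else 0) \<partial>lborel) = 1 / c"
proof -
  interpret prob_space "density lborel (exponential_density c)"
    by (rule prob_space_exponential_density) fact
  have "(\<integral>\<^sup>+s. ennreal (exponential_density c s) \<partial>lborel) = 1"
    using emeasure_space_1 by (simp add: emeasure_density)
  hence "has_bochner_integral lborel (exponential_density c) 1"
    using exponential_density_nonneg[OF assms] by (intro has_bochner_integral_nn_integral) auto
  hence "has_bochner_integral lborel (\<lambda>s. 1 / c * exponential_density c s) (1 / c * 1)"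
    by (intro has_bochner_integral_mult_right)
  also have "(\<lambda>s. 1 / c * exponential_density c s) = (\<lambda>s. if 0 \<le> s then exp (- (c * s)) else 0)"
    using assms by (auto simp: exponential_density_def fun_eq_iff mult.commute)
  finally have "has_bochner_integral lborel (\<lambda>s. if 0 \<le> s then exp (- (c * s)) else 0) (1 / c)" by simp
  thus "integrable lborel (\<lambda>s. if 0 \<le> s then exp (- (c * s)) else (0::real))"
    "(\<integral>s. (if 0 \<le> s then exp (- (c * s)) else 0) \<partial>lborel) = 1 / c"
    by (auto simp: has_bochner_integral_iff)
qed

lemma gaussian_integrable_below:
  "integrable lborel (\<lambda>s::real. if 0 \<le> s then exp (m * s - s\<^sup>2 / 2) else 0)"
proof (rule Bochner_Integration.integrable_bound)
  have "integrable lborel (\<lambda>s. std_normal_density (m + (-1) * s) / std_normal_density m)"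
    using lborel_integrable_real_affine[OF integrable_std_normal_density, of "-1" m] by simp
  thus "integrable lborel (\<lambda>s. exp (m * s - s\<^sup>2 / 2))"
    using std_normal_density_pos[of m] by (simp add: std_normal_density_diff)
qed auto

text \<open>For negative \<open>m\<close>, dropping the quadratic term from the Gaussian integral
  bounds it by an exponential integral with value \<open>1 / (- m)\<close>. This fixes the sign of
  the threshold equation at 0.\<close>

lemma mills_ratio_bound: "0 \<le> m + std_normal_density m / std_normal_cdf m"
proof (cases "m < 0")
  case True
  have "std_normal_cdf m / std_normal_density m \<le> 1 / (- m)"
  proof -
    have "(\<integral>s. (if 0 \<le> s then exp (m * s - s\<^sup>2 / 2) else 0) \<partial>lborel) \<le>
        (\<integral>s. (if 0 \<le> s then exp (- (- m * s)) else 0) \<partial>lborel)"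
      using True by (intro integral_mono gaussian_integrable_below integrable_exp_decay(1)) auto
    thus ?thesis
      unfolding gaussian_integral_below using integrable_exp_decay(2)[of "-m"] True by simp
  qed
  thus ?thesis using True std_normal_density_pos[of m] std_normal_cdf_pos[of m]
    by (simp add: field_simps)
next
  case False
  thus ?thesis using std_normal_density_pos[of m] std_normal_cdf_pos[of m] by simp
qed

section \<open>The limiting cost\<close>

text \<open>Numerator and denominator of the limiting cost have derivatives with the same density
  factor. Their ratio is therefore stationary exactly where
  \<open>(a - p) * \<gamma> * T - p * m\<close> equals the ratio itself, which is the equation for
  the optimal threshold.\<close>

lemma DERIV_zhat_num:
  assumes "\<gamma> > 0"
  shows "(zhat_num p a \<gamma> m has_real_derivative
     std_normal_density (sqrt \<gamma> * (T + m / \<gamma>)) * ((a - p) * \<gamma> * T - p * m)) (at T)"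
proof -
  define f where "f = std_normal_density (sqrt \<gamma> * (T + m / \<gamma>))"
  have g: "sqrt \<gamma> * sqrt \<gamma> = \<gamma>" "sqrt \<gamma> > 0" using assms by auto
  have "p * (- (sqrt \<gamma> * (T + m / \<gamma>)) * f * sqrt \<gamma>) +
      a * (- (- (sqrt \<gamma> * (T + m / \<gamma>)) * f * sqrt \<gamma>) + m / sqrt \<gamma> * (- (f * sqrt \<gamma>))) =
      f * ((a - p) * (sqrt \<gamma> * sqrt \<gamma>) * (T + m / \<gamma>) - a * m)"
    using g(2) by (simp add: algebra_simps)
  also have "\<dots> = f * ((a - p) * \<gamma> * T - p * m)"
    unfolding g using assms by (simp add: field_simps)
  finally have eq: "p * (- (sqrt \<gamma> * (T + m / \<gamma>)) * f * sqrt \<gamma>) +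
      a * (- (- (sqrt \<gamma> * (T + m / \<gamma>)) * f * sqrt \<gamma>) + m / sqrt \<gamma> * (- (f * sqrt \<gamma>))) =
      f * ((a - p) * \<gamma> * T - p * m)" .
  have v: "((\<lambda>T. sqrt \<gamma> * (T + m / \<gamma>)) has_real_derivative sqrt \<gamma>) (at T)"
    using assms by (auto intro!: derivative_eq_intros)
  show ?thesis
    unfolding zhat_num_def[abs_def] Let_def f_def[symmetric] eq[symmetric]
    by (rule derivative_eq_intros v refl)+ (simp add: f_def)
qed

lemma DERIV_zhat_den:
  assumes "\<gamma> > 0"
  shows "(zhat_den \<gamma> m has_real_derivative std_normal_density (sqrt \<gamma> * (T + m / \<gamma>))) (at T)"
proof -
  have v: "((\<lambda>T. sqrt \<gamma> * (T + m / \<gamma>)) has_real_derivative sqrt \<gamma>) (at T)"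
    using assms by (auto intro!: derivative_eq_intros)
  show ?thesis
    unfolding zhat_den_def[abs_def] Let_def
    by (rule derivative_eq_intros v refl)+ (use assms in simp)
qed

lemma scaled_arg_0: "\<gamma> > 0 \<Longrightarrow> sqrt \<gamma> * (0 + m / \<gamma>) = m / sqrt \<gamma>"
  by (simp add: field_simps flip: real_sqrt_mult)

lemma zhat_den_0: "\<gamma> > 0 \<Longrightarrow>
    zhat_den \<gamma> m 0 = std_normal_density (m / sqrt \<gamma>) / std_normal_density m * std_normal_cdf m"
  using scaled_arg_0[of \<gamma> m] by (simp add: zhat_den_def)

lemma zhat_den_mono:
  assumes "\<gamma> > 0" "T \<le> T'"
  shows "zhat_den \<gamma> m T \<le> zhat_den \<gamma> m T'"
  by (rule DERIV_nonneg_imp_nondecreasing[OF assms(2)])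
     (use DERIV_zhat_den[OF assms(1)] std_normal_density_pos less_imp_le in blast)

lemma zhat_den_pos:
  assumes "\<gamma> > 0" "T \<ge> 0"
  shows "zhat_den \<gamma> m T > 0"
proof -
  have "0 < zhat_den \<gamma> m 0"
    using assms std_normal_density_pos std_normal_cdf_pos by (simp add: zhat_den_0)
  also have "\<dots> \<le> zhat_den \<gamma> m T" by (rule zhat_den_mono) fact+
  finally show ?thesis .
qed

lemma zhat_real_0:
  assumes "\<gamma> > 0"
  shows "zhat_real p a \<gamma> m 0 = p * (std_normal_density m / std_normal_cdf m)"
proof -
  have "zhat_num p a \<gamma> m 0 = p * std_normal_density (m / sqrt \<gamma>)"
    unfolding zhat_num_def scaled_arg_0[OF assms] by simp
  thus ?thesis
    using std_normal_cdf_pos[of m] unfolding zhat_real_def zhat_den_0[OF assms] by simp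
qed

text \<open>Multiplied by the denominator, the equation for the optimal threshold has a left-hand side
  with derivative \<open>(a - p) \<gamma>\<close> times that denominator.\<close>

lemma That_star_unique_exists:
  assumes "\<gamma> > 0" "0 < p" "p < a"
  shows "\<exists>!T. 0 \<le> T \<and> (a - p) * \<gamma> * T - zhat_real p a \<gamma> m T = p * m"
proof -
  define k where "k = (\<lambda>T. ((a - p) * \<gamma> * T - p * m) * zhat_den \<gamma> m T - zhat_num p a \<gamma> m T)"
  have c: "(a - p) * \<gamma> > 0" using assms by simp
  have k': "(k has_real_derivative (a - p) * \<gamma> * zhat_den \<gamma> m T) (at T)" for T
    unfolding k_def
    by (rule derivative_eq_intros DERIV_zhat_num DERIV_zhat_den assms refl)+ (simp add: algebra_simps)
  have root: "(a - p) * \<gamma> * T - zhat_real p a \<gamma> m T = p * m \<longleftrightarrow> k T = 0" if "T \<ge> 0" for T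
    using zhat_den_pos[OF assms(1) that, of m] by (auto simp: k_def zhat_real_def field_simps)
  have mono: "k T < k T'" if "0 \<le> T" "T < T'" for T T'
  proof (rule DERIV_pos_imp_increasing[OF that(2)])
    fix x assume "T \<le> x"
    hence "(a - p) * \<gamma> * zhat_den \<gamma> m x > 0"
      using c zhat_den_pos[OF assms(1), of x m] that by (intro mult_pos_pos[OF c]) auto
    thus "\<exists>y. (k has_real_derivative y) (at x) \<and> 0 < y" using k' by blast
  qed
  \<comment> \<open>At threshold 0 the limiting cost is \<open>p\<close> times the inverse Mills
    ratio, so the sign is that of \<open>mills_ratio_bound\<close>.\<close>
  have "k 0 \<le> 0"
  proof -
    have "k 0 = - (p * (m + std_normal_density m / std_normal_cdf m)) * zhat_den \<gamma> m 0"
      using zhat_real_0[OF assms(1), of p a m] zhat_den_pos[OF assms(1), of 0 m]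
      by (simp add: k_def zhat_real_def field_simps)
    also have "\<dots> \<le> 0"
      using mills_ratio_bound[of m] zhat_den_pos[OF assms(1), of 0 m] assms
      by (intro mult_nonpos_nonneg) (auto intro: mult_nonneg_nonneg)
    finally show ?thesis .
  qed
  moreover define D where "D = (a - p) * \<gamma> * zhat_den \<gamma> m 0"
  have D: "D > 0" using c zhat_den_pos[OF assms(1), of 0 m] by (simp add: D_def)
  \<comment> \<open>The derivative of \<open>k\<close> is at least its value \<open>D\<close> at 0
    because the denominator is nondecreasing. Growth is at least linear, so \<open>- k 0 / D\<close>
    bounds the root from above.\<close>
  moreover have "k 0 + D * T \<le> k T" if "T \<ge> 0" for T
  proof -
    have "k 0 - D * 0 \<le> k T - D * T"
    proof (rule DERIV_nonneg_imp_nondecreasing[OF that])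
      fix x :: real assume "0 \<le> x"
      have "((\<lambda>T. k T - D * T) has_real_derivative (a - p) * \<gamma> * zhat_den \<gamma> m x - D) (at x)"
        by (auto intro!: derivative_eq_intros k')
      moreover have "D \<le> (a - p) * \<gamma> * zhat_den \<gamma> m x"
        unfolding D_def using c zhat_den_mono[OF assms(1) \<open>0 \<le> x\<close>] by (intro mult_left_mono) auto
      ultimately show "\<exists>y. ((\<lambda>T. k T - D * T) has_real_derivative y) (at x) \<and> 0 \<le> y" by force
    qed
    thus ?thesis by simp
  qed
  from this[of "- k 0 / D"] have "k 0 + D * (- k 0 / D) \<le> k (- k 0 / D)"
    using D \<open>k 0 \<le> 0\<close> by (simp add: divide_nonpos_pos)
  hence "0 \<le> k (- k 0 / D)" using D by simp
  moreover have "continuous_on {0..- k 0 / D} k"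
    by (intro continuous_at_imp_continuous_on ballI DERIV_isCont[OF k'])
  ultimately obtain T where T: "0 \<le> T" "k T = 0"
    using IVT'[of k 0 0 "- k 0 / D"] \<open>k 0 \<le> 0\<close> D by (auto simp: divide_nonpos_pos)
  show ?thesis
  proof (rule ex1I[of _ T])
    fix T' assume "0 \<le> T' \<and> (a - p) * \<gamma> * T' - zhat_real p a \<gamma> m T' = p * m"
    hence "0 \<le> T'" "k T' = 0" using root by auto
    thus "T' = T" using mono[of T T'] mono[of T' T] T by (cases T T' rule: linorder_cases) auto
  qed (use T root in auto)
qed

definition That_fin :: "real \<Rightarrow> real \<Rightarrow> real \<Rightarrow> real \<Rightarrow> real" where
  "That_fin p a \<gamma> m = (THE T. 0 \<le> T \<and> (a - p) * \<gamma> * T - zhat_real p a \<gamma> m T = p * m)"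

definition zhat_opt :: "real \<Rightarrow> real \<Rightarrow> real \<Rightarrow> real \<Rightarrow> real" where
  "zhat_opt p a \<gamma> m = zhat p a \<gamma> m (That_star p a \<gamma> m)"

lemma That_star_eq:
  "That_star p a \<gamma> m = (if p < a then ereal (That_fin p a \<gamma> m) else \<infinity>)"
  by (simp add: That_star_def That_fin_def)

lemma That_fin:
  assumes "\<gamma> > 0" "0 < p" "p < a"
  shows "0 \<le> That_fin p a \<gamma> m"
    and "(a - p) * \<gamma> * That_fin p a \<gamma> m = zhat_opt p a \<gamma> m + p * m"
    and "zhat_opt p a \<gamma> m = zhat_real p a \<gamma> m (That_fin p a \<gamma> m)"
proof -
  show eq: "zhat_opt p a \<gamma> m = zhat_real p a \<gamma> m (That_fin p a \<gamma> m)"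
    using assms by (simp add: zhat_opt_def That_star_eq zhat_def)
  show "0 \<le> That_fin p a \<gamma> m"
    "(a - p) * \<gamma> * That_fin p a \<gamma> m = zhat_opt p a \<gamma> m + p * m"
    using theI'[OF That_star_unique_exists[OF assms, of m]] unfolding eq That_fin_def
    by (auto simp: algebra_simps)
qed

text \<open>With \<open>v\<close> the optimal value, \<open>num - v * den\<close> has derivative a
  positive multiple of \<open>x - T\<close>, so its minimum over thresholds is at \<open>T\<close>,
  where it is 0. Linearising the ratio in this way avoids differentiating the quotient.\<close>

lemma zhat_opt_le_zhat_real:
  assumes "\<gamma> > 0" "0 < p" "p < a" "t \<ge> 0"
  shows "zhat_opt p a \<gamma> m \<le> zhat_real p a \<gamma> m t"
proof -
  define v where "v = zhat_opt p a \<gamma> m"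
  define T where "T = That_fin p a \<gamma> m"
  define f where "f = (\<lambda>x. zhat_num p a \<gamma> m x - v * zhat_den \<gamma> m x)"
  have T: "T \<ge> 0" "(a - p) * \<gamma> * T = v + p * m" "v = zhat_real p a \<gamma> m T"
    using That_fin[OF assms(1-3), of m] by (auto simp: T_def v_def)
  have c: "(a - p) * \<gamma> > 0" using assms by simp
  have f': "(f has_real_derivative
      std_normal_density (sqrt \<gamma> * (x + m / \<gamma>)) * ((a - p) * \<gamma> * (x - T))) (at x)" for x
    unfolding f_def right_diff_distrib T(2)
    by (rule derivative_eq_intros DERIV_zhat_num DERIV_zhat_den assms refl)+ (simp add: algebra_simps)
  have "f T \<le> f t"
  proof (cases "T \<le> t")
    case True
    show ?thesis
    proof (rule DERIV_nonneg_imp_nondecreasing[OF True])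
      fix x assume "T \<le> x"
      hence "0 \<le> std_normal_density (sqrt \<gamma> * (x + m / \<gamma>)) * ((a - p) * \<gamma> * (x - T))"
        using \<open>T \<le> x\<close> mult_nonneg_nonneg[of "(a - p) * \<gamma>" "x - T"] c
        by (intro mult_nonneg_nonneg[OF less_imp_le[OF std_normal_density_pos]]) simp
      thus "\<exists>y. (f has_real_derivative y) (at x) \<and> 0 \<le> y" using f' by blast
    qed
  next
    case False
    hence le: "t \<le> T" by simp
    show ?thesis
    proof (rule DERIV_nonpos_imp_nonincreasing[OF le])
      fix x assume "x \<le> T"
      hence "std_normal_density (sqrt \<gamma> * (x + m / \<gamma>)) * ((a - p) * \<gamma> * (x - T)) \<le> 0"
        using \<open>x \<le> T\<close> mult_nonneg_nonpos[of "(a - p) * \<gamma>" "x - T"] c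
        by (intro mult_nonneg_nonpos[OF less_imp_le[OF std_normal_density_pos]]) simp
      thus "\<exists>y. (f has_real_derivative y) (at x) \<and> y \<le> 0" using f' by blast
    qed
  qed
  moreover have "f T = 0" using T zhat_den_pos[OF assms(1) T(1), of m] by (simp add: f_def zhat_real_def)
  ultimately show ?thesis
    using zhat_den_pos[OF assms(1,4), of m] by (simp add: f_def zhat_real_def v_def field_simps)
qed

text \<open>The outsourcing term carries the density at the threshold, which vanishes at infinity;
  hence one limit \<open>L\<close> serves all prices \<open>p\<close>. This permits replacing the
  price by 0 in the lower bound for \<open>a \<le> p\<close>.\<close>

lemma zhat_real_tendsto:
  assumes "\<gamma> > 0"
  obtains L where "\<And>p. (zhat_real p a \<gamma> m \<longlongrightarrow> L) at_top"
proof -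
  define w where "w = m / sqrt \<gamma>"
  define L where "L = a * (std_normal_density w + w * (std_normal_cdf w - 1)) /
    (std_normal_density w / std_normal_density m * std_normal_cdf m + 1 / sqrt \<gamma> * (1 - std_normal_cdf w))"
  have g: "sqrt \<gamma> > 0" using assms by simp
  have v: "LIM T at_top. sqrt \<gamma> * (T + m / \<gamma>) :> at_top"
    using g by real_asymp
  have \<Phi>: "((\<lambda>T. std_normal_cdf (sqrt \<gamma> * (T + m / \<gamma>))) \<longlongrightarrow> 1) at_top"
    by (rule filterlim_compose[OF std_normal.cdf_lim_at_top_prob v])
  have "(std_normal_density \<longlongrightarrow> 0) at_top"
    unfolding std_normal_density_def by real_asymp
  from filterlim_compose[OF this v]
  have \<phi>: "((\<lambda>T. std_normal_density (sqrt \<gamma> * (T + m / \<gamma>))) \<longlongrightarrow> 0) at_top" .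
  have "0 < std_normal_density w / std_normal_density m * std_normal_cdf m + 1 / sqrt \<gamma> * (1 - std_normal_cdf w)"
    using g std_normal_cdf_pos[of m] std_normal.cdf_bounded_prob[of w]
    by (intro add_pos_nonneg mult_pos_pos mult_nonneg_nonneg divide_pos_pos) auto
  moreover have "((\<lambda>T. p * std_normal_density (sqrt \<gamma> * (T + m / \<gamma>)) +
      a * (std_normal_density w - std_normal_density (sqrt \<gamma> * (T + m / \<gamma>))
           + w * (std_normal_cdf w - std_normal_cdf (sqrt \<gamma> * (T + m / \<gamma>))))) \<longlongrightarrow>
      p * 0 + a * (std_normal_density w - 0 + w * (std_normal_cdf w - 1))) at_top" for p
    by (intro tendsto_intros \<phi> \<Phi>)
  moreover have "((\<lambda>T. std_normal_density w / std_normal_density m * std_normal_cdf m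
      + 1 / sqrt \<gamma> * (std_normal_cdf (sqrt \<gamma> * (T + m / \<gamma>)) - std_normal_cdf w)) \<longlongrightarrow>
      std_normal_density w / std_normal_density m * std_normal_cdf m + 1 / sqrt \<gamma> * (1 - std_normal_cdf w)) at_top"
    by (intro tendsto_intros \<Phi>)
  ultimately have "((\<lambda>T. zhat_num p a \<gamma> m T / zhat_den \<gamma> m T) \<longlongrightarrow>
      (p * 0 + a * (std_normal_density w - 0 + w * (std_normal_cdf w - 1))) /
      (std_normal_density w / std_normal_density m * std_normal_cdf m + 1 / sqrt \<gamma> * (1 - std_normal_cdf w))) at_top" for p
    unfolding zhat_num_def zhat_den_def Let_def w_def[symmetric]
    by (intro tendsto_divide) simp_all
  hence "(zhat_real p a \<gamma> m \<longlongrightarrow> L) at_top" for p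
    unfolding zhat_real_def[abs_def] L_def by simp
  thus ?thesis by (rule that)
qed

lemma zhat_real_tendsto_zhat_opt:
  assumes "\<gamma> > 0" "a \<le> p"
  shows "(zhat_real p' a \<gamma> m \<longlongrightarrow> zhat_opt p a \<gamma> m) at_top"
proof -
  obtain L where L: "\<And>p. (zhat_real p a \<gamma> m \<longlongrightarrow> L) at_top"
    using zhat_real_tendsto[OF assms(1)] by blast
  have "zhat_opt p a \<gamma> m = L"
    using assms tendsto_Lim[OF _ L] by (simp add: zhat_opt_def zhat_def That_star_eq)
  with L show ?thesis by simp
qed

section \<open>Riemann sums and products\<close>

lemma integral_dominated_convergence_eventually:
  fixes s :: "nat \<Rightarrow> 'a \<Rightarrow> real"
  assumes meas: "f \<in> borel_measurable M" "\<And>i. s i \<in> borel_measurable M" "integrable M w"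
    and lim: "AE x in M. (\<lambda>i. s i x) \<longlonglongrightarrow> f x"
    and bound: "\<forall>\<^sub>F i in sequentially. AE x in M. \<bar>s i x\<bar> \<le> w x"
  shows "(\<lambda>i. integral\<^sup>L M (s i)) \<longlonglongrightarrow> integral\<^sup>L M f"
proof -
  obtain k where k: "\<And>i. i \<ge> k \<Longrightarrow> AE x in M. \<bar>s i x\<bar> \<le> w x"
    using bound by (auto simp: eventually_sequentially)
  have "(\<lambda>i. integral\<^sup>L M (s (i + k))) \<longlonglongrightarrow> integral\<^sup>L M f"
  proof (rule integral_dominated_convergence[of _ _ _ w])
    show "AE x in M. (\<lambda>i. s (i + k) x) \<longlonglongrightarrow> f x"
      using lim by (rule AE_mp) (auto intro: LIMSEQ_ignore_initial_segment)
  qed (use meas k in auto)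
  thus ?thesis by (rule LIMSEQ_offset)
qed

text \<open>Presents a scaled sum as the Lebesgue integral of a step function, so that dominated
  convergence applies to Riemann sums whose range may grow without bound.\<close>

lemma step_function_integral:
  assumes r: "r > (0::real)"
  shows "(\<integral>s. (if 0 \<le> s \<and> nat \<lfloor>s * r\<rfloor> < K then h (nat \<lfloor>s * r\<rfloor>) else 0) \<partial>lborel) =
    (\<Sum>j<K. h j) / (r::real)"
proof -
  let ?I = "\<lambda>j::nat. {real j / r..<(real j + 1) / r}"
  have mem: "s \<in> ?I j \<longleftrightarrow> 0 \<le> s \<and> nat \<lfloor>s * r\<rfloor> = j" for s j
  proof -
    have "s \<in> ?I j \<longleftrightarrow> real j \<le> s * r \<and> s * r < real j + 1"
      using r by (auto simp: field_simps)
    also have "\<dots> \<longleftrightarrow> 0 \<le> s * r \<and> nat \<lfloor>s * r\<rfloor> = j" by linarith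
    finally show ?thesis using r by (simp add: zero_le_mult_iff)
  qed
  have "(if 0 \<le> s \<and> nat \<lfloor>s * r\<rfloor> < K then h (nat \<lfloor>s * r\<rfloor>) else 0) = (\<Sum>j<K. h j * indicator (?I j) s)" for s
  proof -
    have "(\<Sum>j<K. h j * indicator (?I j) s) =
        (\<Sum>j<K. if j = nat \<lfloor>s * r\<rfloor> then (if 0 \<le> s then h j else 0) else 0)"
      using mem[of s] by (intro sum.cong refl) (auto simp del: atLeastLessThan_iff split: split_indicator)
    thus ?thesis by simp
  qed
  hence "(\<integral>s. (if 0 \<le> s \<and> nat \<lfloor>s * r\<rfloor> < K then h (nat \<lfloor>s * r\<rfloor>) else 0) \<partial>lborel) =
      (\<integral>s. (\<Sum>j<K. h j * indicator (?I j) s) \<partial>lborel)"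
    by presburger
  also have "\<dots> = (\<Sum>j<K. \<integral>s. h j * indicator (?I j) s \<partial>lborel)"
    by (intro Bochner_Integration.integral_sum integrable_mult_right integrable_real_indicator)
       (use r in \<open>auto simp: divide_right_mono\<close>)
  also have "\<dots> = (\<Sum>j<K. h j * (1 / r))"
  proof (intro sum.cong refl)
    fix j
    have "real j / r \<le> (real j + 1) / r" using r by (simp add: divide_right_mono)
    thus "(\<integral>s. h j * indicator (?I j) s \<partial>lborel) = h j * (1 / r)"
      using r by (simp add: measure_def diff_divide_distrib[symmetric] del: integral_mult_right)
  qed
  finally show ?thesis by (simp add: sum_divide_distrib)
qed

lemma riemann_sum_tendsto:
  fixes h :: "nat \<Rightarrow> nat \<Rightarrow> real" and r :: "nat \<Rightarrow> real"
  assumes r: "filterlim r at_top sequentially"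
    and bound: "\<forall>\<^sub>F n in sequentially. \<forall>j<K n. \<bar>h n j\<bar> \<le> C * exp (- (real j / r n))"
    and lim: "AE s in lborel. s \<ge> 0 \<longrightarrow>
      (\<lambda>n. if nat \<lfloor>s * r n\<rfloor> < K n then h n (nat \<lfloor>s * r n\<rfloor>) else 0) \<longlonglongrightarrow> f s"
    and [measurable]: "f \<in> borel_measurable borel"
  shows "(\<lambda>n. (\<Sum>j<K n. h n j) / r n) \<longlonglongrightarrow> (\<integral>s. (if 0 \<le> s then f s else 0) \<partial>lborel)"
proof -
  define S where "S = (\<lambda>n s. if 0 \<le> s \<and> nat \<lfloor>s * r n\<rfloor> < K n then h n (nat \<lfloor>s * r n\<rfloor>) else 0)"
  have r1: "\<forall>\<^sub>F n in sequentially. r n \<ge> 1"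
    using r by (simp add: filterlim_at_top)
  have "(\<lambda>n. integral\<^sup>L lborel (S n)) \<longlonglongrightarrow> (\<integral>s. (if 0 \<le> s then f s else 0) \<partial>lborel)"
  proof (rule integral_dominated_convergence_eventually)
    show "integrable lborel (\<lambda>s. \<bar>C\<bar> * exp 1 * (if 0 \<le> s then exp (- (1 * s)) else 0))"
      by (intro integrable_mult_right integrable_exp_decay) simp
    show "AE s in lborel. (\<lambda>n. S n s) \<longlonglongrightarrow> (if 0 \<le> s then f s else 0)"
      using lim by eventually_elim (simp add: S_def)
    show "\<forall>\<^sub>F n in sequentially. AE s in lborel.
        \<bar>S n s\<bar> \<le> \<bar>C\<bar> * exp 1 * (if 0 \<le> s then exp (- (1 * s)) else 0)"
      using bound r1
    proof eventually_elim
      case (elim n)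
      have "\<bar>S n s\<bar> \<le> \<bar>C\<bar> * exp 1 * (if 0 \<le> s then exp (- (1 * s)) else 0)" for s
      proof (cases "0 \<le> s \<and> nat \<lfloor>s * r n\<rfloor> < K n")
        case True
        define j where "j = nat \<lfloor>s * r n\<rfloor>"
        \<comment> \<open>Passing from the grid point \<open>j / r n\<close> to \<open>s\<close>
          loses at most one unit in the exponent once \<open>r n \<ge> 1\<close>; this is the factor
          \<open>exp 1\<close> in the dominating function.\<close>
        have "s * r n < real j + 1" unfolding j_def by linarith
        hence "s < (real j + 1) / r n" using elim by (simp add: field_simps)
        also have "\<dots> = real j / r n + 1 / r n" by (simp add: add_divide_distrib)
        also have "\<dots> \<le> real j / r n + 1" using elim by simp
        finally have "- (real j / r n) \<le> 1 - s" by simp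
        hence e: "exp (- (real j / r n)) \<le> exp 1 * exp (- s)" by (simp add: exp_add[symmetric])
        have "\<bar>h n j\<bar> \<le> C * exp (- (real j / r n))" using elim True unfolding j_def by blast
        also have "\<dots> \<le> \<bar>C\<bar> * (exp 1 * exp (- s))" using e by (intro mult_mono) auto
        finally show ?thesis using True by (simp add: S_def j_def mult.assoc)
      qed (auto simp: S_def)
      thus ?case by simp
    qed
    fix n
    have "(\<lambda>s. nat \<lfloor>s * r n\<rfloor>) \<in> borel \<rightarrow>\<^sub>M count_space UNIV" by measurable
    thus "S n \<in> borel_measurable lborel" unfolding S_def by measurable
  qed measurable
  moreover have "\<forall>\<^sub>F n in sequentially. integral\<^sup>L lborel (S n) = (\<Sum>j<K n. h n j) / r n"
    using r1 by eventually_elim (simp add: S_def step_function_integral)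
  ultimately show ?thesis by (rule Lim_transform_eventually)
qed

section \<open>Exponential limits of products\<close>

text \<open>Taking logarithms, the second-order error per factor is at most
  \<open>2 * (C / r)\<^sup>2\<close>. Over about \<open>t * r\<close> factors it adds up to order
  \<open>1 / r\<close>, so only the sum of the \<open>x n i\<close> survives.\<close>

lemma prod_one_plus_tendsto_exp:
  fixes x :: "nat \<Rightarrow> nat \<Rightarrow> real" and r :: "nat \<Rightarrow> real"
  assumes r: "filterlim r at_top sequentially"
    and J: "(\<lambda>n. real (J n) / r n) \<longlonglongrightarrow> t"
    and bound: "\<forall>\<^sub>F n in sequentially. \<forall>i<J n. \<bar>x n i\<bar> \<le> C / r n"
    and sum: "(\<lambda>n. \<Sum>i<J n. x n i) \<longlonglongrightarrow> \<sigma>"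
  shows "(\<lambda>n. \<Prod>i<J n. 1 + x n i) \<longlonglongrightarrow> exp \<sigma>"
proof -
  have inv: "(\<lambda>n. 1 / r n) \<longlonglongrightarrow> 0"
    using r by (intro real_tendsto_divide_at_top[OF tendsto_const])
  have "(\<lambda>n. C * (1 / r n)) \<longlonglongrightarrow> C * 0" by (intro tendsto_intros inv)
  hence "\<forall>\<^sub>F n in sequentially. C * (1 / r n) < 1 / 2"
    by (rule order_tendstoD) simp
  hence "\<forall>\<^sub>F n in sequentially. C / r n \<le> 1 / 2"
    by eventually_elim simp
  with bound have small: "\<forall>\<^sub>F n in sequentially. \<forall>i<J n. \<bar>x n i\<bar> \<le> C / r n \<and> \<bar>x n i\<bar> \<le> 1 / 2"
    by eventually_elim (meson order_trans)
  have "(\<lambda>n. (\<Sum>i<J n. ln (1 + x n i)) - (\<Sum>i<J n. x n i)) \<longlonglongrightarrow> 0"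
  proof (rule Lim_null_comparison)
    show "(\<lambda>n. 2 * C\<^sup>2 * (real (J n) / r n) * (1 / r n)) \<longlonglongrightarrow> 0"
      using tendsto_mult[OF tendsto_mult[OF tendsto_const J] inv, of "2 * C\<^sup>2"] by simp
    show "\<forall>\<^sub>F n in sequentially. norm ((\<Sum>i<J n. ln (1 + x n i)) - (\<Sum>i<J n. x n i))
        \<le> 2 * C\<^sup>2 * (real (J n) / r n) * (1 / r n)"
      using small
    proof eventually_elim
      case (elim n)
      have "norm ((\<Sum>i<J n. ln (1 + x n i)) - (\<Sum>i<J n. x n i)) \<le> (\<Sum>i<J n. \<bar>ln (1 + x n i) - x n i\<bar>)"
        unfolding sum_subtractf[symmetric] real_norm_def by (rule sum_abs)
      also have "\<dots> \<le> (\<Sum>i<J n. 2 * (C / r n)\<^sup>2)"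
      proof (intro sum_mono)
        fix i assume "i \<in> {..<J n}"
        hence i: "\<bar>x n i\<bar> \<le> C / r n" "\<bar>x n i\<bar> \<le> 1 / 2" using elim by auto
        have "\<bar>ln (1 + x n i) - x n i\<bar> \<le> 2 * (x n i)\<^sup>2"
          by (rule abs_ln_one_plus_x_minus_x_bound) fact
        also have "\<bar>x n i\<bar>\<^sup>2 \<le> (C / r n)\<^sup>2" using i by (intro power_mono) auto
        hence "2 * (x n i)\<^sup>2 \<le> 2 * (C / r n)\<^sup>2" by simp
        finally show "\<bar>ln (1 + x n i) - x n i\<bar> \<le> 2 * (C / r n)\<^sup>2" .
      qed
      also have "\<dots> = 2 * C\<^sup>2 * (real (J n) / r n) * (1 / r n)"
        by (simp add: power2_eq_square)
      finally show ?case .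
    qed
  qed
  from tendsto_add[OF this sum] have "(\<lambda>n. \<Sum>i<J n. ln (1 + x n i)) \<longlonglongrightarrow> \<sigma>" by simp
  hence "(\<lambda>n. exp (\<Sum>i<J n. ln (1 + x n i))) \<longlonglongrightarrow> exp \<sigma>" by (rule tendsto_exp)
  moreover have "\<forall>\<^sub>F n in sequentially. exp (\<Sum>i<J n. ln (1 + x n i)) = (\<Prod>i<J n. 1 + x n i)"
    using small
  proof eventually_elim
    case (elim n)
    have "1 + x n i > 0" if "i < J n" for i using elim that by (smt (verit) field_sum_of_halves)
    thus ?case by (simp add: exp_sum)
  qed
  ultimately show ?thesis by (rule Lim_transform_eventually)
qed

lemma sum_real_lessThan: "(\<Sum>i<J. real i) = real J * (real J - 1) / 2"
  by (induction J) (simp_all add: field_simps)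

text \<open>One limit for both sides of \<open>N\<close>: slope \<open>b = -1\<close> and
  \<open>d = 0\<close> below, where servers become idle, and \<open>b = d = \<gamma>\<close> above,
  where waiting customers abandon. Summing the linear term over the factors gives the quadratic
  exponent.\<close>

lemma prod_affine_tendsto_exp:
  fixes r \<mu> :: "nat \<Rightarrow> real"
  assumes r: "filterlim r at_top sequentially" and \<mu>: "\<mu> \<longlonglongrightarrow> m"
    and J: "(\<lambda>n. real (J n) / r n) \<longlonglongrightarrow> t"
  shows "(\<lambda>n. \<Prod>i<J n. 1 + (\<mu> n * r n + b * real i + d) / (r n)\<^sup>2) \<longlonglongrightarrow> exp (m * t + b * t\<^sup>2 / 2)"
proof (rule prod_one_plus_tendsto_exp[OF r J])
  have inv: "(\<lambda>n. 1 / r n) \<longlonglongrightarrow> 0"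
    using r by (intro real_tendsto_divide_at_top[OF tendsto_const])
  have pos: "\<forall>\<^sub>F n in sequentially. r n \<ge> 1"
    using r by (simp add: filterlim_at_top)
  have \<mu>1: "\<forall>\<^sub>F n in sequentially. \<bar>\<mu> n\<bar> < \<bar>m\<bar> + 1"
    by (rule order_tendstoD(2)[OF tendsto_rabs[OF \<mu>]]) simp
  have J1: "\<forall>\<^sub>F n in sequentially. real (J n) / r n < t + 1"
    by (rule order_tendstoD(2)[OF J]) simp
  show "\<forall>\<^sub>F n in sequentially. \<forall>i<J n. \<bar>(\<mu> n * r n + b * real i + d) / (r n)\<^sup>2\<bar>
      \<le> (\<bar>m\<bar> + 1 + \<bar>b\<bar> * (t + 1) + \<bar>d\<bar>) / r n"
    using pos \<mu>1 J1
  proof (eventually_elim, intro allI impI)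
    fix n i assume r: "1 \<le> r n" and \<mu>: "\<bar>\<mu> n\<bar> < \<bar>m\<bar> + 1" and J: "real (J n) / r n < t + 1" and i: "i < J n"
    have "real i \<le> (t + 1) * r n" using r J i by (simp add: field_simps)
    hence "\<bar>b\<bar> * real i \<le> \<bar>b\<bar> * ((t + 1) * r n)" by (intro mult_left_mono) auto
    moreover have "\<bar>\<mu> n\<bar> * r n \<le> (\<bar>m\<bar> + 1) * r n" using r \<mu> by (intro mult_right_mono) auto
    moreover have "\<bar>d\<bar> * 1 \<le> \<bar>d\<bar> * r n" using r by (intro mult_left_mono) auto
    moreover have "\<bar>\<mu> n * r n + b * real i + d\<bar> \<le> \<bar>\<mu> n * r n\<bar> + \<bar>b * real i\<bar> + \<bar>d\<bar>" by linarith
    moreover have "\<bar>\<mu> n * r n\<bar> = \<bar>\<mu> n\<bar> * r n" "\<bar>b * real i\<bar> = \<bar>b\<bar> * real i"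
      using r by (auto simp: abs_mult)
    ultimately have "\<bar>\<mu> n * r n + b * real i + d\<bar> \<le>
        (\<bar>m\<bar> + 1) * r n + \<bar>b\<bar> * ((t + 1) * r n) + \<bar>d\<bar> * r n" by linarith
    also have "\<dots> = (\<bar>m\<bar> + 1 + \<bar>b\<bar> * (t + 1) + \<bar>d\<bar>) * r n" by (simp add: algebra_simps)
    finally have "\<bar>\<mu> n * r n + b * real i + d\<bar> / (r n)\<^sup>2 \<le>
        (\<bar>m\<bar> + 1 + \<bar>b\<bar> * (t + 1) + \<bar>d\<bar>) * r n / (r n)\<^sup>2"
      by (intro divide_right_mono) auto
    thus "\<bar>(\<mu> n * r n + b * real i + d) / (r n)\<^sup>2\<bar> \<le> (\<bar>m\<bar> + 1 + \<bar>b\<bar> * (t + 1) + \<bar>d\<bar>) / r n"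
      using r by (simp add: power2_eq_square)
  qed
  have "(\<lambda>n. \<mu> n * (real (J n) / r n) + b / 2 * ((real (J n) / r n) * (real (J n) / r n - 1 / r n))
      + d * ((real (J n) / r n) * (1 / r n))) \<longlonglongrightarrow> m * t + b / 2 * (t * (t - 0)) + d * (t * 0)"
    by (intro tendsto_intros \<mu> J inv)
  also have "m * t + b / 2 * (t * (t - 0)) + d * (t * 0) = m * t + b * t\<^sup>2 / 2"
    by (simp add: power2_eq_square)
  finally show "(\<lambda>n. \<Sum>i<J n. (\<mu> n * r n + b * real i + d) / (r n)\<^sup>2) \<longlonglongrightarrow> m * t + b * t\<^sup>2 / 2"
  proof (rule Lim_transform_eventually)
    show "\<forall>\<^sub>F n in sequentially. \<mu> n * (real (J n) / r n) + b / 2 * ((real (J n) / r n) * (real (J n) / r n - 1 / r n))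
      + d * ((real (J n) / r n) * (1 / r n)) = (\<Sum>i<J n. (\<mu> n * r n + b * real i + d) / (r n)\<^sup>2)"
      using pos
    proof eventually_elim
      case (elim n)
      have "(\<Sum>i<J n. (\<mu> n * r n + b * real i + d) / (r n)\<^sup>2) =
          (real (J n) * (\<mu> n * r n) + b * (real (J n) * (real (J n) - 1) / 2) + real (J n) * d) / (r n)\<^sup>2"
        unfolding sum_real_lessThan[symmetric]
        by (simp add: sum_divide_distrib[symmetric] sum.distrib sum_distrib_left[symmetric])
      thus ?case using elim by (simp add: field_simps power2_eq_square)
    qed
  qed
qed

section \<open>Heavy-traffic limits\<close>

lemma weight_below_ratio:
  assumes "l > 0" "j \<le> N"
  shows "free_weight \<gamma> N l (N - j) / free_weight \<gamma> N l N = (\<Prod>i<j. (real N - real i) / l)"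
  using assms(2)
proof (induction j)
  case 0
  have "free_weight \<gamma> N l N > 0" using assms by (simp add: free_weight_below)
  thus ?case by simp
next
  case (Suc j)
  have "fact (N - j) = real (N - j) * fact (N - Suc j)" "l ^ (N - j) = l * l ^ (N - Suc j)"
    using Suc.prems by (simp_all add: fact_reduce Suc_diff_Suc flip: power_Suc)
  hence "free_weight \<gamma> N l (N - Suc j) = free_weight \<gamma> N l (N - j) * ((real N - real j) / l)"
    using Suc.prems assms(1) by (simp add: free_weight_below of_nat_diff)
  hence "free_weight \<gamma> N l (N - Suc j) / free_weight \<gamma> N l N =
      free_weight \<gamma> N l (N - j) / free_weight \<gamma> N l N * ((real N - real j) / l)" by simp
  also have "\<dots> = (\<Prod>i<Suc j. (real N - real i) / l)"
    using Suc by (simp only: prod.lessThan_Suc Suc_leD)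
  finally show ?case .
qed

text \<open>The reciprocal form leaves a product of affine factors, so the same limit applies as
  below \<open>N\<close>.\<close>

lemma weight_above_ratio:
  assumes "\<gamma> > 0" "l > 0"
  shows "free_weight \<gamma> N l (N + j) / free_weight \<gamma> N l N = 1 / (\<Prod>i<j. (real N + \<gamma> * real i + \<gamma>) / l)"
proof (induction j)
  case 0
  show ?case using free_weight_pos[OF assms, of N N] by simp
next
  case (Suc j)
  have "death_rate \<gamma> N (Suc (N + j)) = real N + \<gamma> * real j + \<gamma>"
    by (simp add: death_rate_def algebra_simps)
  hence "free_weight \<gamma> N l (N + Suc j) / free_weight \<gamma> N l N =
      free_weight \<gamma> N l (N + j) / free_weight \<gamma> N l N * (l / (real N + \<gamma> * real j + \<gamma>))"
    by (simp add: stationary_weight_Suc)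
  also have "\<dots> = 1 / (\<Prod>i<Suc j. (real N + \<gamma> * real i + \<gamma>) / l)"
    unfolding Suc by simp
  finally show ?case .
qed

text \<open>The scale \<open>s\<close> varies with \<open>n\<close> because the test thresholds of
  the lower bound depend on the current staffing. It may be negative for some \<open>n\<close>,
  where \<open>nat\<close> truncates; hence the comparison with \<open>max 0 (s n)\<close>.\<close>

lemma nat_floor_scaled_tendsto:
  fixes r s :: "nat \<Rightarrow> real"
  assumes r: "filterlim r at_top sequentially" and "s \<longlonglongrightarrow> t" "t \<ge> 0"
  shows "(\<lambda>n. real (nat \<lfloor>s n * r n\<rfloor>) / r n) \<longlonglongrightarrow> t"
    and "(\<lambda>n. real (nat \<lceil>s n * r n\<rceil>) / r n) \<longlonglongrightarrow> t"
proof -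
  have inv: "(\<lambda>n. 1 / r n) \<longlonglongrightarrow> 0"
    using r by (intro real_tendsto_divide_at_top[OF tendsto_const])
  have pos: "\<forall>\<^sub>F n in sequentially. r n > 0"
    using r by (simp add: filterlim_at_top_dense)
  have m: "(\<lambda>n. max 0 (s n)) \<longlonglongrightarrow> t"
    using tendsto_max[OF tendsto_const[of 0] assms(2)] assms(3) by (simp add: max_absorb2)
  have *: "(\<lambda>n. real (g n) / r n) \<longlonglongrightarrow> t"
    if g: "\<And>n. \<bar>real (g n) - max 0 (s n * r n)\<bar> \<le> 1" for g :: "nat \<Rightarrow> nat"
  proof (rule real_tendsto_sandwich)
    show "(\<lambda>n. max 0 (s n) - 1 / r n) \<longlonglongrightarrow> t" "(\<lambda>n. max 0 (s n) + 1 / r n) \<longlonglongrightarrow> t"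
      using tendsto_diff[OF m inv] tendsto_add[OF m inv] by simp_all
    have mx: "max 0 (s n) = max 0 (s n * r n) / r n" if "r n > 0" for n
      using that by (auto simp: max_def mult_le_0_iff zero_le_mult_iff)
    have g': "max 0 (s n * r n) - 1 \<le> real (g n)" "real (g n) \<le> max 0 (s n * r n) + 1" for n
      using g[of n] by linarith+
    show "\<forall>\<^sub>F n in sequentially. max 0 (s n) - 1 / r n \<le> real (g n) / r n"
      using pos by eventually_elim
        (auto simp: mx diff_divide_distrib[symmetric] simp del: max.bounded_iff intro!: divide_right_mono g')
    show "\<forall>\<^sub>F n in sequentially. real (g n) / r n \<le> max 0 (s n) + 1 / r n"
      using pos by eventually_elim
        (auto simp: mx add_divide_distrib[symmetric] intro!: divide_right_mono g')
  qed
  show "(\<lambda>n. real (nat \<lfloor>s n * r n\<rfloor>) / r n) \<longlonglongrightarrow> t" by (rule *) linarith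
  show "(\<lambda>n. real (nat \<lceil>s n * r n\<rceil>) / r n) \<longlonglongrightarrow> t" by (rule *) linarith
qed

text \<open>A deterministic sequence of realised arrival rates, centred and scaled by
  \<open>l\<close> itself. For a fixed realization \<open>x\<close> of \<open>X\<close> it is
  instantiated with \<open>m = \<beta> - x\<close>.\<close>

locale heavy_traffic =
  fixes \<gamma> m :: real and l :: "nat \<Rightarrow> real" and N :: "nat \<Rightarrow> nat"
  assumes gamma_pos: "\<gamma> > 0"
    and l_at_top: "filterlim l at_top sequentially"
    and staffing: "(\<lambda>n. (real (N n) - l n) / sqrt (l n)) \<longlonglongrightarrow> m"
begin

abbreviation r :: "nat \<Rightarrow> real" where "r n \<equiv> sqrt (l n)"

abbreviation \<mu> :: "nat \<Rightarrow> real" where "\<mu> n \<equiv> (real (N n) - l n) / r n"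

abbreviation w :: "nat \<Rightarrow> nat \<Rightarrow> real" where "w n \<equiv> free_weight \<gamma> (N n) (l n)"

lemma r_at_top: "filterlim r at_top sequentially"
  by (rule filterlim_compose[OF sqrt_at_top l_at_top])

lemma inverse_r: "(\<lambda>n. 1 / r n) \<longlonglongrightarrow> 0"
  using r_at_top by (intro real_tendsto_divide_at_top[OF tendsto_const])

lemma eventually_l: "\<forall>\<^sub>F n in sequentially. l n \<ge> 1"
  using l_at_top by (simp add: filterlim_at_top)

lemma eventually_\<mu>: "\<forall>\<^sub>F n in sequentially. \<bar>\<mu> n\<bar> < \<bar>m\<bar> + 1"
  by (rule order_tendstoD(2)[OF tendsto_rabs[OF staffing]]) simp

lemma l_eq: "l n \<ge> 1 \<Longrightarrow> l n = (r n)\<^sup>2" "l n \<ge> 1 \<Longrightarrow> r n \<ge> 1"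
  by simp_all

lemma N_eq: "l n \<ge> 1 \<Longrightarrow> real (N n) = (r n)\<^sup>2 + \<mu> n * r n"
  by simp

lemma factor_eq: "l n \<ge> 1 \<Longrightarrow> (real (N n) + y) / l n = 1 + (\<mu> n * r n + y) / (r n)\<^sup>2"
  by (simp add: field_simps)

lemma weight_below_tendsto:
  assumes J: "(\<lambda>n. real (J n) / r n) \<longlonglongrightarrow> t" and "\<forall>\<^sub>F n in sequentially. J n \<le> N n"
  shows "(\<lambda>n. w n (N n - J n) / w n (N n)) \<longlonglongrightarrow> exp (m * t - t\<^sup>2 / 2)"
proof -
  have "(\<lambda>n. \<Prod>i<J n. 1 + (\<mu> n * r n + (-1) * real i + 0) / (r n)\<^sup>2) \<longlonglongrightarrow> exp (m * t + (-1) * t\<^sup>2 / 2)"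
    by (rule prod_affine_tendsto_exp[OF r_at_top staffing J])
  hence "(\<lambda>n. \<Prod>i<J n. 1 + (\<mu> n * r n + (-1) * real i + 0) / (r n)\<^sup>2) \<longlonglongrightarrow> exp (m * t - t\<^sup>2 / 2)"
    by simp
  thus ?thesis
  proof (rule Lim_transform_eventually)
    show "\<forall>\<^sub>F n in sequentially. (\<Prod>i<J n. 1 + (\<mu> n * r n + (-1) * real i + 0) / (r n)\<^sup>2) =
        w n (N n - J n) / w n (N n)"
      using eventually_l assms(2)
    proof eventually_elim
      case (elim n)
      have "(real (N n) - real i) / l n = 1 + (\<mu> n * r n + (-1) * real i + 0) / (r n)\<^sup>2" for i
        using factor_eq[OF elim(1), of "- real i"] by simp
      thus ?case using elim weight_below_ratio[of "l n" "J n" "N n" \<gamma>] by simp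
    qed
  qed
qed

lemma weight_above_tendsto:
  assumes J: "(\<lambda>n. real (J n) / r n) \<longlonglongrightarrow> t"
  shows "(\<lambda>n. w n (N n + J n) / w n (N n)) \<longlonglongrightarrow> exp (- (m * t + \<gamma> * t\<^sup>2 / 2))"
proof -
  have "(\<lambda>n. 1 / (\<Prod>i<J n. 1 + (\<mu> n * r n + \<gamma> * real i + \<gamma>) / (r n)\<^sup>2)) \<longlonglongrightarrow>
      1 / exp (m * t + \<gamma> * t\<^sup>2 / 2)"
    by (intro tendsto_divide tendsto_const prod_affine_tendsto_exp[OF r_at_top staffing J]) simp
  also have "1 / exp (m * t + \<gamma> * t\<^sup>2 / 2) = exp (- (m * t + \<gamma> * t\<^sup>2 / 2))"
    by (simp only: exp_minus inverse_eq_divide)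
  finally show ?thesis
  proof (rule Lim_transform_eventually)
    show "\<forall>\<^sub>F n in sequentially. 1 / (\<Prod>i<J n. 1 + (\<mu> n * r n + \<gamma> * real i + \<gamma>) / (r n)\<^sup>2) =
        w n (N n + J n) / w n (N n)"
      using eventually_l
    proof eventually_elim
      case (elim n)
      have "(real (N n) + \<gamma> * real i + \<gamma>) / l n = 1 + (\<mu> n * r n + \<gamma> * real i + \<gamma>) / (r n)\<^sup>2" for i
        using factor_eq[OF elim, of "\<gamma> * real i + \<gamma>"] by (simp only: add.assoc)
      thus ?case using elim gamma_pos weight_above_ratio[of \<gamma> "l n" "N n" "J n"] by simp
    qed
  qed
qed

lemma weight_below_bound:
  "\<forall>\<^sub>F n in sequentially. \<forall>j<Suc (N n).
     \<bar>w n (N n - j) / w n (N n)\<bar> \<le> exp ((\<bar>m\<bar> + 3)\<^sup>2 / 2) * exp (- (real j / r n))"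
  using eventually_l eventually_\<mu>
proof (eventually_elim, intro allI impI)
  fix n j assume l: "1 \<le> l n" and \<mu>: "\<bar>\<mu> n\<bar> < \<bar>m\<bar> + 1" and "j < Suc (N n)"
  hence j: "j \<le> N n" by simp
  define s where "s = real j / r n"
  have s: "s \<ge> 0" using l by (simp add: s_def)
  have "w n (N n - j) / w n (N n) = (\<Prod>i<j. (real (N n) - real i) / l n)"
    using l j by (simp add: weight_below_ratio)
  also have "\<dots> \<le> (\<Prod>i<j. exp ((real (N n) - real i) / l n - 1))"
  proof (rule prod_mono, intro conjI)
    fix i assume "i \<in> {..<j}"
    thus "0 \<le> (real (N n) - real i) / l n" using j l by simp
    show "(real (N n) - real i) / l n \<le> exp ((real (N n) - real i) / l n - 1)"
      using exp_ge_add_one_self[of "(real (N n) - real i) / l n - 1"] by simp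
  qed
  also have "\<dots> = exp (\<Sum>i<j. (real (N n) - real i) / l n - 1)" by (simp add: exp_sum)
  also have "(\<Sum>i<j. (real (N n) - real i) / l n - 1) =
      (real j * real (N n) - real j * (real j - 1) / 2) / l n - real j"
    unfolding sum_real_lessThan[symmetric] by (simp add: sum_subtractf sum_divide_distrib[symmetric])
  also have "\<dots> = real j * (real (N n) - l n) / l n - real j * (real j - 1) / 2 / l n"
    using l by (simp add: diff_divide_distrib right_diff_distrib)
  also have "\<dots> = \<mu> n * s - s\<^sup>2 / 2 + s / (2 * r n)"
  proof -
    define R where "R = r n"
    have R: "R \<ge> 1" "l n = R * R" using l by (auto simp: R_def)
    show ?thesis unfolding s_def R_def[symmetric] R(2)
      using R(1) by (simp add: field_simps power2_eq_square)
  qed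
  \<comment> \<open>Three units of slope are paid for by the Gaussian term: one from replacing
    \<open>\<mu> n\<close> by \<open>\<bar>m\<bar> + 1\<close>, one from the rounding term, one to
    retain the factor \<open>exp (- s)\<close>. Completing the square gives the constant.\<close>
  also have "\<dots> \<le> (\<bar>m\<bar> + 3)\<^sup>2 / 2 - s"
  proof -
    have "1 \<le> 2 * r n" using l_eq(2)[OF l] by linarith
    hence "s / (2 * r n) \<le> s / 1" using s by (intro divide_left_mono mult_pos_pos) linarith+
    moreover have "\<mu> n \<le> \<bar>m\<bar> + 1" using \<mu> by linarith
    hence "\<mu> n * s \<le> (\<bar>m\<bar> + 1) * s" using s by (intro mult_right_mono)
    moreover have "0 \<le> (s - (\<bar>m\<bar> + 3))\<^sup>2" by simp
    hence "(\<bar>m\<bar> + 1) * s + s \<le> (\<bar>m\<bar> + 3)\<^sup>2 / 2 - s + s\<^sup>2 / 2"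
      by (simp add: power2_eq_square field_simps)
    ultimately show ?thesis by linarith
  qed
  finally have "w n (N n - j) / w n (N n) \<le> exp ((\<bar>m\<bar> + 3)\<^sup>2 / 2) * exp (- s)"
    by (simp add: exp_add[symmetric])
  moreover have "0 \<le> w n (N n - j) / w n (N n)"
    using l gamma_pos by (intro divide_nonneg_nonneg stationary_weight_nonneg) auto
  ultimately show "\<bar>w n (N n - j) / w n (N n)\<bar> \<le> exp ((\<bar>m\<bar> + 3)\<^sup>2 / 2) * exp (- (real j / r n))"
    by (simp add: s_def)
qed

text \<open>Only queue lengths up to \<open>(t + 1) * r n\<close> occur, so exponential growth at a
  fixed rate is harmless: the decaying factor required by the Riemann sum lemma is inserted and
  absorbed into the constant.\<close>

lemma weight_above_bound:
  assumes J: "(\<lambda>n. real (J n) / r n) \<longlonglongrightarrow> t"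
  shows "\<forall>\<^sub>F n in sequentially. \<forall>j<Suc (J n).
     \<bar>w n (N n + j) / w n (N n)\<bar> \<le> exp ((2 * \<bar>m\<bar> + 3) * (t + 1)) * exp (- (real j / r n))"
proof -
  define c where "c = \<bar>m\<bar> + 1"
  have J1: "\<forall>\<^sub>F n in sequentially. real (J n) / r n < t + 1"
    by (rule order_tendstoD(2)[OF J]) simp
  have "\<forall>\<^sub>F n in sequentially. r n \<ge> 2 * c"
    using r_at_top by (simp add: filterlim_at_top)
  thus ?thesis using eventually_l eventually_\<mu> J1
  proof (eventually_elim, intro allI impI)
    fix n j assume rc: "r n \<ge> 2 * c" and l: "1 \<le> l n" and \<mu>: "\<bar>\<mu> n\<bar> < \<bar>m\<bar> + 1"
      and J: "real (J n) / r n < t + 1" and j: "j < Suc (J n)"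
    define y where "y = c / r n"
    define s where "s = real j / r n"
    have y: "0 \<le> y" "y \<le> 1 / 2" using rc l by (auto simp: y_def c_def field_simps)
    \<comment> \<open>Valid on \<open>0 \<le> y \<le> 1 / 2\<close>, which is what
      \<open>r n \<ge> 2 * c\<close> secures. It bounds each factor from below by an exponential
      even when understaffing makes it less than 1.\<close>
    have "exp (- 2 * y) \<le> 1 - y"
    proof -
      have "y * y \<le> y * (1 / 2)" using y by (intro mult_left_mono) auto
      hence "2 * y\<^sup>2 \<le> y" by (simp add: power2_eq_square)
      hence "- 2 * y \<le> ln (1 - y)" using ln_one_minus_pos_lower_bound[of y] y by simp
      thus ?thesis using y by (subst ln_ge_iff[symmetric]) auto
    qed
    also have "1 - y \<le> 1 + \<mu> n * r n / (r n)\<^sup>2"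
    proof -
      define R where "R = r n"
      have "R \<ge> 1" using l by (simp add: R_def)
      moreover have "- c \<le> \<mu> n" using \<mu> unfolding c_def by linarith
      ultimately have "- c / R \<le> \<mu> n / R" by (intro divide_right_mono) auto
      moreover have "\<mu> n / R = \<mu> n * R / R\<^sup>2" by (simp add: power2_eq_square)
      ultimately show ?thesis unfolding y_def R_def[symmetric] by simp
    qed
    also have "\<dots> = real (N n) / l n" using factor_eq[OF l, of 0] by simp
    finally have base: "exp (- 2 * y) \<le> real (N n) / l n" .
    have "exp (- 2 * c * s) = (\<Prod>i<j. exp (- 2 * y))"
      by (simp add: s_def y_def exp_of_nat_mult[symmetric] mult.commute)
    also have "\<dots> \<le> (\<Prod>i<j. (real (N n) + \<gamma> * real i + \<gamma>) / l n)"
    proof (rule prod_mono, intro conjI)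
      fix i
      have "real (N n) / l n \<le> (real (N n) + \<gamma> * real i + \<gamma>) / l n"
        using l gamma_pos by (intro divide_right_mono) auto
      with base show "exp (- 2 * y) \<le> (real (N n) + \<gamma> * real i + \<gamma>) / l n" by simp
    qed simp
    finally have "1 / (\<Prod>i<j. (real (N n) + \<gamma> * real i + \<gamma>) / l n) \<le> 1 / exp (- 2 * c * s)"
      by (intro divide_left_mono mult_pos_pos) (auto intro: less_le_trans[OF exp_gt_zero])
    also have "\<dots> = exp ((2 * c + 1) * s) * exp (- s)"
      by (simp add: exp_minus exp_add[symmetric] field_simps flip: exp_add)
    also have "\<dots> \<le> exp ((2 * \<bar>m\<bar> + 3) * (t + 1)) * exp (- s)"
    proof -
      have "s \<le> real (J n) / r n" using j l by (simp add: s_def divide_right_mono)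
      hence "(2 * c + 1) * s \<le> (2 * c + 1) * (t + 1)"
        using J by (intro mult_left_mono) (auto simp: c_def)
      thus ?thesis by (simp add: c_def algebra_simps)
    qed
    finally have "w n (N n + j) / w n (N n) \<le> exp ((2 * \<bar>m\<bar> + 3) * (t + 1)) * exp (- s)"
      using l gamma_pos by (simp add: weight_above_ratio)
    moreover have "0 \<le> w n (N n + j) / w n (N n)"
      using l gamma_pos by (intro divide_nonneg_nonneg stationary_weight_nonneg) auto
    ultimately show "\<bar>w n (N n + j) / w n (N n)\<bar> \<le> exp ((2 * \<bar>m\<bar> + 3) * (t + 1)) * exp (- (real j / r n))"
      by (simp add: s_def)
  qed
qed

lemma sum_below_tendsto:
  "(\<lambda>n. (\<Sum>k\<le>N n. w n k) / w n (N n) / r n) \<longlonglongrightarrow> std_normal_cdf m / std_normal_density m"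
proof -
  define f where "f = (\<lambda>s::real. exp (m * s - s\<^sup>2 / 2))"
  \<comment> \<open>\<open>\<mu> n + r n\<close> is the staffing level divided by
    \<open>r n\<close>, so every fixed \<open>s\<close> eventually lies inside the range of
    summation.\<close>
  have "filterlim (\<lambda>n. \<mu> n + r n) at_top sequentially"
    by (rule filterlim_tendsto_add_at_top[OF staffing r_at_top])
  hence large: "\<forall>\<^sub>F n in sequentially. s < \<mu> n + r n" for s
    by (simp add: filterlim_at_top_dense)
  have below: "\<forall>\<^sub>F n in sequentially. nat \<lfloor>s * r n\<rfloor> < Suc (N n)" if "s \<ge> 0" for s
    using large[of s] eventually_l
  proof eventually_elim
    case (elim n)
    have "s * r n \<le> (\<mu> n + r n) * r n" using elim by (intro mult_right_mono) auto
    also have "\<dots> = real (N n)" using N_eq[OF elim(2)] by (simp add: ring_distribs power2_eq_square)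
    finally show ?case by linarith
  qed
  have "(\<lambda>n. (\<Sum>j<Suc (N n). w n (N n - j) / w n (N n)) / r n) \<longlonglongrightarrow>
      (\<integral>s. (if 0 \<le> s then f s else 0) \<partial>lborel)"
  proof (rule riemann_sum_tendsto[OF r_at_top weight_below_bound], intro AE_I2 impI)
    fix s :: real assume s: "s \<ge> 0"
    have "(\<lambda>n. w n (N n - nat \<lfloor>s * r n\<rfloor>) / w n (N n)) \<longlonglongrightarrow> f s"
      unfolding f_def using below[OF s]
      by (intro weight_below_tendsto nat_floor_scaled_tendsto[OF r_at_top tendsto_const s])
         (simp add: less_Suc_eq_le)
    thus "(\<lambda>n. if nat \<lfloor>s * r n\<rfloor> < Suc (N n) then w n (N n - nat \<lfloor>s * r n\<rfloor>) / w n (N n) else 0) \<longlonglongrightarrow> f s"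
      by (rule Lim_transform_eventually) (use below[OF s] in eventually_elim, simp)
  qed (simp add: f_def)
  moreover have "(\<Sum>j<Suc (N n). w n (N n - j) / w n (N n)) = (\<Sum>k\<le>N n. w n k) / w n (N n)" for n
    using sum.nat_diff_reindex[of "\<lambda>k. w n k / w n (N n)" "Suc (N n)"]
    by (simp add: sum_divide_distrib lessThan_Suc_atMost del: sum.lessThan_Suc)
  ultimately show ?thesis unfolding f_def gaussian_integral_below by (simp only:)
qed

definition I_above :: "real \<Rightarrow> real" where
  "I_above t = (\<integral>s. (if 0 \<le> s \<and> s < t then exp (- (m * s + \<gamma> * s\<^sup>2 / 2)) else 0) \<partial>lborel)"

lemma sum_above_tendsto:
  assumes J: "(\<lambda>n. real (J n) / r n) \<longlonglongrightarrow> t"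
  shows "(\<lambda>n. (\<Sum>j\<in>{1..J n}. w n (N n + j)) / w n (N n) / r n) \<longlonglongrightarrow> I_above t"
proof -
  define f where "f = (\<lambda>s::real. if s < t then exp (- (m * s + \<gamma> * s\<^sup>2 / 2)) else 0)"
  have "(\<lambda>n. (\<Sum>j<Suc (J n). w n (N n + j) / w n (N n)) / r n) \<longlonglongrightarrow>
      (\<integral>s. (if 0 \<le> s then f s else 0) \<partial>lborel)"
  proof (rule riemann_sum_tendsto[OF r_at_top weight_above_bound[OF J]])
    \<comment> \<open>At the cut-off \<open>s = t\<close> the indicator of the summation range need
      not converge; a single point is negligible.\<close>
    have "AE s in lborel. s \<noteq> t" by (rule AE_lborel_singleton)
    thus "AE s in lborel. s \<ge> 0 \<longrightarrow>
      (\<lambda>n. if nat \<lfloor>s * r n\<rfloor> < Suc (J n) then w n (N n + nat \<lfloor>s * r n\<rfloor>) / w n (N n) else 0) \<longlonglongrightarrow> f s"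
    proof (eventually_elim, intro impI)
      fix s :: real assume st: "s \<noteq> t" and s: "s \<ge> 0"
      note fl = nat_floor_scaled_tendsto(1)[OF r_at_top tendsto_const s]
      show "(\<lambda>n. if nat \<lfloor>s * r n\<rfloor> < Suc (J n) then w n (N n + nat \<lfloor>s * r n\<rfloor>) / w n (N n) else 0) \<longlonglongrightarrow> f s"
      proof (cases "s < t")
        case True
        have "\<forall>\<^sub>F n in sequentially. 0 < real (J n) / r n - real (nat \<lfloor>s * r n\<rfloor>) / r n"
          by (rule order_tendstoD(1)[OF tendsto_diff[OF J fl]]) (use True in simp)
        hence "\<forall>\<^sub>F n in sequentially. nat \<lfloor>s * r n\<rfloor> < Suc (J n)"
          using eventually_l by eventually_elim (simp add: divide_less_cancel)
        hence "\<forall>\<^sub>F n in sequentially. w n (N n + nat \<lfloor>s * r n\<rfloor>) / w n (N n) =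
            (if nat \<lfloor>s * r n\<rfloor> < Suc (J n) then w n (N n + nat \<lfloor>s * r n\<rfloor>) / w n (N n) else 0)"
          by eventually_elim simp
        moreover have "(\<lambda>n. w n (N n + nat \<lfloor>s * r n\<rfloor>) / w n (N n)) \<longlonglongrightarrow> f s"
          using weight_above_tendsto[OF fl] True by (simp add: f_def)
        ultimately show ?thesis by (rule Lim_transform_eventually[rotated])
      next
        case False
        have "(\<lambda>n. real (nat \<lfloor>s * r n\<rfloor>) / r n - real (J n) / r n - 1 / r n) \<longlonglongrightarrow> s - t - 0"
          by (intro tendsto_diff fl J inverse_r)
        hence "\<forall>\<^sub>F n in sequentially. 0 < real (nat \<lfloor>s * r n\<rfloor>) / r n - real (J n) / r n - 1 / r n"
          by (rule order_tendstoD(1)) (use False st in simp)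
        hence "\<forall>\<^sub>F n in sequentially. \<not> nat \<lfloor>s * r n\<rfloor> < Suc (J n)"
          using eventually_l
          by eventually_elim (simp add: diff_divide_distrib[symmetric] zero_less_divide_iff)
        hence "\<forall>\<^sub>F n in sequentially. (if nat \<lfloor>s * r n\<rfloor> < Suc (J n)
            then w n (N n + nat \<lfloor>s * r n\<rfloor>) / w n (N n) else 0) = 0"
          by eventually_elim simp
        thus ?thesis using False by (simp add: f_def tendsto_eventually)
      qed
    qed
  qed (simp add: f_def)
  moreover have I: "(\<integral>s. (if 0 \<le> s then f s else 0) \<partial>lborel) = I_above t"
    unfolding I_above_def by (intro Bochner_Integration.integral_cong) (auto simp: f_def)
  ultimately have "(\<lambda>n. (\<Sum>j<Suc (J n). w n (N n + j) / w n (N n)) / r n) \<longlonglongrightarrow> I_above t"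
    by (simp only:)
  \<comment> \<open>The term \<open>j = 0\<close> belongs to the sum up to \<open>N\<close>;
    removing it changes the Riemann sum by \<open>1 / r n\<close>.\<close>
  from tendsto_diff[OF this inverse_r]
  have "(\<lambda>n. (\<Sum>j<Suc (J n). w n (N n + j) / w n (N n)) / r n - 1 / r n) \<longlonglongrightarrow> I_above t"
    by simp
  thus ?thesis
  proof (rule Lim_transform_eventually)
    show "\<forall>\<^sub>F n in sequentially. (\<Sum>j<Suc (J n). w n (N n + j) / w n (N n)) / r n - 1 / r n =
        (\<Sum>j\<in>{1..J n}. w n (N n + j)) / w n (N n) / r n"
      using eventually_l
    proof eventually_elim
      case (elim n)
      have "w n (N n) > 0" using elim gamma_pos by (intro free_weight_pos) auto
      have "(\<Sum>j<Suc (J n). w n (N n + j) / w n (N n)) = 1 + (\<Sum>j\<in>{1..J n}. w n (N n + j) / w n (N n))"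
        unfolding sum.lessThan_Suc_shift using \<open>w n (N n) > 0\<close>
        by (simp add: sum.atLeast1_atMost_eq)
      thus ?case by (simp add: sum_divide_distrib add_divide_distrib)
    qed
  qed
qed

text \<open>Division of numerator and denominator by the density at \<open>m / sqrt \<gamma>\<close>
  brings the Gaussian formula into the shape of the prelimit cost: limiting weight at the threshold,
  and limiting masses below and above \<open>N\<close>.\<close>

lemma zhat_real_eq:
  assumes "t \<ge> 0"
  shows "zhat_real p a \<gamma> m t =
    (p * exp (- (m * t + \<gamma> * t\<^sup>2 / 2)) + a * (1 - exp (- (m * t + \<gamma> * t\<^sup>2 / 2)) - m * I_above t))
      / (std_normal_cdf m / std_normal_density m + I_above t)"
proof -
  define v where "v = sqrt \<gamma> * (t + m / \<gamma>)"
  define u where "u = m / sqrt \<gamma>"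
  define e where "e = exp (- (m * t + \<gamma> * t\<^sup>2 / 2))"
  define f where "f = std_normal_density u"
  have g: "sqrt \<gamma> > 0" "sqrt \<gamma> * u = m" using gamma_pos by (auto simp: u_def)
  have f: "f > 0" by (simp add: f_def)
  have v: "v = u + sqrt \<gamma> * t"
    using gamma_pos by (simp add: v_def u_def ring_distribs) (simp add: field_simps)
  have "std_normal_density v = f * e"
  proof -
    have "u * (- (sqrt \<gamma> * t)) - (- (sqrt \<gamma> * t))\<^sup>2 / 2 = - ((sqrt \<gamma> * u) * t + \<gamma> * t\<^sup>2 / 2)"
      using gamma_pos by (simp add: power_mult_distrib)
    thus ?thesis using std_normal_density_diff[of u "- (sqrt \<gamma> * t)"] g by (simp add: v f_def e_def)
  qed
  moreover have "std_normal_cdf v - std_normal_cdf u = sqrt \<gamma> * f * I_above t"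
    using gaussian_integral_above[OF gamma_pos assms, of m] g(1) f
    unfolding I_above_def v_def[symmetric] u_def[symmetric] f_def by (simp add: field_simps)
  moreover from this have "u * (std_normal_cdf u - std_normal_cdf v) = - f * ((sqrt \<gamma> * u) * I_above t)"
    by (simp add: algebra_simps)
  hence "u * (std_normal_cdf u - std_normal_cdf v) = - f * (m * I_above t)"
    unfolding g(2) .
  ultimately have "zhat_num p a \<gamma> m t = f * (p * e + a * (1 - e - m * I_above t))"
    "zhat_den \<gamma> m t = f * (std_normal_cdf m / std_normal_density m + I_above t)"
    unfolding zhat_num_def zhat_den_def Let_def v_def[symmetric] u_def[symmetric] f_def[symmetric]
    using g(1) by (simp_all only:) (simp_all add: algebra_simps)
  thus ?thesis using f by (simp add: zhat_real_def e_def)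
qed

lemma I_above_nonneg: "I_above t \<ge> 0"
  unfolding I_above_def by (intro Bochner_Integration.integral_nonneg) simp

text \<open>After \<open>queue_sum_eq\<close>, the numerator is divided by
  \<open>l n * w n (N n)\<close> and the denominator by \<open>r n * w n (N n)\<close>. The
  remaining factor \<open>r n\<close> is the scaling of the cost, and every piece has a known
  limit.\<close>

lemma threshold_cost_tendsto:
  assumes J: "(\<lambda>n. real (J n) / r n) \<longlonglongrightarrow> t"
  shows "(\<lambda>n. threshold_cost p a \<gamma> (N n) (l n) (N n + J n) / r n) \<longlonglongrightarrow> zhat_real p a \<gamma> m t"
proof -
  have t: "t \<ge> 0"
    by (rule tendsto_lowerbound[OF J]) (use eventually_l in \<open>auto elim: eventually_mono\<close>)
  have den: "std_normal_cdf m / std_normal_density m + I_above t \<noteq> 0"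
    using I_above_nonneg[of t] std_normal_cdf_pos[of m] std_normal_density_pos[of m]
    by (metis add_pos_nonneg divide_pos_pos less_irrefl)
  have "(\<lambda>n. (p * (w n (N n + J n) / w n (N n)) + a * (1 - w n (N n + J n) / w n (N n)
        - \<mu> n * ((\<Sum>j\<in>{1..J n}. w n (N n + j)) / w n (N n) / r n))) /
      ((\<Sum>k\<le>N n. w n k) / w n (N n) / r n + (\<Sum>j\<in>{1..J n}. w n (N n + j)) / w n (N n) / r n))
    \<longlonglongrightarrow> zhat_real p a \<gamma> m t"
    unfolding zhat_real_eq[OF t]
    by (intro tendsto_intros weight_above_tendsto[OF J] sum_above_tendsto[OF J] sum_below_tendsto staffing den)
  thus ?thesis
  proof (rule Lim_transform_eventually)
    show "\<forall>\<^sub>F n in sequentially. (p * (w n (N n + J n) / w n (N n)) + a * (1 - w n (N n + J n) / w n (N n)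
        - \<mu> n * ((\<Sum>j\<in>{1..J n}. w n (N n + j)) / w n (N n) / r n))) /
      ((\<Sum>k\<le>N n. w n k) / w n (N n) / r n + (\<Sum>j\<in>{1..J n}. w n (N n + j)) / w n (N n) / r n) =
      threshold_cost p a \<gamma> (N n) (l n) (N n + J n) / r n"
      using eventually_l
    proof eventually_elim
      case (elim n)
      define W where "W = w n (N n)"
      define U where "U = (\<Sum>j\<in>{1..J n}. w n (N n + j))"
      define S where "S = (\<Sum>k\<le>N n. w n k)"
      define V where "V = w n (N n + J n)"
      define R where "R = r n"
      have wpos: "w n k > 0" for k
        using elim gamma_pos by (intro free_weight_pos) auto
      have "W > 0" "S > 0" "U \<ge> 0"
        unfolding W_def S_def U_def using wpos by (auto intro!: sum_pos sum_nonneg simp: less_imp_le)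
      hence pos: "W > 0" "S > 0" "U \<ge> 0" "R > 0" "l n = R * R"
        using elim by (auto simp: R_def)
      have "(p * (V / W) + a * (1 - V / W - (real (N n) - R * R) / R * (U / W / R))) / (S / W / R + U / W / R) =
         (p * ((R * R) * V) + a * ((R * R) * (W - V) - (real (N n) - R * R) * U)) / (S + U) / R"
      proof -
        have "S / W / R + U / W / R = (S + U) / (W * R)" by (simp add: add_divide_distrib)
        moreover have "p * (V / W) + a * (1 - V / W - (real (N n) - R * R) / R * (U / W / R)) =
          (p * ((R * R) * V) + a * ((R * R) * (W - V) - (real (N n) - R * R) * U)) / (W * R * R)"
          using pos by (simp add: field_simps)
        ultimately show ?thesis using pos by simp
      qed
      thus ?case
        unfolding threshold_cost_eq[OF gamma_pos] queue_sum_eq[OF gamma_pos] sum_atMost_add_split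
          W_def[symmetric] U_def[symmetric] S_def[symmetric] V_def[symmetric] R_def[symmetric] pos(5)[symmetric]
        by simp
    qed
  qed
qed

end

lemma nat_ceiling_of_nat_add: "0 \<le> y \<Longrightarrow> nat \<lceil>real N + y\<rceil> = N + nat \<lceil>y\<rceil>"
  by linarith

section \<open>Convergence of the optimal and of the proposed cost\<close>

context heavy_traffic
begin

text \<open>A single scaled threshold \<open>t\<close> suffices: the optimal one if
  \<open>p < a\<close>, and otherwise one so large that its limiting cost is already below
  \<open>y\<close>.\<close>

lemma opt_cost_tendsto_upper:
  assumes "0 < p" "0 < a" "zhat_opt p a \<gamma> m < y"
  shows "\<forall>\<^sub>F n in sequentially. opt_cost p a \<gamma> (N n) (l n) / r n < y"
proof -
  obtain t where t: "t \<ge> 0" "zhat_real p a \<gamma> m t < y"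
  proof (cases "p < a")
    case True
    thus ?thesis using That_fin[OF gamma_pos assms(1) True, of m] assms(3)
      by (intro that[of "That_fin p a \<gamma> m"]) auto
  next
    case False
    hence "\<forall>\<^sub>F t in at_top. zhat_real p a \<gamma> m t < y"
      using order_tendstoD(2)[OF zhat_real_tendsto_zhat_opt[OF gamma_pos] assms(3)] by simp
    from eventually_conj[OF this eventually_ge_at_top[of 0]] show ?thesis
      using that by (metis (mono_tags, lifting) eventually_at_top_linorder order_refl)
  qed
  define J where "J = (\<lambda>n. nat \<lceil>t * r n\<rceil>)"
  have "(\<lambda>n. real (J n) / r n) \<longlonglongrightarrow> t"
    unfolding J_def by (intro nat_floor_scaled_tendsto r_at_top tendsto_const t)
  from order_tendstoD(2)[OF threshold_cost_tendsto[OF this] t(2)] eventually_l show ?thesis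
  proof eventually_elim
    case (elim n)
    have "opt_cost p a \<gamma> (N n) (l n) / r n \<le> threshold_cost p a \<gamma> (N n) (l n) (N n + J n) / r n"
      using elim assms gamma_pos by (intro divide_right_mono opt_cost_le_threshold_cost) auto
    thus ?case using elim by linarith
  qed
qed

lemma opt_cost_tendsto_lower:
  assumes "0 < p" "0 < a" "y < zhat_opt p a \<gamma> m"
  shows "\<forall>\<^sub>F n in sequentially. y \<le> opt_cost p a \<gamma> (N n) (l n) / r n"
proof (cases "p < a")
  case True
  define s where "s = (\<lambda>n. (y + p * \<mu> n) / ((a - p) * \<gamma>))"
  define t where "t = (y + p * m) / ((a - p) * \<gamma>)"
  define J where "J = (\<lambda>n. nat \<lfloor>s n * r n\<rfloor>)"
  have c: "(a - p) * \<gamma> > 0" using True gamma_pos by simp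
  have s: "s \<longlonglongrightarrow> t"
    unfolding s_def t_def using c by (intro tendsto_intros staffing) auto
  have *: "y \<le> opt_cost p a \<gamma> (N n) (l n) / r n"
    if l: "l n \<ge> 1"
      and z: "s n \<ge> 0 \<Longrightarrow> y * r n \<le> threshold_cost p a \<gamma> (N n) (l n) (N n + J n)" for n
  proof -
    have R: "r n > 0" using l by simp
    have eq: "y * r n + p * (real (N n) - l n) = (y + p * \<mu> n) * r n"
    proof -
      have "real (N n) - l n = \<mu> n * r n" using R by simp
      thus ?thesis by (simp only: distrib_right mult.assoc)
    qed
    have "y * r n \<le> opt_cost p a \<gamma> (N n) (l n)"
    proof (rule opt_cost_ge_if_threshold_cost_ge)
      show "J n = nat \<lfloor>(y * r n + p * (real (N n) - l n)) / ((a - p) * \<gamma>)\<rfloor>"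
        unfolding eq J_def s_def by simp
      assume "0 \<le> y * r n + p * (real (N n) - l n)"
      hence "s n \<ge> 0" unfolding eq s_def using R c
        by (intro divide_nonneg_pos) (auto simp: zero_le_mult_iff)
      thus "y * r n \<le> threshold_cost p a \<gamma> (N n) (l n) (N n + J n)" by (rule z)
    qed (use gamma_pos l assms True in auto)
    thus ?thesis using R by (simp add: pos_le_divide_eq)
  qed
  show ?thesis
  proof (cases "t \<ge> 0")
    \<comment> \<open>Eventually the test level is below the net cost of every state, so no
      threshold has to be checked.\<close>
    case False
    hence "\<forall>\<^sub>F n in sequentially. s n < 0" using s by (intro order_tendstoD(2)[OF s]) simp
    thus ?thesis using eventually_l by eventually_elim (rule *, auto)
  next
    case t: True
    \<comment> \<open>The threshold \<open>t\<close> selected by \<open>y\<close> is in general not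
      the optimal one; optimality enters only as the inequality
      \<open>zhat_opt \<le> zhat_real\<close> at \<open>t\<close>.\<close>
    have "y < zhat_real p a \<gamma> m t"
      using zhat_opt_le_zhat_real[OF gamma_pos assms(1) True t, of m] assms(3) by simp
    moreover have "(\<lambda>n. real (J n) / r n) \<longlonglongrightarrow> t"
      unfolding J_def by (intro nat_floor_scaled_tendsto r_at_top s t)
    ultimately have "\<forall>\<^sub>F n in sequentially. y < threshold_cost p a \<gamma> (N n) (l n) (N n + J n) / r n"
      using order_tendstoD(1)[OF threshold_cost_tendsto] by blast
    thus ?thesis using eventually_l
    proof eventually_elim
      case (elim n)
      have "r n > 0" using elim by simp
      thus ?case using elim by (intro *) (auto simp: pos_less_divide_eq)
    qed
  qed
next
  case False
  have "\<forall>\<^sub>F t in at_top. y < zhat_real 0 a \<gamma> m t"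
    using False order_tendstoD(1)[OF zhat_real_tendsto_zhat_opt[OF gamma_pos] assms(3)] by simp
  from eventually_conj[OF this eventually_ge_at_top[of 0]]
  obtain t where t: "t \<ge> 0" "y < zhat_real 0 a \<gamma> m t"
    by (metis (mono_tags, lifting) eventually_at_top_linorder order_refl)
  define J where "J = (\<lambda>n. nat \<lceil>t * r n\<rceil>)"
  have "(\<lambda>n. real (J n) / r n) \<longlonglongrightarrow> t"
    unfolding J_def by (intro nat_floor_scaled_tendsto r_at_top tendsto_const t)
  from order_tendstoD(1)[OF threshold_cost_tendsto[OF this] t(2)] eventually_l show ?thesis
  proof eventually_elim
    case (elim n)
    hence l: "l n > 0" "r n > 0" by simp_all
    \<comment> \<open>From the price-0 cost at \<open>N + J\<close> one moves up to
      \<open>K'\<close>, raises the price to \<open>p\<close>, and moves down to \<open>K\<close>.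
      Each move goes in the direction in which the cost does not decrease.\<close>
    have "y * r n \<le> threshold_cost p a \<gamma> (N n) (l n) K" for K
    proof -
      define K' where "K' = max K (N n + J n)"
      have "y * r n \<le> threshold_cost 0 a \<gamma> (N n) (l n) (N n + J n)"
        using elim l by (simp add: pos_less_divide_eq)
      also have "\<dots> \<le> threshold_cost 0 a \<gamma> (N n) (l n) K'"
        using gamma_pos l assms by (intro threshold_cost_no_outsourcing_mono) (auto simp: K'_def)
      also have "\<dots> \<le> threshold_cost p a \<gamma> (N n) (l n) K'"
        using gamma_pos l assms by (intro threshold_cost_mono_price) auto
      also have "\<dots> \<le> threshold_cost p a \<gamma> (N n) (l n) K"
        using gamma_pos l assms False by (intro threshold_cost_antimono) (auto simp: K'_def)
      finally show ?thesis .
    qed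
    hence "y * r n \<le> opt_cost p a \<gamma> (N n) (l n)"
      using gamma_pos l by (intro opt_cost_ge) auto
    thus ?case using l by (simp add: pos_le_divide_eq)
  qed
qed

lemma opt_cost_tendsto:
  assumes "0 < p" "0 < a"
  shows "(\<lambda>n. opt_cost p a \<gamma> (N n) (l n) / r n) \<longlonglongrightarrow> zhat_opt p a \<gamma> m"
proof (rule order_tendstoI)
  fix y assume "y < zhat_opt p a \<gamma> m"
  then obtain y' where "y < y'" "y' < zhat_opt p a \<gamma> m" using dense by blast
  with opt_cost_tendsto_lower[OF assms, of y']
  show "\<forall>\<^sub>F n in sequentially. y < opt_cost p a \<gamma> (N n) (l n) / r n"
    by (auto elim!: eventually_mono)
qed (use opt_cost_tendsto_upper[OF assms] in auto)

lemma star_cost_tendsto: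
  assumes "0 < p" "0 < a"
  shows "(\<lambda>n. operating_cost p a \<gamma>
      (threshold_policy (ereal (real (N n)) + That_star p a \<gamma> m * ereal (r n))) (N n) (l n) / r n)
    \<longlonglongrightarrow> zhat_opt p a \<gamma> m"
proof (cases "p < a")
  case True
  define T where "T = That_fin p a \<gamma> m"
  have T: "T \<ge> 0" "zhat_opt p a \<gamma> m = zhat_real p a \<gamma> m T"
    using That_fin[OF gamma_pos assms(1) True, of m] by (auto simp: T_def)
  define J where "J = (\<lambda>n. nat \<lceil>T * r n\<rceil>)"
  have "(\<lambda>n. real (J n) / r n) \<longlonglongrightarrow> T"
    unfolding J_def by (intro nat_floor_scaled_tendsto r_at_top tendsto_const T)
  from threshold_cost_tendsto[OF this]
  have "(\<lambda>n. threshold_cost p a \<gamma> (N n) (l n) (N n + J n) / r n) \<longlonglongrightarrow> zhat_opt p a \<gamma> m"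
    unfolding T(2) .
  thus ?thesis
  proof (rule Lim_transform_eventually)
    show "\<forall>\<^sub>F n in sequentially. threshold_cost p a \<gamma> (N n) (l n) (N n + J n) / r n =
      operating_cost p a \<gamma>
        (threshold_policy (ereal (real (N n)) + That_star p a \<gamma> m * ereal (r n))) (N n) (l n) / r n"
      using eventually_l
    proof eventually_elim
      case (elim n)
      have "nat \<lceil>real (N n) + T * r n\<rceil> = N n + J n"
        using T elim unfolding J_def by (intro nat_ceiling_of_nat_add mult_nonneg_nonneg) auto
      thus ?case
        using elim gamma_pos operating_cost_threshold_policy[of \<gamma> "l n" p a "real (N n) + T * r n" "N n"]
        by (simp add: That_star_eq True T_def)
    qed
  qed
next
  case False
  from opt_cost_tendsto[OF assms] show ?thesis
  proof (rule Lim_transform_eventually)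
    show "\<forall>\<^sub>F n in sequentially. opt_cost p a \<gamma> (N n) (l n) / r n =
      operating_cost p a \<gamma>
        (threshold_policy (ereal (real (N n)) + That_star p a \<gamma> m * ereal (r n))) (N n) (l n) / r n"
      using eventually_l
      by eventually_elim (use False gamma_pos assms in
        \<open>simp add: That_star_eq operating_cost_no_threshold\<close>)
  qed
qed

end

section \<open>Uniform bounds on the cost\<close>

text \<open>The proposed threshold is at least \<open>N\<close>, so the Erlang bound applies to
  finite ones; an infinite one is optimal for \<open>a \<le> p\<close> and hence no worse than
  threshold \<open>N\<close>. For \<open>l = 0\<close> the extended product of infinity and 0 is 0,
  and the cost vanishes whatever the threshold.\<close>

lemma star_cost_le:
  assumes "\<gamma> > 0" "0 < p" "0 < a" "l \<ge> 0"
  shows "operating_cost p a \<gamma> (threshold_policy (ereal (real N) + That_star p a \<gamma> m * ereal (sqrt l))) N l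
    \<le> max p a * (max 0 (l - real N) + sqrt l)"
proof (cases "l = 0")
  case True
  hence "operating_cost p a \<gamma> (threshold_policy (ereal (real N) + That_star p a \<gamma> m * ereal (sqrt l))) N l \<le> 0"
    using operating_cost_bounds(2)[OF assms(1,4) threshold_policy_routing, of p a] assms by fastforce
  also have "0 \<le> max p a * (max 0 (l - real N) + sqrt l)"
    using assms by (intro mult_nonneg_nonneg add_nonneg_nonneg) auto
  finally show ?thesis .
next
  case False
  hence l: "l > 0" using assms by simp
  have *: "threshold_cost p a \<gamma> N l (N + J) \<le> max p a * (max 0 (l - real N) + sqrt l)" for J
  proof -
    have "threshold_cost p a \<gamma> N l (N + J) \<le> max p a * erlang_loss \<gamma> N l"
      using assms l by (intro threshold_cost_le_erlang_loss) auto
    also have "\<dots> \<le> max p a * (max 0 (l - real N) + sqrt l)"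
      using assms by (intro mult_left_mono erlang_loss_le l) auto
    finally show ?thesis .
  qed
  show ?thesis
  proof (cases "p < a")
    case True
    define T where "T = That_fin p a \<gamma> m"
    have T: "T \<ge> 0" using That_fin[OF assms(1,2) True, of m] by (simp add: T_def)
    have "nat \<lceil>real N + T * sqrt l\<rceil> = N + nat \<lceil>T * sqrt l\<rceil>"
      using T l by (intro nat_ceiling_of_nat_add mult_nonneg_nonneg) auto
    thus ?thesis
      using operating_cost_threshold_policy[OF assms(1,4), of p a "real N + T * sqrt l" N] *
      by (simp add: That_star_eq True T_def)
  next
    case False
    hence "operating_cost p a \<gamma> (threshold_policy (ereal (real N) + That_star p a \<gamma> m * ereal (sqrt l))) N l
      = opt_cost p a \<gamma> N l"
      using l assms by (simp add: That_star_eq operating_cost_no_threshold)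
    also have "\<dots> \<le> threshold_cost p a \<gamma> N l (N + 0)"
      using assms by (intro opt_cost_le_threshold_cost) auto
    finally show ?thesis using *[of 0] by simp
  qed
qed

lemma opt_cost_le_bound:
  assumes "\<gamma> > 0" "0 < p" "0 < a" "l \<ge> 0"
  shows "opt_cost p a \<gamma> N l \<le> max p a * (max 0 (l - real N) + sqrt l)"
  using opt_cost_le[OF assms(1,4) _ _ threshold_policy_routing, of p a] star_cost_le[OF assms] assms
  by (meson less_imp_le order_trans)

section \<open>Random arrival rates\<close>

lemma arrival_rate_nonneg [simp]: "0 \<le> arrival_rate lam x"
  by (simp add: arrival_rate_def)

lemma measurable_arrival_rate [measurable]: "arrival_rate lam \<in> borel_measurable borel"
  unfolding arrival_rate_def by measurable

lemma arrival_rate_heavy_traffic: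
  assumes "\<gamma> > 0" and lam: "filterlim lam at_top sequentially"
    and N: "(\<lambda>n. (real (N n) - lam n) / sqrt (lam n)) \<longlonglongrightarrow> \<beta>"
  shows "heavy_traffic \<gamma> (\<beta> - x) (\<lambda>n. arrival_rate (lam n) x) N"
    and "(\<lambda>n. sqrt (arrival_rate (lam n) x) / sqrt (lam n)) \<longlonglongrightarrow> 1"
proof -
  have inv: "(\<lambda>n. 1 / sqrt (lam n)) \<longlonglongrightarrow> 0"
    by (intro real_tendsto_divide_at_top[OF tendsto_const] filterlim_compose[OF sqrt_at_top lam])
  have "(\<lambda>n. 1 + x * (1 / sqrt (lam n))) \<longlonglongrightarrow> 1 + x * 0" by (intro tendsto_intros inv)
  hence ratio: "(\<lambda>n. 1 + x * (1 / sqrt (lam n))) \<longlonglongrightarrow> 1" by simp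
  have pos: "\<forall>\<^sub>F n in sequentially. lam n > 0" using lam by (simp add: filterlim_at_top_dense)
  \<comment> \<open>Positivity of this factor makes the truncation in \<open>arrival_rate\<close>
    inactive; the value 1/2 is only a margin.\<close>
  have half: "\<forall>\<^sub>F n in sequentially. 1 + x * (1 / sqrt (lam n)) > 1 / 2"
    by (rule order_tendstoD(1)[OF ratio]) simp
  have eq: "arrival_rate (lam n) x = lam n * (1 + x * (1 / sqrt (lam n)))"
    if "lam n > 0" "1 + x * (1 / sqrt (lam n)) > 1 / 2" for n
  proof -
    have "lam n + x * sqrt (lam n) = lam n * (1 + x * (1 / sqrt (lam n)))"
    proof -
      have "lam n * (1 / sqrt (lam n)) = sqrt (lam n)" using that by (simp add: real_div_sqrt)
      thus ?thesis by (simp only: distrib_left mult.left_commute[of _ x] mult_1_right)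
    qed
    moreover have "0 \<le> lam n * (1 + x * (1 / sqrt (lam n)))" using that by (intro mult_nonneg_nonneg) linarith+
    ultimately show ?thesis by (simp add: arrival_rate_def)
  qed
  have sq: "\<forall>\<^sub>F n in sequentially. sqrt (1 + x * (1 / sqrt (lam n))) = sqrt (arrival_rate (lam n) x) / sqrt (lam n)"
    using pos half by eventually_elim (simp add: eq real_sqrt_mult)
  have "(\<lambda>n. sqrt (1 + x * (1 / sqrt (lam n)))) \<longlonglongrightarrow> sqrt 1"
    by (intro tendsto_real_sqrt ratio)
  hence "(\<lambda>n. sqrt (1 + x * (1 / sqrt (lam n)))) \<longlonglongrightarrow> 1" by simp
  from this sq show s1: "(\<lambda>n. sqrt (arrival_rate (lam n) x) / sqrt (lam n)) \<longlonglongrightarrow> 1"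
    by (rule Lim_transform_eventually)
  show "heavy_traffic \<gamma> (\<beta> - x) (\<lambda>n. arrival_rate (lam n) x) N"
  proof
    have "filterlim (\<lambda>n. (1 + x * (1 / sqrt (lam n))) * lam n) at_top sequentially"
      by (rule filterlim_tendsto_pos_mult_at_top[OF ratio _ lam]) simp
    thus "filterlim (\<lambda>n. arrival_rate (lam n) x) at_top sequentially"
    proof (rule filterlim_mono_eventually[OF _ order_refl order_refl])
      show "\<forall>\<^sub>F n in sequentially. (1 + x * (1 / sqrt (lam n))) * lam n = arrival_rate (lam n) x"
        using pos half by eventually_elim (simp only: eq mult.commute)
    qed
    have "(\<lambda>n. ((real (N n) - lam n) / sqrt (lam n) - x) / (sqrt (arrival_rate (lam n) x) / sqrt (lam n)))
        \<longlonglongrightarrow> (\<beta> - x) / 1"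
      by (intro tendsto_divide tendsto_diff N tendsto_const s1) simp
    hence "(\<lambda>n. ((real (N n) - lam n) / sqrt (lam n) - x) / (sqrt (arrival_rate (lam n) x) / sqrt (lam n)))
        \<longlonglongrightarrow> \<beta> - x" by simp
    thus "(\<lambda>n. (real (N n) - arrival_rate (lam n) x) / sqrt (arrival_rate (lam n) x)) \<longlonglongrightarrow> \<beta> - x"
    proof (rule Lim_transform_eventually)
      show "\<forall>\<^sub>F n in sequentially.
          ((real (N n) - lam n) / sqrt (lam n) - x) / (sqrt (arrival_rate (lam n) x) / sqrt (lam n)) =
          (real (N n) - arrival_rate (lam n) x) / sqrt (arrival_rate (lam n) x)"
        using pos half
      proof eventually_elim
        case (elim n)
        have "arrival_rate (lam n) x = lam n + x * sqrt (lam n)"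
        proof -
          have "lam n * (1 / sqrt (lam n)) = sqrt (lam n)" using elim by (simp add: real_div_sqrt)
          thus ?thesis unfolding eq[OF elim] by (simp only: distrib_left mult.left_commute[of _ x] mult_1_right)
        qed
        hence "real (N n) - arrival_rate (lam n) x = ((real (N n) - lam n) / sqrt (lam n) - x) * sqrt (lam n)"
        proof -
          have "(real (N n) - lam n) / sqrt (lam n) * sqrt (lam n) = real (N n) - lam n" using elim(1) by simp
          thus ?thesis unfolding \<open>arrival_rate (lam n) x = lam n + x * sqrt (lam n)\<close> left_diff_distrib
            by simp
        qed
        thus ?case by simp
      qed
    qed
  qed fact
qed

text \<open>With \<open>R = sqrt lam\<close>, the excess of arrivals over staffing is at most
  \<open>(\<bar>x\<bar> + \<bar>b\<bar>) * R\<close>, and the square root term at most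
  \<open>sqrt (1 + \<bar>x\<bar>) * R\<close>. Relaxing that root to
  \<open>1 + \<bar>x\<bar>\<close> keeps the bound affine in \<open>\<bar>x\<bar>\<close>, hence
  integrable.\<close>

lemma scaled_bound:
  assumes "lam \<ge> 1"
  shows "(max 0 (arrival_rate lam x - real N) + sqrt (arrival_rate lam x)) / sqrt lam
    \<le> 2 * \<bar>x\<bar> + 1 + \<bar>(real N - lam) / sqrt lam\<bar>"
proof -
  define b where "b = (real N - lam) / sqrt lam"
  have R: "sqrt lam \<ge> 1" "sqrt lam * sqrt lam = lam" using assms by auto
  have N: "real N = lam + b * sqrt lam" using R(1) by (simp add: b_def)
  have "\<bar>x\<bar> * sqrt lam \<ge> x * sqrt lam" "\<bar>b\<bar> * sqrt lam \<ge> - b * sqrt lam"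
    using R by (intro mult_right_mono; simp)+
  moreover have "0 \<le> \<bar>x\<bar> * sqrt lam" "0 \<le> \<bar>b\<bar> * sqrt lam" using R by auto
  moreover have "arrival_rate lam x - real N \<le> max (- real N) (x * sqrt lam - b * sqrt lam)"
    using N by (auto simp: arrival_rate_def max_def)
  ultimately have 1: "max 0 (arrival_rate lam x - real N) \<le> (\<bar>x\<bar> + \<bar>b\<bar>) * sqrt lam"
    by (simp add: distrib_right max_def split: if_splits)
  have "sqrt lam \<le> lam" using R by (metis mult_le_cancel_right1 mult.commute order_trans zero_le_one not_less)
  hence "x * sqrt lam \<le> \<bar>x\<bar> * lam" using R by (intro mult_mono) auto
  hence "arrival_rate lam x \<le> lam * (1 + \<bar>x\<bar>)"
    using assms by (auto simp: arrival_rate_def algebra_simps intro!: add_nonneg_nonneg)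
  hence "sqrt (arrival_rate lam x) \<le> sqrt lam * sqrt (1 + \<bar>x\<bar>)"
    by (simp add: real_sqrt_mult[symmetric])
  also have "sqrt (1 + \<bar>x\<bar>) \<le> 1 + \<bar>x\<bar>"
    by (intro real_le_lsqrt) (auto simp: power2_eq_square algebra_simps)
  finally have 2: "sqrt (arrival_rate lam x) \<le> (1 + \<bar>x\<bar>) * sqrt lam"
    using R by (simp add: mult.commute)
  have "max 0 (arrival_rate lam x - real N) + sqrt (arrival_rate lam x)
      \<le> (\<bar>x\<bar> + \<bar>b\<bar>) * sqrt lam + (1 + \<bar>x\<bar>) * sqrt lam"
    by (rule add_mono[OF 1 2])
  also have "\<dots> = (2 * \<bar>x\<bar> + 1 + \<bar>b\<bar>) * sqrt lam" by (simp add: algebra_simps)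
  finally have "max 0 (arrival_rate lam x - real N) + sqrt (arrival_rate lam x)
      \<le> (2 * \<bar>x\<bar> + 1 + \<bar>b\<bar>) * sqrt lam" .
  thus ?thesis using R by (simp add: pos_divide_le_eq b_def)
qed

text \<open>Stated for a general cost \<open>g\<close> so that it covers both the optimal cost and
  the cost of the proposed policy: their pointwise limits and dominating bounds are the
  same.\<close>

lemma (in prob_space) scaled_expectation_tendsto:
  assumes X: "integrable M X" and lam: "filterlim lam at_top sequentially"
    and N: "(\<lambda>n. (real (N n) - lam n) / sqrt (lam n)) \<longlonglongrightarrow> \<beta>"
    and meas: "\<And>n. g n \<in> borel_measurable borel"
    and nonneg: "\<And>n x. 0 \<le> g n x"
    and bound: "\<And>n x. g n x \<le> C * (max 0 (arrival_rate (lam n) x - real (N n)) + sqrt (arrival_rate (lam n) x))"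
    and lim: "\<And>x. (\<lambda>n. g n x / sqrt (arrival_rate (lam n) x)) \<longlonglongrightarrow> v (\<beta> - x)"
  shows "(\<lambda>n. (\<integral>\<omega>. g n (X \<omega>) \<partial>M) / sqrt (lam n)) \<longlonglongrightarrow> (\<integral>\<omega>. v (\<beta> - X \<omega>) \<partial>M)"
proof -
  note [measurable] = meas borel_measurable_integrable[OF X]
  have pos: "\<forall>\<^sub>F n in sequentially. lam n \<ge> 1" using lam by (simp add: filterlim_at_top)
  have lim': "(\<lambda>n. g n x / sqrt (lam n)) \<longlonglongrightarrow> v (\<beta> - x)" for x
  proof -
    have "(\<lambda>n. g n x / sqrt (arrival_rate (lam n) x) * (sqrt (arrival_rate (lam n) x) / sqrt (lam n)))
        \<longlonglongrightarrow> v (\<beta> - x) * 1"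
      by (intro tendsto_mult lim arrival_rate_heavy_traffic(2)[OF zero_less_one lam N])
    hence *: "(\<lambda>n. g n x / sqrt (arrival_rate (lam n) x) * (sqrt (arrival_rate (lam n) x) / sqrt (lam n)))
        \<longlonglongrightarrow> v (\<beta> - x)" by simp
    have "\<forall>\<^sub>F n in sequentially. arrival_rate (lam n) x \<ge> 1"
      using heavy_traffic.eventually_l[OF arrival_rate_heavy_traffic(1)[OF zero_less_one lam N]] .
    hence "\<forall>\<^sub>F n in sequentially.
        g n x / sqrt (arrival_rate (lam n) x) * (sqrt (arrival_rate (lam n) x) / sqrt (lam n)) = g n x / sqrt (lam n)"
      by eventually_elim (simp add: not_le[symmetric])
    with * show ?thesis by (rule Lim_transform_eventually)
  qed
  have C: "g n x \<le> \<bar>C\<bar> * (max 0 (arrival_rate (lam n) x - real (N n)) + sqrt (arrival_rate (lam n) x))" for n x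
    by (rule order_trans[OF bound]) (intro mult_right_mono; simp)
  have b: "\<forall>\<^sub>F n in sequentially. \<bar>(real (N n) - lam n) / sqrt (lam n)\<bar> < \<bar>\<beta>\<bar> + 1"
    by (rule order_tendstoD(2)[OF tendsto_rabs[OF N]]) simp
  have "(\<lambda>n. \<integral>\<omega>. g n (X \<omega>) / sqrt (lam n) \<partial>M) \<longlonglongrightarrow> (\<integral>\<omega>. v (\<beta> - X \<omega>) \<partial>M)"
  proof (rule integral_dominated_convergence_eventually)
    show "integrable M (\<lambda>\<omega>. \<bar>C\<bar> * (2 * \<bar>X \<omega>\<bar> + 1 + (\<bar>\<beta>\<bar> + 1)))"
      by (intro integrable_mult_right Bochner_Integration.integrable_add integrable_abs X integrable_const)
    show "AE \<omega> in M. (\<lambda>n. g n (X \<omega>) / sqrt (lam n)) \<longlonglongrightarrow> v (\<beta> - X \<omega>)"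
      using lim' by simp
    show "(\<lambda>\<omega>. v (\<beta> - X \<omega>)) \<in> borel_measurable M"
      by (rule borel_measurable_LIMSEQ_real[OF lim']) measurable
    show "\<forall>\<^sub>F n in sequentially. AE \<omega> in M. \<bar>g n (X \<omega>) / sqrt (lam n)\<bar>
        \<le> \<bar>C\<bar> * (2 * \<bar>X \<omega>\<bar> + 1 + (\<bar>\<beta>\<bar> + 1))"
      using pos b
    proof (eventually_elim, intro AE_I2)
      fix n \<omega> assume lam: "1 \<le> lam n" and b: "\<bar>(real (N n) - lam n) / sqrt (lam n)\<bar> < \<bar>\<beta>\<bar> + 1"
      let ?l = "arrival_rate (lam n) (X \<omega>)"
      have "\<bar>g n (X \<omega>) / sqrt (lam n)\<bar> = g n (X \<omega>) / sqrt (lam n)"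
        using nonneg[of n "X \<omega>"] lam by simp
      also have "\<dots> \<le> \<bar>C\<bar> * (max 0 (?l - real (N n)) + sqrt ?l) / sqrt (lam n)"
        using C lam by (intro divide_right_mono) auto
      also have "\<dots> = \<bar>C\<bar> * ((max 0 (?l - real (N n)) + sqrt ?l) / sqrt (lam n))" by simp
      also have "\<dots> \<le> \<bar>C\<bar> * (2 * \<bar>X \<omega>\<bar> + 1 + (\<bar>\<beta>\<bar> + 1))"
        using scaled_bound[OF lam, of "X \<omega>" "N n"] b by (intro mult_left_mono) linarith+
      finally show "\<bar>g n (X \<omega>) / sqrt (lam n)\<bar> \<le> \<bar>C\<bar> * (2 * \<bar>X \<omega>\<bar> + 1 + (\<bar>\<beta>\<bar> + 1))" .
    qed
  qed measurable
  thus ?thesis by simp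
qed

section \<open>Measurability\<close>

text \<open>Staffing \<open>n\<close> at mean rate \<open>n\<close> with realization
  \<open>- m\<close> is a heavy-traffic sequence with parameter \<open>m\<close>, which exhibits
  \<open>zhat_opt\<close> as a pointwise limit of measurable optimal costs.\<close>

lemma measurable_zhat_opt:
  assumes "\<gamma> > 0" "0 < p" "0 < a"
  shows "zhat_opt p a \<gamma> \<in> borel_measurable borel"
proof (rule borel_measurable_LIMSEQ_real)
  fix m :: real
  have N: "(\<lambda>n. (real n - real n) / sqrt (real n)) \<longlonglongrightarrow> 0" by simp
  have "(\<lambda>n. opt_cost p a \<gamma> n (arrival_rate (real n) (- m)) / sqrt (arrival_rate (real n) (- m))
      * (sqrt (arrival_rate (real n) (- m)) / sqrt (real n))) \<longlonglongrightarrow> zhat_opt p a \<gamma> (0 - (- m)) * 1"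
    by (intro tendsto_mult arrival_rate_heavy_traffic(2)[OF assms(1) filterlim_real_sequentially N]
        heavy_traffic.opt_cost_tendsto[OF arrival_rate_heavy_traffic(1)[OF assms(1) filterlim_real_sequentially N]] assms)
  thus "(\<lambda>n. opt_cost p a \<gamma> n (arrival_rate (real n) (- m)) / sqrt (arrival_rate (real n) (- m))
      * (sqrt (arrival_rate (real n) (- m)) / sqrt (real n))) \<longlonglongrightarrow> zhat_opt p a \<gamma> m" by simp
next
  fix n
  have "(\<lambda>m. opt_cost p a \<gamma> n (arrival_rate (real n) (- m))) \<in> borel_measurable borel"
    using assms by (intro measurable_opt_cost) auto
  thus "(\<lambda>m. opt_cost p a \<gamma> n (arrival_rate (real n) (- m)) / sqrt (arrival_rate (real n) (- m))
      * (sqrt (arrival_rate (real n) (- m)) / sqrt (real n))) \<in> borel_measurable borel"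
    by measurable
qed

text \<open>For \<open>p < a\<close> the defining equation can be solved for the threshold once its
  value \<open>zhat_opt\<close> is known, so the threshold inherits measurability from the
  cost.\<close>

lemma measurable_That_star:
  assumes "\<gamma> > 0" "0 < p" "0 < a"
  shows "That_star p a \<gamma> \<in> borel_measurable borel"
proof (cases "p < a")
  case True
  have "That_fin p a \<gamma> m = (zhat_opt p a \<gamma> m + p * m) / ((a - p) * \<gamma>)" for m
    using That_fin(2)[OF assms(1,2) True, of m] True assms(1) by (simp add: field_simps)
  hence "That_star p a \<gamma> = (\<lambda>m. ereal ((zhat_opt p a \<gamma> m + p * m) / ((a - p) * \<gamma>)))"
    by (simp add: That_star_eq True fun_eq_iff)
  thus ?thesis using measurable_zhat_opt[OF assms] by simp
next
  case False
  hence "That_star p a \<gamma> = (\<lambda>_. \<infinity>)" by (simp add: That_star_eq fun_eq_iff)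
  thus ?thesis by simp
qed

lemma admissible_star_policy:
  assumes "\<gamma> > 0" "0 < p" "0 < a"
  shows "admissible (star_policy p a \<gamma> \<beta>)"
proof -
  note [measurable] = measurable_That_star[OF assms]
  have "(\<lambda>x. threshold_policy (star_threshold p a \<gamma> \<beta> lam x) n) \<in> borel_measurable borel" for lam n
    unfolding threshold_policy_def star_threshold_def by measurable
  thus ?thesis by (simp add: admissible_def star_policy_def)
qed

lemma measurable_operating_cost:
  assumes "admissible u"
  shows "(\<lambda>x. operating_cost p a \<gamma> (snd u lam x) N (arrival_rate lam x)) \<in> borel_measurable borel"
proof -
  have [measurable]: "(\<lambda>x. snd u lam x n) \<in> borel_measurable borel" for n
    using assms by (simp add: admissible_def)
  show ?thesis
    unfolding operating_cost_def outsourcing_prob_def abandonment_rate_def stationary_prob_def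
      stationary_weight_def
    by measurable
qed

section \<open>Optimisation over staffing levels\<close>

locale staffing_problem = prob_space M for M :: "'a measure" +
  fixes X :: "'a \<Rightarrow> real" and c p a \<gamma> \<beta>s :: real
  assumes a_pos: "a > 0" and p_pos: "p > 0" and c_pos: "c > 0" and gamma_pos: "\<gamma> > 0"
    and c_less: "c < min a p"
    and X: "integrable M X" and mean_X: "(\<integral>\<omega>. X \<omega> \<partial>M) = 0"
    and \<beta>s: "\<And>\<beta>. limit_cost c p a \<gamma> M X \<beta>s \<le> limit_cost c p a \<gamma> M X \<beta>"
begin

definition expected_opt_cost :: "nat \<Rightarrow> real \<Rightarrow> real" where
  "expected_opt_cost N lam = (\<integral>\<omega>. opt_cost p a \<gamma> N (arrival_rate lam (X \<omega>)) \<partial>M)"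

lemma measurable_X [measurable]: "X \<in> borel_measurable M"
  using X by simp

lemma integrable_arrival_rate: "integrable M (\<lambda>\<omega>. arrival_rate lam (X \<omega>))"
  unfolding arrival_rate_def using X by simp

lemma limit_cost_eq:
  "limit_cost c p a \<gamma> M X \<beta> = c * \<beta> + (\<integral>\<omega>. zhat_opt p a \<gamma> (\<beta> - X \<omega>) \<partial>M)"
  by (simp add: limit_cost_def zhat_opt_def)

lemma measurable_opt_cost_arrival:
  "(\<lambda>x. opt_cost p a \<gamma> N (arrival_rate lam x)) \<in> borel_measurable borel"
  using a_pos p_pos gamma_pos by (intro measurable_opt_cost) auto

lemma operating_cost_arrival_bounds:
  assumes "\<pi> \<in> routing_policies"
  shows "0 \<le> operating_cost p a \<gamma> \<pi> N (arrival_rate lam x)"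
    "operating_cost p a \<gamma> \<pi> N (arrival_rate lam x) \<le> (p + a) * arrival_rate lam x"
    "opt_cost p a \<gamma> N (arrival_rate lam x) \<le> operating_cost p a \<gamma> \<pi> N (arrival_rate lam x)"
    "0 \<le> opt_cost p a \<gamma> N (arrival_rate lam x)"
  using assms a_pos p_pos gamma_pos
  by (auto intro!: operating_cost_bounds opt_cost_le opt_cost_nonneg)

lemma integrable_operating_cost:
  assumes "admissible u"
  shows "integrable M (\<lambda>\<omega>. operating_cost p a \<gamma> (snd u lam (X \<omega>)) N (arrival_rate lam (X \<omega>)))"
proof (rule Bochner_Integration.integrable_bound)
  show "integrable M (\<lambda>\<omega>. (p + a) * arrival_rate lam (X \<omega>))"
    using integrable_arrival_rate by simp
  show "(\<lambda>\<omega>. operating_cost p a \<gamma> (snd u lam (X \<omega>)) N (arrival_rate lam (X \<omega>))) \<in> borel_measurable M"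
    using measurable_compose[OF measurable_X measurable_operating_cost[OF assms]] .
  have "snd u lam x \<in> routing_policies" for x using assms by (simp add: admissible_def)
  thus "AE \<omega> in M. norm (operating_cost p a \<gamma> (snd u lam (X \<omega>)) N (arrival_rate lam (X \<omega>)))
      \<le> norm ((p + a) * arrival_rate lam (X \<omega>))"
    using operating_cost_arrival_bounds a_pos p_pos by (intro AE_I2) simp
qed

lemma integrable_opt_cost: "integrable M (\<lambda>\<omega>. opt_cost p a \<gamma> N (arrival_rate lam (X \<omega>)))"
proof (rule Bochner_Integration.integrable_bound)
  show "integrable M (\<lambda>\<omega>. (p + a) * arrival_rate lam (X \<omega>))"
    using integrable_arrival_rate by simp
  show "(\<lambda>\<omega>. opt_cost p a \<gamma> N (arrival_rate lam (X \<omega>))) \<in> borel_measurable M"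
    using measurable_compose[OF measurable_X measurable_opt_cost_arrival] .
  show "AE \<omega> in M. norm (opt_cost p a \<gamma> N (arrival_rate lam (X \<omega>))) \<le> norm ((p + a) * arrival_rate lam (X \<omega>))"
    using order_trans[OF operating_cost_arrival_bounds(3)[OF free_policy] operating_cost_arrival_bounds(2)[OF free_policy]]
      operating_cost_arrival_bounds(4)[OF free_policy] a_pos p_pos
    by (intro AE_I2) simp
qed

lemma expected_opt_cost_nonneg: "0 \<le> expected_opt_cost N lam"
  unfolding expected_opt_cost_def
  by (intro Bochner_Integration.integral_nonneg operating_cost_arrival_bounds(4)[OF free_policy])

text \<open>The fluid bound is affine in the arrival rate and \<open>X\<close> has mean 0, so no
  term in \<open>X\<close> remains in its expectation. The truncation at 0 only raises the arrival
  rate.\<close>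

lemma expected_opt_cost_ge_fluid:
  "min p a * (lam - real N) \<le> expected_opt_cost N lam"
proof -
  have "min p a * (lam - real N) = (\<integral>\<omega>. min p a * (lam + X \<omega> * sqrt lam - real N) \<partial>M)"
    using X mean_X by (simp add: prob_space)
  also have "\<dots> \<le> expected_opt_cost N lam"
    unfolding expected_opt_cost_def
  proof (intro integral_mono integrable_opt_cost)
    show "integrable M (\<lambda>\<omega>. min p a * (lam + X \<omega> * sqrt lam - real N))" using X by simp
    fix \<omega>
    have "min p a * (lam + X \<omega> * sqrt lam - real N) \<le> min p a * (arrival_rate lam (X \<omega>) - real N)"
      using a_pos p_pos by (intro mult_left_mono) (auto simp: arrival_rate_def)
    also have "\<dots> \<le> opt_cost p a \<gamma> N (arrival_rate lam (X \<omega>))"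
      using a_pos p_pos gamma_pos by (intro opt_cost_ge threshold_cost_ge_fluid) auto
    finally show "min p a * (lam + X \<omega> * sqrt lam - real N) \<le> opt_cost p a \<gamma> N (arrival_rate lam (X \<omega>))" .
  qed
  finally show ?thesis .
qed

lemma scale_cost:
  assumes "lam > 0"
  shows "sqrt lam * ((c * real N + E) / lam - c) = c * ((real N - lam) / sqrt lam) + E / sqrt lam"
proof -
  define R where "R = sqrt lam"
  have "R > 0" "lam = R * R" using assms by (auto simp: R_def)
  thus ?thesis unfolding R_def[symmetric] by (simp add: field_simps)
qed

lemma scaled_opt_cost_tendsto:
  assumes lam: "filterlim lam at_top sequentially"
    and N: "(\<lambda>n. (real (N n) - lam n) / sqrt (lam n)) \<longlonglongrightarrow> \<beta>"
  shows "(\<lambda>n. c * ((real (N n) - lam n) / sqrt (lam n)) + expected_opt_cost (N n) (lam n) / sqrt (lam n))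
    \<longlonglongrightarrow> limit_cost c p a \<gamma> M X \<beta>"
  unfolding limit_cost_eq expected_opt_cost_def
proof (intro tendsto_add tendsto_mult tendsto_const N
    scaled_expectation_tendsto[where C = "max p a" and g = "\<lambda>n x. opt_cost p a \<gamma> (N n) (arrival_rate (lam n) x)"])
  fix x
  show "(\<lambda>n. opt_cost p a \<gamma> (N n) (arrival_rate (lam n) x) / sqrt (arrival_rate (lam n) x))
      \<longlonglongrightarrow> zhat_opt p a \<gamma> (\<beta> - x)"
    by (intro heavy_traffic.opt_cost_tendsto arrival_rate_heavy_traffic gamma_pos lam N a_pos p_pos)
qed (auto intro!: opt_cost_le_bound measurable_opt_cost_arrival operating_cost_arrival_bounds(4)[OF free_policy]
      gamma_pos X lam N a_pos p_pos)

text \<open>Staffing levels whose scaled cost stays bounded are within \<open>O(sqrt lam)\<close> of \<open>lam\<close>: overstaffing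
  costs \<open>c\<close> and understaffing \<open>min p a - c\<close> per server, so a convergent subsequence exists.\<close>

lemma eventually_scaled_opt_cost_gt:
  fixes N :: "real \<Rightarrow> nat"
  assumes C: "C < limit_cost c p a \<gamma> M X \<beta>s"
  shows "\<forall>\<^sub>F lam in at_top. C < sqrt lam * ((c * real (N lam) + expected_opt_cost (N lam) lam) / lam - c)"
proof (rule ccontr)
  assume "\<not> ?thesis"
  \<comment> \<open>Failure along \<open>at_top\<close> yields a sequence of mean arrival rates, at
    least \<open>n + 1\<close> at index \<open>n\<close>, on which the scaled cost stays at most
    \<open>C\<close>. Its limit along a subsequence would undercut the minimum.\<close>
  hence "\<exists>lam \<ge> real (Suc n). sqrt lam * ((c * real (N lam) + expected_opt_cost (N lam) lam) / lam - c) \<le> C" for n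
    unfolding eventually_at_top_linorder by (metis not_less)
  then obtain lam where lam: "\<And>n. lam n \<ge> real (Suc n)"
    and le: "\<And>n. sqrt (lam n) * ((c * real (N (lam n)) + expected_opt_cost (N (lam n)) (lam n)) / lam n - c) \<le> C"
    by metis
  define b where "b = (\<lambda>n. (real (N (lam n)) - lam n) / sqrt (lam n))"
  have pos: "lam n > 0" for n using lam[of n] by (rule less_le_trans[rotated]) simp
  have le': "c * b n + expected_opt_cost (N (lam n)) (lam n) / sqrt (lam n) \<le> C" for n
    using le[of n] unfolding scale_cost[OF pos] b_def .
  have lam_top: "filterlim lam at_top sequentially"
  proof (rule filterlim_at_top_mono[OF filterlim_real_sequentially])
    show "\<forall>\<^sub>F n in sequentially. real n \<le> lam n"
      using lam by (intro always_eventually allI order_trans[OF _ lam]) simp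
  qed
  define d where "d = min p a - c"
  have d: "d > 0" using c_less by (simp add: d_def)
  have "\<bar>b n\<bar> \<le> \<bar>C\<bar> / c + \<bar>C\<bar> / d" for n
  proof -
    have "c * b n \<le> C"
    proof -
      have "0 \<le> expected_opt_cost (N (lam n)) (lam n) / sqrt (lam n)"
        using pos[of n] by (intro divide_nonneg_nonneg expected_opt_cost_nonneg) simp
      thus ?thesis using le'[of n] by linarith
    qed
    hence "b n \<le> C / c" using c_pos by (simp add: field_simps)
    also have "\<dots> \<le> \<bar>C\<bar> / c" using c_pos by (simp add: divide_right_mono)
    finally have up: "b n \<le> \<bar>C\<bar> / c" .
    have "min p a * (- b n) = min p a * (lam n - real (N (lam n))) / sqrt (lam n)"
      by (simp add: b_def minus_divide_left[symmetric] flip: minus_divide_left)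
        (simp add: algebra_simps diff_divide_distrib)
    also have "\<dots> \<le> expected_opt_cost (N (lam n)) (lam n) / sqrt (lam n)"
      using pos[of n] by (intro divide_right_mono expected_opt_cost_ge_fluid) auto
    finally have "d * (- b n) \<le> C" using le'[of n] by (simp add: d_def algebra_simps)
    hence "- b n \<le> C / d" using d by (simp add: field_simps)
    also have "\<dots> \<le> \<bar>C\<bar> / d" using d by (simp add: divide_right_mono)
    finally have "- b n \<le> \<bar>C\<bar> / d" .
    moreover have "0 \<le> \<bar>C\<bar> / c" "0 \<le> \<bar>C\<bar> / d" using c_pos d by auto
    ultimately show ?thesis using up by linarith
  qed
  hence "bounded (range b)" by (auto simp: bounded_iff)
  then obtain \<beta> s where s: "strict_mono s" "(b \<circ> s) \<longlonglongrightarrow> \<beta>"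
    using bounded_imp_convergent_subsequence by blast
  have "(\<lambda>n. c * ((real (N (lam (s n))) - lam (s n)) / sqrt (lam (s n))) +
      expected_opt_cost (N (lam (s n))) (lam (s n)) / sqrt (lam (s n))) \<longlonglongrightarrow> limit_cost c p a \<gamma> M X \<beta>"
  proof (rule scaled_opt_cost_tendsto)
    show "filterlim (\<lambda>n. lam (s n)) at_top sequentially"
      by (rule filterlim_compose[OF lam_top filterlim_subseq[OF s(1)]])
    show "(\<lambda>n. (real (N (lam (s n))) - lam (s n)) / sqrt (lam (s n))) \<longlonglongrightarrow> \<beta>"
      using s(2) by (simp add: b_def o_def)
  qed
  hence "limit_cost c p a \<gamma> M X \<beta> \<le> C"
    by (rule LIMSEQ_le_const2) (use le' in \<open>auto simp: b_def\<close>)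
  with \<beta>s[of \<beta>] C show False by simp
qed

lemma total_cost_ge:
  assumes "admissible u"
  shows "c * real (fst u lam) + expected_opt_cost (fst u lam) lam \<le> total_cost c p a \<gamma> M X u lam"
proof -
  have "snd u lam x \<in> routing_policies" for x using assms by (simp add: admissible_def)
  thus ?thesis
    unfolding total_cost_def expected_opt_cost_def
    by (intro add_left_mono integral_mono integrable_opt_cost integrable_operating_cost assms
        operating_cost_arrival_bounds)
qed

lemma eventually_scaled_cost_gt:
  assumes "admissible u" "C < limit_cost c p a \<gamma> M X \<beta>s"
  shows "\<forall>\<^sub>F lam in at_top. C < scaled_cost c p a \<gamma> M X u lam"
  using eventually_scaled_opt_cost_gt[OF assms(2), of "fst u"] eventually_gt_at_top[of 0]
proof eventually_elim
  case (elim lam)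
  have "sqrt lam * ((c * real (fst u lam) + expected_opt_cost (fst u lam) lam) / lam - c)
      \<le> scaled_cost c p a \<gamma> M X u lam"
    unfolding scaled_cost_def using elim total_cost_ge[OF assms(1), of lam]
    by (intro mult_left_mono diff_right_mono divide_right_mono) auto
  thus ?case using elim by simp
qed

lemma star_staffing_tendsto:
  assumes lam: "filterlim lam at_top sequentially"
  shows "(\<lambda>n. (real (star_staffing \<beta> (lam n)) - lam n) / sqrt (lam n)) \<longlonglongrightarrow> \<beta>"
proof -
  have s: "filterlim (\<lambda>n. sqrt (lam n)) at_top sequentially"
    by (rule filterlim_compose[OF sqrt_at_top lam])
  have inv: "(\<lambda>n. 1 / sqrt (lam n)) \<longlonglongrightarrow> 0"
    by (intro real_tendsto_divide_at_top[OF tendsto_const] s)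
  \<comment> \<open>The bound \<open>\<bar>\<beta>\<bar>\<close> makes
    \<open>lam + \<beta> * sqrt lam\<close> nonnegative, so \<open>nat\<close> does not truncate and
    only the rounding error remains.\<close>
  have pos: "\<forall>\<^sub>F n in sequentially. sqrt (lam n) \<ge> max 1 \<bar>\<beta>\<bar>"
    using s unfolding filterlim_at_top by blast
  have "(\<lambda>n. (real (star_staffing \<beta> (lam n)) - lam n) / sqrt (lam n) - \<beta>) \<longlonglongrightarrow> 0"
  proof (rule Lim_null_comparison[OF _ inv])
    show "\<forall>\<^sub>F n in sequentially. norm ((real (star_staffing \<beta> (lam n)) - lam n) / sqrt (lam n) - \<beta>) \<le> 1 / sqrt (lam n)"
      using pos
    proof eventually_elim
      case (elim n)
      define R where "R = sqrt (lam n)"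
      have R: "R \<ge> 1" "R \<ge> \<bar>\<beta>\<bar>" using elim by (auto simp: R_def)
      have lam: "lam n = R * R"
      proof -
        have "lam n > 0" using elim by (metis max.bounded_iff real_sqrt_gt_0_iff zero_less_one less_le_trans)
        thus ?thesis by (simp add: R_def)
      qed
      have "0 \<le> R * (R + \<beta>)" using R by (intro mult_nonneg_nonneg) linarith+
      hence "0 \<le> R * R + \<beta> * R" by (simp add: algebra_simps)
      hence "\<bar>real (nat (round (R * R + \<beta> * R))) - (R * R + \<beta> * R)\<bar> \<le> 1"
        using of_int_round_abs_le[of "R * R + \<beta> * R"] round_mono[of 0 "R * R + \<beta> * R"] by simp
      moreover have "(real (star_staffing \<beta> (lam n)) - lam n) / R - \<beta> =
          (real (nat (round (R * R + \<beta> * R))) - (R * R + \<beta> * R)) / R"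
        unfolding star_staffing_def R_def[symmetric] lam using R(1) by (simp add: field_simps)
      ultimately show ?case unfolding R_def[symmetric] using R(1)
        by (simp add: divide_right_mono)
    qed
  qed
  thus ?thesis by (simp add: LIM_zero_iff)
qed

text \<open>The limit along the reals is tested on arbitrary sequences tending to infinity, since
  dominated convergence is used for sequences.\<close>

lemma scaled_cost_star_tendsto:
  "(scaled_cost c p a \<gamma> M X (star_policy p a \<gamma> \<beta>s) \<longlongrightarrow> limit_cost c p a \<gamma> M X \<beta>s) at_top"
proof (rule tendsto_at_topI_sequentially)
  fix lam :: "nat \<Rightarrow> real" assume lam: "filterlim lam at_top sequentially"
  define N where "N = (\<lambda>n. star_staffing \<beta>s (lam n))"
  define g where "g = (\<lambda>n x. operating_cost p a \<gamma>
    (threshold_policy (star_threshold p a \<gamma> \<beta>s (lam n) x)) (N n) (arrival_rate (lam n) x))"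
  have N_eq: "star_staffing \<beta>s (lam n) = N n" for n by (simp add: N_def)
  have N: "(\<lambda>n. (real (N n) - lam n) / sqrt (lam n)) \<longlonglongrightarrow> \<beta>s"
    unfolding N_def by (rule star_staffing_tendsto[OF lam])
  have "(\<lambda>n. c * ((real (N n) - lam n) / sqrt (lam n)) + (\<integral>\<omega>. g n (X \<omega>) \<partial>M) / sqrt (lam n))
      \<longlonglongrightarrow> limit_cost c p a \<gamma> M X \<beta>s"
    unfolding limit_cost_eq
  proof (intro tendsto_add tendsto_mult tendsto_const N scaled_expectation_tendsto[where C = "max p a" and N = N])
    fix n x
    show "(\<lambda>n. g n x / sqrt (arrival_rate (lam n) x)) \<longlonglongrightarrow> zhat_opt p a \<gamma> (\<beta>s - x)"
      unfolding g_def star_threshold_def N_eq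
      by (intro heavy_traffic.star_cost_tendsto arrival_rate_heavy_traffic gamma_pos lam N a_pos p_pos)
    show "g n x \<le> max p a * (max 0 (arrival_rate (lam n) x - real (N n)) + sqrt (arrival_rate (lam n) x))"
      unfolding g_def star_threshold_def N_def
      by (intro star_cost_le gamma_pos a_pos p_pos) simp
    show "0 \<le> g n x" unfolding g_def by (intro operating_cost_arrival_bounds) simp
    show "g n \<in> borel_measurable borel"
      using measurable_operating_cost[OF admissible_star_policy[OF gamma_pos p_pos a_pos], of p a \<gamma> \<beta>s "lam n" "N n"]
      by (simp add: g_def star_policy_def)
  qed (use gamma_pos X lam in auto)
  thus "(\<lambda>n. scaled_cost c p a \<gamma> M X (star_policy p a \<gamma> \<beta>s) (lam n)) \<longlonglongrightarrow> limit_cost c p a \<gamma> M X \<beta>s"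
  proof (rule Lim_transform_eventually)
    have "\<forall>\<^sub>F n in sequentially. lam n > 0" using lam by (simp add: filterlim_at_top_dense)
    thus "\<forall>\<^sub>F n in sequentially. c * ((real (N n) - lam n) / sqrt (lam n)) + (\<integral>\<omega>. g n (X \<omega>) \<partial>M) / sqrt (lam n)
        = scaled_cost c p a \<gamma> M X (star_policy p a \<gamma> \<beta>s) (lam n)"
    proof eventually_elim
      case (elim n)
      show ?case
        unfolding scaled_cost_def total_cost_def star_policy_def fst_conv snd_conv scale_cost[OF elim]
        by (simp add: N_def g_def)
    qed
  qed
qed

lemma min_cost_eq: "min_cost c p a \<gamma> M X lam = (INF N. c * real N + expected_opt_cost N lam)"
  by (simp add: min_cost_def expected_opt_cost_def opt_cost_def)

lemma bdd_below_cost: "bdd_below (range (\<lambda>N. c * real N + expected_opt_cost N lam))"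
  using c_pos expected_opt_cost_nonneg by (intro bdd_belowI[of _ 0]) auto

text \<open>The lower bound on scaled costs holds for staffing levels that depend arbitrarily on
  \<open>lam\<close>, in particular for near-minimisers, while the proposed policy attains the same
  limit.\<close>

lemma star_cost_minus_min_cost_tendsto:
  "((\<lambda>lam. (total_cost c p a \<gamma> M X (star_policy p a \<gamma> \<beta>s) lam - min_cost c p a \<gamma> M X lam) / sqrt lam)
     \<longlongrightarrow> 0) at_top"
proof -
  let ?u = "star_policy p a \<gamma> \<beta>s" and ?L = "limit_cost c p a \<gamma> M X \<beta>s"
  define f where "f = (\<lambda>lam. (total_cost c p a \<gamma> M X ?u lam - min_cost c p a \<gamma> M X lam) / sqrt lam)"
  \<comment> \<open>A slack of 1 in the choice of a near-minimiser becomes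
    \<open>1 / sqrt lam\<close> after scaling and vanishes in the limit.\<close>
  have "\<exists>N. c * real N + expected_opt_cost N lam < min_cost c p a \<gamma> M X lam + 1" for lam
    using cInf_lessD[of "range (\<lambda>N. c * real N + expected_opt_cost N lam)" "min_cost c p a \<gamma> M X lam + 1"]
    by (auto simp: min_cost_eq)
  then obtain N where N: "\<And>lam. c * real (N lam) + expected_opt_cost (N lam) lam < min_cost c p a \<gamma> M X lam + 1"
    by metis
  have inv: "((\<lambda>lam. 1 / sqrt lam) \<longlongrightarrow> 0) at_top"
    by (intro real_tendsto_divide_at_top[OF tendsto_const] sqrt_at_top)
  have "(f \<longlongrightarrow> 0) at_top"
  proof (rule order_tendstoI)
    fix y :: real assume "y < 0"
    moreover have "0 \<le> f lam" if "lam > 0" for lam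
    proof -
      have "min_cost c p a \<gamma> M X lam \<le> c * real (fst ?u lam) + expected_opt_cost (fst ?u lam) lam"
        unfolding min_cost_eq by (intro cINF_lower bdd_below_cost) simp
      also have "\<dots> \<le> total_cost c p a \<gamma> M X ?u lam"
        by (intro total_cost_ge admissible_star_policy gamma_pos p_pos a_pos)
      finally show ?thesis using that by (simp add: f_def)
    qed
    ultimately show "\<forall>\<^sub>F lam in at_top. y < f lam"
      by (intro eventually_mono[OF eventually_gt_at_top[of 0]]) (rule less_le_trans)
  next
    fix y :: real assume y: "0 < y"
    have "\<forall>\<^sub>F lam in at_top. scaled_cost c p a \<gamma> M X ?u lam < ?L + y / 3"
      by (rule order_tendstoD(2)[OF scaled_cost_star_tendsto]) (use y in simp)
    moreover have "\<forall>\<^sub>F lam in at_top. ?L - y / 3 <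
        sqrt lam * ((c * real (N lam) + expected_opt_cost (N lam) lam) / lam - c)"
      by (rule eventually_scaled_opt_cost_gt) (use y in simp)
    moreover have "\<forall>\<^sub>F lam in at_top. 1 / sqrt lam < y / 3"
      by (rule order_tendstoD(2)[OF inv]) (use y in simp)
    ultimately show "\<forall>\<^sub>F lam in at_top. f lam < y"
      using eventually_gt_at_top[of 0]
    proof eventually_elim
      case (elim lam)
      define R where "R = sqrt lam"
      have R: "R > 0" "lam = R * R" using elim by (auto simp: R_def)
      have *: "sqrt lam * (t / lam - c) = t / R - c * R" for t
        unfolding R_def[symmetric] R(2) using R(1) by (simp add: field_simps)
      have "min_cost c p a \<gamma> M X lam / R \<ge> (c * real (N lam) + expected_opt_cost (N lam) lam) / R - 1 / R"
        using N[of lam] R(1) by (simp add: diff_divide_distrib[symmetric] divide_right_mono)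
      moreover have "total_cost c p a \<gamma> M X ?u lam / R - c * R < ?L + y / 3"
        using elim(1) unfolding scaled_cost_def * .
      moreover have "?L - y / 3 < (c * real (N lam) + expected_opt_cost (N lam) lam) / R - c * R"
        using elim(2) unfolding * .
      moreover have "1 / R < y / 3" using elim(3) by (simp add: R_def)
      ultimately have "total_cost c p a \<gamma> M X ?u lam / R - min_cost c p a \<gamma> M X lam / R < y"
        by linarith
      thus ?case by (simp add: f_def R_def diff_divide_distrib)
    qed
  qed
  thus ?thesis by (simp add: f_def)
qed

end

theorem theorem2:
  fixes a p c \<gamma> \<beta>s :: real
    and M :: "'a measure" and X :: "'a \<Rightarrow> real"
  assumes "a > 0" and "p > 0" and "c > 0" and "\<gamma> > 0"
    and "c < min a p"
    and "prob_space M"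
    and "integrable M X"
    and "(\<integral>\<omega>. X \<omega> \<partial>M) = 0"
    and "\<forall>\<^sub>F lam in at_top. AE \<omega> in M. X \<omega> \<ge> - sqrt lam"
    and "\<forall>\<beta>. limit_cost c p a \<gamma> M X \<beta>s \<le> limit_cost c p a \<gamma> M X \<beta>"
  shows "asymptotically_optimal c p a \<gamma> M X (star_policy p a \<gamma> \<beta>s)
    \<and> (\<forall>u. admissible u \<longrightarrow>
          ereal (limit_cost c p a \<gamma> M X \<beta>s)
            \<le> Liminf at_top (\<lambda>lam. ereal (scaled_cost c p a \<gamma> M X u lam)))
    \<and> ((\<lambda>lam. (total_cost c p a \<gamma> M X (star_policy p a \<gamma> \<beta>s) lam
                - min_cost c p a \<gamma> M X lam) / sqrt lam) \<longlongrightarrow> 0) at_top"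
proof -
  interpret staffing_problem M X c p a \<gamma> \<beta>s
    using assms by (intro staffing_problem.intro staffing_problem_axioms.intro) auto
  let ?L = "limit_cost c p a \<gamma> M X \<beta>s"
  have lower: "ereal ?L \<le> Liminf at_top (\<lambda>lam. ereal (scaled_cost c p a \<gamma> M X u lam))"
    if "admissible u" for u
    \<comment> \<open>The subsequence argument excludes every real level strictly below the limiting
      cost, and this characterisation of the liminf asks for exactly such levels.\<close>
    unfolding le_Liminf_iff
  proof (intro allI impI)
    fix y assume y: "y < ereal ?L"
    show "\<forall>\<^sub>F lam in at_top. y < ereal (scaled_cost c p a \<gamma> M X u lam)"
      using y eventually_scaled_cost_gt[OF that] by (cases y) auto
  qed
  have "((\<lambda>lam. ereal (scaled_cost c p a \<gamma> M X (star_policy p a \<gamma> \<beta>s) lam)) \<longlongrightarrow> ereal ?L) at_top"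
    using scaled_cost_star_tendsto by simp
  hence "Limsup at_top (\<lambda>lam. ereal (scaled_cost c p a \<gamma> M X (star_policy p a \<gamma> \<beta>s) lam)) = ereal ?L"
    by (intro lim_imp_Limsup) simp_all
  with lower have "asymptotically_optimal c p a \<gamma> M X (star_policy p a \<gamma> \<beta>s)"
    using admissible_star_policy[OF assms(4,2,1)] by (simp add: asymptotically_optimal_def)
  with lower star_cost_minus_min_cost_tendsto show ?thesis by blast
qed

end
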